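(* Let the setting be as in the context, with $0<\sigma<\infty$. Let $f\equiv0$ and let $g\in C^{0,1}(\partial\Omega)$ satisfy the bounded slope condition of rank $K<\sigma$ on $\partial\Omega$. Let $u$ be the minimizer of $F$ on $S_g$ and, for $n\ge2$, let $u_n$ be the minimizer of the truncated energy $$F_n(v)=\sum_{p=2}^{n}\frac{a_p}{p}\int_\Omega|\nabla v|^p-\int_\Omega fv$$ among $v\in W^{1,n}(\Omega)$ with $v-\bar g\in W^{1,n}_0(\Omega)$. Then $$\|\nabla u\|_{L^\infty(\Omega)}\le K<\sigma\qquad\text{and}\qquad\|\nabla u_n\|_{L^\infty(\Omega)}\le K<\sigma\quad\text{for every }n\ge2 .$$ In particular $u$ is a weak solution of $-\sum_{p=2}^\infty a_p\Delta_pu=f$ in $\Omega$, $u=g$ on $\partial\Omega$, and $u_n$ is a weak solution of the truncated problem $-\sum_{p=2}^{n}a_p\Delta_pu_n=f$ in $\Omega$, $u_n=g$ on $\partial\Omega$.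
   Context: $\Omega\subset\mathbb{R}^N$ ($N\ge1$) is a bounded, connected, open set with Lipschitz boundary. $\{a_p\}_{p\ge2}$ ($p$ integer) is a real sequence with $a_p\ge0$ for all $p$, $a_2>0$, and $a_p\ne0$ for infinitely many $p$; $\sigma$ is defined by $1/\sigma=\limsup_{p\to\infty}a_p^{1/p}$. Put $\Phi(t)=\sum_{p\ge2}\frac{a_p}{p}t^p\in[0,+\infty]$ for $t\in[0,\sigma]$, and $G(\xi)=\Phi(|\xi|)$ if $|\xi|\le\sigma$, $G(\xi)=+\infty$ if $|\xi|>\sigma$. Put $S_g=\{v\in C^{0,1}(\overline\Omega):\ \|\nabla v\|_{L^\infty(\Omega)}\le\sigma,\ v=g\text{ on }\partial\Omega\}$; for $v\in S_g$, $F(v)=\int_\Omega G(\nabla v)-\int_\Omega fv\in(-\infty,+\infty]$. $\bar g$ denotes a Lipschitz extension of $g$ to $\overline\Omega$ belonging to $S_g$ with $F(\bar g)<\infty$. $g$ satisfies the bounded slope condition (BSC) of rank $K>0$ on $\partial\Omega$ if for every $y\in\partial\Omega$ there exist affine functions $\ell^\pm_y$ with $\ell^-_y(y)=g(y)=\ell^+_y(y)$, $\ell^-_y\le g\le\ell^+_y$ on $\partial\Omega$, and $|\nabla\ell^\pm_y|\le K$. Here $\Delta_pu=\operatorname{div}(|\nabla u|^{p-2}\nabla u)$. A function $u\in S_g$ is a weak solution of the (non-truncated) Dirichlet problem if $\sum_{p=2}^{\infty}a_p\int_\Omega|\nabla u|^{p-2}\nabla u\cdot\nabla\psi=\int_\Omega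 f\psi$ for every $\psi\in W^{1,\infty}_0(\Omega)$ (Lipschitz functions on $\overline\Omega$ vanishing on $\partial\Omega$) for which the series on the left is absolutely convergent, i.e. $\sum_pa_p\big|\int_\Omega|\nabla u|^{p-2}\nabla u\cdot\nabla\psi\big|<\infty$; weak solutions of the truncated problem are understood analogously with the finite sum over $2\le p\le n$. *)

theory Defs
  imports "HOL-Analysis.Analysis" "HOL-Probability.Essential_Supremum"
begin

text \<open>
  Euclidean space is an arbitrary type of class \<open>euclidean_space\<close>. Sobolev and Lipschitz functions
  are total functions of which only the values on \<open>\<Omega>\<close> (respectively on its closure) matter; all
  integrals over \<open>\<Omega>\<close> are taken with respect to \<open>lebesgue_on \<Omega>\<close>.
\<close>

text \<open>Around each boundary point, \<open>\<Omega>\<close> is the part of a ball lying strictly above the graph, in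
  some direction \<open>e\<close>, of a Lipschitz function on the hyperplane orthogonal to \<open>e\<close>.\<close>

definition lipschitz_boundary :: "'a::euclidean_space set \<Rightarrow> bool" where
  "lipschitz_boundary \<Omega> \<longleftrightarrow>
     (\<forall>x0\<in>frontier \<Omega>. \<exists>r>0. \<exists>e \<gamma> L. norm e = 1 \<and> L-lipschitz_on {y. y \<bullet> e = 0} \<gamma> \<and>
        \<Omega> \<inter> ball x0 r = {x \<in> ball x0 r. \<gamma> (x - (x \<bullet> e) *\<^sub>R e) < x \<bullet> e})"

definition C01 :: "'a::euclidean_space set \<Rightarrow> ('a \<Rightarrow> real) \<Rightarrow> bool" where
  "C01 S v \<longleftrightarrow> (\<exists>L. L-lipschitz_on S v)"


subsection \<open>Weak gradients and Sobolev spaces\<close>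

primrec times_cont_diff :: "nat \<Rightarrow> ('a::euclidean_space \<Rightarrow> real) \<Rightarrow> bool" where
  "times_cont_diff 0 \<phi> \<longleftrightarrow> continuous_on UNIV \<phi>"
| "times_cont_diff (Suc k) \<phi> \<longleftrightarrow>
     (\<exists>D. (\<forall>x. GDERIV \<phi> x :> D x) \<and> (\<forall>b\<in>Basis. times_cont_diff k (\<lambda>x. D x \<bullet> b)))"

definition test_function :: "'a::euclidean_space set \<Rightarrow> ('a \<Rightarrow> real) \<Rightarrow> bool" where
  "test_function \<Omega> \<phi> \<longleftrightarrow> (\<forall>k. times_cont_diff k \<phi>) \<and>
     compact (closure {x. \<phi> x \<noteq> 0}) \<and> closure {x. \<phi> x \<noteq> 0} \<subseteq> \<Omega>"

definition locally_integrable ::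
    "'a::euclidean_space set \<Rightarrow> ('a \<Rightarrow> 'b::{banach, second_countable_topology}) \<Rightarrow> bool" where
  "locally_integrable \<Omega> v \<longleftrightarrow> (\<forall>C. compact C \<and> C \<subseteq> \<Omega> \<longrightarrow> set_integrable lebesgue C v)"

definition has_weak_gradient ::
    "'a::euclidean_space set \<Rightarrow> ('a \<Rightarrow> real) \<Rightarrow> ('a \<Rightarrow> 'a) \<Rightarrow> bool" where
  "has_weak_gradient \<Omega> v V \<longleftrightarrow> locally_integrable \<Omega> v \<and> locally_integrable \<Omega> V \<and>
     (\<forall>\<phi> D. test_function \<Omega> \<phi> \<and> (\<forall>x. GDERIV \<phi> x :> D x) \<longrightarrow>
        (LINT x|lebesgue_on \<Omega>. \<phi> x *\<^sub>R V x) = - (LINT x|lebesgue_on \<Omega>. v x *\<^sub>R D x))"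

text \<open>A choice of representative: the weak gradient is determined only almost everywhere on \<open>\<Omega>\<close>.
  It exists for every function that is Lipschitz on \<open>\<Omega>\<close>, and then agrees almost everywhere with
  the pointwise gradient (Rademacher).\<close>

definition weak_gradient :: "'a::euclidean_space set \<Rightarrow> ('a \<Rightarrow> real) \<Rightarrow> 'a \<Rightarrow> 'a" where
  "weak_gradient \<Omega> v = (SOME V. has_weak_gradient \<Omega> v V)"

definition Linf_norm :: "'a::euclidean_space set \<Rightarrow> ('a \<Rightarrow> 'b::real_normed_vector) \<Rightarrow> ereal" where
  "Linf_norm \<Omega> V = esssup (lebesgue_on \<Omega>) (\<lambda>x. ereal (norm (V x)))"

definition Lp_space ::
    "nat \<Rightarrow> 'a::euclidean_space set \<Rightarrow> ('a \<Rightarrow> 'b::real_normed_vector) set" where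
  "Lp_space p \<Omega> = {v. v \<in> borel_measurable (lebesgue_on \<Omega>) \<and>
     integrable (lebesgue_on \<Omega>) (\<lambda>x. norm (v x) ^ p)}"

definition W1p :: "nat \<Rightarrow> 'a::euclidean_space set \<Rightarrow> ('a \<Rightarrow> real) set" where
  "W1p p \<Omega> = {v. v \<in> Lp_space p \<Omega> \<and> (\<exists>V. has_weak_gradient \<Omega> v V) \<and>
     weak_gradient \<Omega> v \<in> Lp_space p \<Omega>}"

text \<open>The closure of the test functions in the Sobolev norm.\<close>

definition W1p_0 :: "nat \<Rightarrow> 'a::euclidean_space set \<Rightarrow> ('a \<Rightarrow> real) set" where
  "W1p_0 p \<Omega> = {v \<in> W1p p \<Omega>. \<exists>\<phi> D.
     (\<forall>k. test_function \<Omega> (\<phi> k) \<and> (\<forall>x. GDERIV (\<phi> k) x :> D k x)) \<and>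
     (\<lambda>k::nat. LINT x|lebesgue_on \<Omega>. \<bar>v x - \<phi> k x\<bar> ^ p) \<longlonglongrightarrow> 0 \<and>
     (\<lambda>k. LINT x|lebesgue_on \<Omega>. norm (weak_gradient \<Omega> v x - D k x) ^ p) \<longlonglongrightarrow> 0}"

definition W1inf_0 :: "'a::euclidean_space set \<Rightarrow> ('a \<Rightarrow> real) set" where
  "W1inf_0 \<Omega> = {\<psi>. C01 (closure \<Omega>) \<psi> \<and> (\<forall>x\<in>frontier \<Omega>. \<psi> x = 0)}"


subsection \<open>The energies and their admissible classes\<close>

text \<open>Only the coefficients \<open>a p\<close> with \<open>p \<ge> 2\<close> are used. Series over \<open>p \<ge> 2\<close> are indexed by
  \<open>p + 2\<close> with \<open>p \<ge> 0\<close>; the series defining \<open>Phi\<close> has values in \<open>[0, \<infinity>]\<close>.\<close>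

definition Phi :: "(nat \<Rightarrow> real) \<Rightarrow> real \<Rightarrow> ennreal" where
  "Phi a t = (\<Sum>p. ennreal (a (p + 2) / real (p + 2) * t ^ (p + 2)))"

definition G :: "(nat \<Rightarrow> real) \<Rightarrow> real \<Rightarrow> 'a::euclidean_space \<Rightarrow> ennreal" where
  "G a \<sigma> \<xi> = (if norm \<xi> \<le> \<sigma> then Phi a (norm \<xi>) else \<infinity>)"

definition S_class :: "'a::euclidean_space set \<Rightarrow> real \<Rightarrow> ('a \<Rightarrow> real) \<Rightarrow> ('a \<Rightarrow> real) set" where
  "S_class \<Omega> \<sigma> g = {v. C01 (closure \<Omega>) v \<and> Linf_norm \<Omega> (weak_gradient \<Omega> v) \<le> ereal \<sigma> \<and>
     (\<forall>x\<in>frontier \<Omega>. v x = g x)}"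

definition energy ::
    "'a::euclidean_space set \<Rightarrow> (nat \<Rightarrow> real) \<Rightarrow> real \<Rightarrow> ('a \<Rightarrow> real) \<Rightarrow> ('a \<Rightarrow> real) \<Rightarrow> ereal" where
  "energy \<Omega> a \<sigma> f v =
     enn2ereal (\<integral>\<^sup>+x. G a \<sigma> (weak_gradient \<Omega> v x) \<partial>lebesgue_on \<Omega>)
       - ereal (LINT x|lebesgue_on \<Omega>. f x * v x)"

definition truncated_energy ::
    "'a::euclidean_space set \<Rightarrow> (nat \<Rightarrow> real) \<Rightarrow> nat \<Rightarrow> ('a \<Rightarrow> real) \<Rightarrow> ('a \<Rightarrow> real) \<Rightarrow> real" where
  "truncated_energy \<Omega> a n f v =
     (\<Sum>p=2..n. a p / real p * (LINT x|lebesgue_on \<Omega>. norm (weak_gradient \<Omega> v x) ^ p))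
       - (LINT x|lebesgue_on \<Omega>. f x * v x)"

definition truncated_class ::
    "'a::euclidean_space set \<Rightarrow> nat \<Rightarrow> ('a \<Rightarrow> real) \<Rightarrow> ('a \<Rightarrow> real) set" where
  "truncated_class \<Omega> n gbar = {v \<in> W1p n \<Omega>. (\<lambda>x. v x - gbar x) \<in> W1p_0 n \<Omega>}"


subsection \<open>Bounded slope condition and weak solutions\<close>

text \<open>An affine function is written \<open>\<lambda>x. b \<bullet> x + c\<close>; its gradient is \<open>b\<close>.\<close>

definition bounded_slope :: "'a::euclidean_space set \<Rightarrow> ('a \<Rightarrow> real) \<Rightarrow> real \<Rightarrow> bool" where
  "bounded_slope \<Omega> g K \<longleftrightarrow> K > 0 \<and>
     (\<forall>y\<in>frontier \<Omega>. \<exists>bm cm bp cp.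
        bm \<bullet> y + cm = g y \<and> bp \<bullet> y + cp = g y \<and>
        (\<forall>x\<in>frontier \<Omega>. bm \<bullet> x + cm \<le> g x \<and> g x \<le> bp \<bullet> x + cp) \<and>
        norm bm \<le> K \<and> norm bp \<le> K)"

text \<open>The weak form of the \<open>p\<close>-Laplacian of \<open>u\<close>, up to sign, tested against \<open>\<psi>\<close> (for \<open>p \<ge> 2\<close>).\<close>

definition p_form :: "'a::euclidean_space set \<Rightarrow> nat \<Rightarrow> ('a \<Rightarrow> real) \<Rightarrow> ('a \<Rightarrow> real) \<Rightarrow> real" where
  "p_form \<Omega> p u \<psi> = (LINT x|lebesgue_on \<Omega>.
     norm (weak_gradient \<Omega> u x) ^ (p - 2) * (weak_gradient \<Omega> u x \<bullet> weak_gradient \<Omega> \<psi> x))"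

definition weak_solution ::
    "'a::euclidean_space set \<Rightarrow> (nat \<Rightarrow> real) \<Rightarrow> real \<Rightarrow> ('a \<Rightarrow> real) \<Rightarrow> ('a \<Rightarrow> real) \<Rightarrow> ('a \<Rightarrow> real) \<Rightarrow> bool"
  where
  "weak_solution \<Omega> a \<sigma> f g u \<longleftrightarrow> u \<in> S_class \<Omega> \<sigma> g \<and>
     (\<forall>\<psi>\<in>W1inf_0 \<Omega>. summable (\<lambda>p. a (p + 2) * \<bar>p_form \<Omega> (p + 2) u \<psi>\<bar>) \<longrightarrow>
        (\<Sum>p. a (p + 2) * p_form \<Omega> (p + 2) u \<psi>) = (LINT x|lebesgue_on \<Omega>. f x * \<psi> x))"

definition truncated_weak_solution ::
    "'a::euclidean_space set \<Rightarrow> (nat \<Rightarrow> real) \<Rightarrow> real \<Rightarrow> nat \<Rightarrow> ('a \<Rightarrow> real) \<Rightarrow> ('a \<Rightarrow> real) \<Rightarrow> ('a \<Rightarrow> real) \<Rightarrow> bool"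
  where
  "truncated_weak_solution \<Omega> a \<sigma> n f g u \<longleftrightarrow> u \<in> S_class \<Omega> \<sigma> g \<and>
     (\<forall>\<psi>\<in>W1inf_0 \<Omega>.
        (\<Sum>p=2..n. a p * p_form \<Omega> p u \<psi>) = (LINT x|lebesgue_on \<Omega>. f x * \<psi> x))"

end

theory Submission
  imports Defs "HOL-Complex_Analysis.Great_Picard"
begin

text \<open>The gradient bound is obtained for one specific Lipschitz function \<open>w\<close>, and the given minimizers are
then identified with \<open>w\<close> by strict convexity.  This way every comparison argument takes place among
Lipschitz functions, where minima and maxima of competitors are elementary.

The same argument serves the full and the truncated energy.  With \<open>c j = a (j + 2)\<close>, respectively with
these coefficients cut off after \<open>p = n\<close>, both have a density \<open>dens c (norm \<xi>)\<close> whose power series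
converges beyond some \<open>K' > K\<close>.  Extend \<open>g\<close>, which the bounded slope condition makes Lipschitz with
constant \<open>K\<close>, to all of space, and minimize the energy among the functions that are Lipschitz with constant
\<open>K'\<close> and agree with this extension off \<open>\<Omega>\<close>.  The quadratic term \<open>a 2 > 0\<close> makes the functional
uniformly convex: gradients of a minimizing sequence are Cauchy in \<open>L\<^sup>2\<close>, so a minimizer \<open>w\<close> exists
(\<open>minimizer_exists\<close>), and it is unique (\<open>minimizer_unique\<close>).  It satisfies the following.

\<^item> Comparison with the affine functions of the bounded slope condition bounds the slope of \<open>w\<close> between
  any point and any point off \<open>\<Omega>\<close> by \<open>K\<close> (\<open>minimizer_boundary_slope\<close>).
\<^item> Comparison of \<open>w\<close> with its own translates carries this bound to the interior, so \<open>w\<close> is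
  Lipschitz with constant \<open>K\<close> (\<open>minimizer_lipschitz\<close>).
\<^item> Since \<open>K < K'\<close>, the constraint on the slope is not active and \<open>w\<close> admits small variations in all
  directions, so the Euler-Lagrange equation holds (\<open>minimizer_Euler_Lagrange\<close>).

By convexity a solution of the Euler-Lagrange equation minimizes the energy in the larger
classes of the theorem as well, and the quadratic term forces any other minimizer to have the same gradient
(\<open>gradient_eq_if_energy_le\<close>).  For \<open>u_n\<close>, which is only a Sobolev function, this needs the
equation tested with elements of \<open>W1p_0\<close> (\<open>Euler_Lagrange_W1p_0\<close>) and the Poincare inequality
(\<open>W1p_0_eqI\<close>).  The series in the weak formulation may be summed under the integral because the
gradient is bounded by \<open>K\<close>, which is less than the radius of convergence.

All of this rests on facts about weak gradients of Lipschitz functions: they exist and are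
almost everywhere limits of gradients of smooth functions converging uniformly
(\<open>lipschitz_smooth_approximation\<close>), they vanish almost everywhere on the zero set of the
function (\<open>grad_zero_on_zero_set\<close>), and a Lipschitz function vanishing off \<open>\<Omega>\<close> belongs to \<open>W1p_0\<close>
(\<open>lipschitz_zero_boundary_in_W1p_0\<close>).\<close>

section \<open>Smooth functions\<close>

definition smooth :: "('a::euclidean_space \<Rightarrow> real) \<Rightarrow> bool" where
  "smooth \<phi> \<longleftrightarrow> (\<forall>k. times_cont_diff k \<phi>)"

text \<open>The classical gradient, meaningful where the function is differentiable.\<close>

definition gradient :: "('a::euclidean_space \<Rightarrow> real) \<Rightarrow> 'a \<Rightarrow> 'a" where
  "gradient f x = (THE D. GDERIV f x :> D)"

lemma GDERIV_unique:
  assumes "GDERIV f x :> D" "GDERIV f x :> D'"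
  shows "D = D'"
proof -
  have "(\<lambda>h. inner h D) = (\<lambda>h. inner h D')"
    using assms unfolding gderiv_def by (rule has_derivative_unique)
  then show ?thesis
    by (metis inner_commute vector_eq_ldot)
qed

lemma gradient_eq: "GDERIV f x :> D \<Longrightarrow> gradient f x = D"
  unfolding gradient_def by (rule the_equality) (auto intro: GDERIV_unique)

lemma times_cont_diff_SucD: "times_cont_diff (Suc k) f \<Longrightarrow> times_cont_diff k f"
proof (induction k arbitrary: f)
  case 0
  then obtain D where "\<forall>x. GDERIV f x :> D x" by auto
  then have "continuous (at x) f" for x
    unfolding gderiv_def using has_derivative_continuous by blast
  then show ?case by (simp add: continuous_on_eq_continuous_at)
next
  case (Suc k)
  then obtain D where D: "\<forall>x. GDERIV f x :> D x" "\<forall>b\<in>Basis. times_cont_diff (Suc k) (\<lambda>x. D x \<bullet> b)"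
    by auto
  then have "\<forall>b\<in>Basis. times_cont_diff k (\<lambda>x. D x \<bullet> b)" using Suc.IH by blast
  then show ?case using D(1) by auto
qed

lemma times_cont_diff_add:
  "times_cont_diff k f \<Longrightarrow> times_cont_diff k h \<Longrightarrow> times_cont_diff k (\<lambda>x. f x + h x)"
proof (induction k arbitrary: f h)
  case 0
  then show ?case by (auto intro: continuous_intros)
next
  case (Suc k)
  from Suc.prems obtain D E where
    D: "\<forall>x. GDERIV f x :> D x" "\<forall>b\<in>Basis. times_cont_diff k (\<lambda>x. D x \<bullet> b)" and
    E: "\<forall>x. GDERIV h x :> E x" "\<forall>b\<in>Basis. times_cont_diff k (\<lambda>x. E x \<bullet> b)"
    by auto
  have "\<forall>x. GDERIV (\<lambda>x. f x + h x) x :> D x + E x" using D(1) E(1) by (auto intro: GDERIV_add)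
  moreover have "\<forall>b\<in>Basis. times_cont_diff k (\<lambda>x. (D x + E x) \<bullet> b)"
    using Suc.IH D(2) E(2) by (auto simp: inner_add_left)
  ultimately show ?case by auto
qed

lemma times_cont_diff_const: "times_cont_diff k (\<lambda>x::'a::euclidean_space. c)"
proof (induction k arbitrary: c)
  case (Suc k)
  have "\<forall>x::'a. GDERIV (\<lambda>x. c) x :> 0" by (simp add: GDERIV_const)
  moreover have "\<forall>b\<in>Basis. times_cont_diff k (\<lambda>x::'a. 0 \<bullet> b)" using Suc.IH[of 0] by simp
  ultimately show ?case unfolding times_cont_diff.simps by (intro exI[of _ "\<lambda>_. 0"]) auto
qed auto

lemma times_cont_diff_mult:
  "times_cont_diff k f \<Longrightarrow> times_cont_diff k h \<Longrightarrow> times_cont_diff k (\<lambda>x. f x * h x)"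
proof (induction k arbitrary: f h)
  case 0
  then show ?case by (auto intro: continuous_intros)
next
  case (Suc k)
  from Suc.prems obtain D E where
    D: "\<forall>x. GDERIV f x :> D x" "\<forall>b\<in>Basis. times_cont_diff k (\<lambda>x. D x \<bullet> b)" and
    E: "\<forall>x. GDERIV h x :> E x" "\<forall>b\<in>Basis. times_cont_diff k (\<lambda>x. E x \<bullet> b)"
    by auto
  have fh: "times_cont_diff k f" "times_cont_diff k h"
    using Suc.prems times_cont_diff_SucD by blast+
  have "\<forall>x. GDERIV (\<lambda>x. f x * h x) x :> f x *\<^sub>R E x + h x *\<^sub>R D x"
    using D(1) E(1) by (auto intro: GDERIV_mult)
  moreover have "\<forall>b\<in>Basis. times_cont_diff k (\<lambda>x. (f x *\<^sub>R E x + h x *\<^sub>R D x) \<bullet> b)"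
    using Suc.IH D(2) E(2) fh by (auto simp: inner_add_left intro!: times_cont_diff_add)
  ultimately show ?case
    unfolding times_cont_diff.simps by (intro exI[of _ "\<lambda>x. f x *\<^sub>R E x + h x *\<^sub>R D x"]) auto
qed

lemma GDERIV_inner_left: "GDERIV (\<lambda>x. x \<bullet> b) x :> b"
  unfolding gderiv_def by (auto intro!: derivative_eq_intros)

lemma times_cont_diff_inner: "times_cont_diff k (\<lambda>x::'a::euclidean_space. x \<bullet> b)"
proof (cases k)
  case 0
  then show ?thesis by (auto intro: continuous_intros)
next
  case (Suc j)
  then show ?thesis
    unfolding Suc times_cont_diff.simps
    by (intro exI[of _ "\<lambda>_. b"]) (auto simp: GDERIV_inner_left times_cont_diff_const)
qed

lemma smooth_add: "smooth f \<Longrightarrow> smooth h \<Longrightarrow> smooth (\<lambda>x. f x + h x)"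
  and smooth_mult: "smooth f \<Longrightarrow> smooth h \<Longrightarrow> smooth (\<lambda>x. f x * h x)"
  and smooth_const: "smooth (\<lambda>x. c)"
  by (auto simp: smooth_def times_cont_diff_add times_cont_diff_mult times_cont_diff_const)

lemma smooth_cmult: "smooth f \<Longrightarrow> smooth (\<lambda>x. c * f x)"
  by (simp add: smooth_mult smooth_const)

lemma smooth_diff: "smooth f \<Longrightarrow> smooth h \<Longrightarrow> smooth (\<lambda>x. f x - h x)"
  using smooth_add[of f "\<lambda>x. - 1 * h x"] smooth_cmult[of h "-1"] by simp

lemma smooth_gradient:
  assumes "smooth f"
  shows GDERIV_gradient: "GDERIV f x :> gradient f x"
    and smooth_gradient_inner: "b \<in> Basis \<Longrightarrow> smooth (\<lambda>x. gradient f x \<bullet> b)"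
proof -
  have *: "(\<forall>x. GDERIV f x :> gradient f x) \<and> (\<forall>b\<in>Basis. times_cont_diff k (\<lambda>x. gradient f x \<bullet> b))" for k
  proof -
    have "times_cont_diff (Suc k) f" using assms by (simp only: smooth_def)
    then obtain D where D: "\<forall>x. GDERIV f x :> D x" "\<forall>b\<in>Basis. times_cont_diff k (\<lambda>x. D x \<bullet> b)"
      by auto
    then have "gradient f = D" by (auto simp: gradient_eq)
    with D show ?thesis by simp
  qed
  show "GDERIV f x :> gradient f x" using * by blast
  show "b \<in> Basis \<Longrightarrow> smooth (\<lambda>x. gradient f x \<bullet> b)" using * by (simp add: smooth_def)
qed

lemma smooth_continuous: "smooth f \<Longrightarrow> continuous_on UNIV f"
  unfolding smooth_def by (metis times_cont_diff.simps(1))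

lemma smooth_continuous_gradient:
  assumes "smooth f" shows "continuous_on UNIV (gradient f)"
proof (rule continuous_on_componentwise[THEN iffD2], safe)
  fix b :: 'a assume "b \<in> Basis"
  then show "continuous_on UNIV (\<lambda>x. gradient f x \<bullet> b)"
    using smooth_continuous[OF smooth_gradient_inner[OF assms]] by blast
qed

text \<open>Bump functions are built from \<open>exp (-1/t)\<close>.  With the negative powers of \<open>t\<close> included, the
  family is closed under differentiation up to linear combinations, so its smoothness
  follows by induction.\<close>

definition flat :: "nat \<Rightarrow> real \<Rightarrow> real" where
  "flat m t = (if t \<le> 0 then 0 else exp (- 1 / t) / t ^ m)"

lemma flat_tendsto_0: "(flat m \<longlongrightarrow> 0) (at 0)"
proof -
  have "((\<lambda>s::real. s ^ m / exp s) \<longlongrightarrow> 0) at_top" by (rule tendsto_power_div_exp_0)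
  then have "((\<lambda>t::real. inverse t ^ m / exp (inverse t)) \<longlongrightarrow> 0) (at_right 0)"
    by (rule filterlim_compose[OF _ filterlim_inverse_at_top_right])
  moreover have "\<forall>\<^sub>F t in at_right (0::real). inverse t ^ m / exp (inverse t) = flat m t"
    unfolding eventually_at_right_field
    by (rule exI[of _ 1]) (auto simp: flat_def exp_minus divide_simps)
  ultimately have R: "(flat m \<longlongrightarrow> 0) (at_right 0)"
    using tendsto_cong by fastforce
  have L: "(flat m \<longlongrightarrow> 0) (at_left 0)"
    by (rule tendsto_eventually) (auto simp: flat_def eventually_at_left_field intro: exI[of _ "-1"])
  show ?thesis using L R filterlim_split_at by blast
qed

text \<open>At \<open>0\<close> the difference quotient of \<open>flat m\<close> is \<open>flat (m + 1)\<close>, which tends to \<open>0\<close>.\<close>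

lemma flat_DERIV: "(flat m has_real_derivative (flat (m + 2) t - real m * flat (m + 1) t)) (at t)"
proof -
  consider "t < 0" | "t = 0" | "t > 0" by linarith
  then show ?thesis
  proof cases
    case 1
    then have "\<forall>\<^sub>F y in nhds t. flat m y = 0"
      by (auto simp: flat_def eventually_nhds intro!: exI[of _ "{..<0}"])
    moreover have "flat (m + 2) t - real m * flat (m + 1) t = 0" using 1 by (simp add: flat_def)
    ultimately show ?thesis by (simp add: DERIV_cong_ev)
  next
    case 2
    have "((\<lambda>h. flat m h / h) \<longlongrightarrow> 0) (at 0)"
    proof (rule Lim_transform_eventually[OF flat_tendsto_0[of "m + 1"]])
      show "\<forall>\<^sub>F x in at 0. flat (m + 1) x = flat m x / x"
        by (auto simp: flat_def eventually_at_filter)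
    qed
    then show ?thesis unfolding has_field_derivative_iff using 2 by (simp add: flat_def)
  next
    case 3
    have ev: "\<forall>\<^sub>F y in nhds t. flat m y = exp (- 1 / y) / y ^ m"
      using 3 by (auto simp: flat_def eventually_nhds intro!: exI[of _ "{0<..}"])
    have "((\<lambda>y. exp (- 1 / y) / y ^ m) has_real_derivative
       (flat (m + 2) t - real m * flat (m + 1) t)) (at t)"
    proof (cases m)
      case 0
      then show ?thesis using 3
        by (auto intro!: derivative_eq_intros simp: flat_def field_simps power2_eq_square)
    next
      case (Suc j)
      then show ?thesis using 3
        by (auto intro!: derivative_eq_intros simp: flat_def field_simps power2_eq_square power_add)
          (cases j; simp)
    qed
    then show ?thesis using DERIV_cong_ev[OF refl ev refl] by blast
  qed
qed

definition ball_bump :: "real \<Rightarrow> 'a::euclidean_space \<Rightarrow> real" where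
  "ball_bump r x = flat 0 (r\<^sup>2 - x \<bullet> x)"

lemma GDERIV_flat_quadratic:
  "GDERIV (\<lambda>x. flat m (s - x \<bullet> x)) x :>
     (flat (m + 2) (s - x \<bullet> x) - real m * flat (m + 1) (s - x \<bullet> x)) *\<^sub>R (- 2 *\<^sub>R x)"
proof (rule GDERIV_DERIV_compose[OF _ flat_DERIV])
  show "GDERIV (\<lambda>x. s - x \<bullet> x) x :> - 2 *\<^sub>R x"
    unfolding gderiv_def by (auto intro!: derivative_eq_intros simp: inner_commute)
qed

lemma smooth_flat_quadratic: "times_cont_diff k (\<lambda>x::'a::euclidean_space. flat m (s - x \<bullet> x))"
proof (induction k arbitrary: m)
  case 0
  have "continuous (at x) (\<lambda>x::'a. flat m (s - x \<bullet> x))" for x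
    using GDERIV_flat_quadratic[of m s x] has_derivative_continuous unfolding gderiv_def by blast
  then show ?case by (simp add: continuous_on_eq_continuous_at)
next
  case (Suc k)
  let ?D = "\<lambda>x::'a. (flat (m + 2) (s - x \<bullet> x) - real m * flat (m + 1) (s - x \<bullet> x)) *\<^sub>R (- 2 *\<^sub>R x)"
  have "times_cont_diff k (\<lambda>x. ?D x \<bullet> b)" for b
  proof -
    have eq: "(\<lambda>x. ?D x \<bullet> b) =
      (\<lambda>x. (flat (m + 2) (s - x \<bullet> x) + (- real m) * flat (m + 1) (s - x \<bullet> x)) * ((-2) * (x \<bullet> b)))"
      by (auto simp: algebra_simps)
    show ?thesis
      unfolding eq
      by (intro times_cont_diff_mult times_cont_diff_add times_cont_diff_const times_cont_diff_inner
          Suc.IH)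
  qed
  then show ?case using GDERIV_flat_quadratic[of m s] unfolding times_cont_diff.simps
    by (intro exI[of _ ?D]) auto
qed

lemma ball_bump:
  shows smooth_ball_bump: "smooth (ball_bump r :: 'a::euclidean_space \<Rightarrow> real)"
    and ball_bump_nonneg: "0 \<le> ball_bump r x"
    and ball_bump_pos_iff: "0 < r \<Longrightarrow> 0 < ball_bump r x \<longleftrightarrow> norm x < r"
proof -
  show "smooth (ball_bump r :: 'a \<Rightarrow> real)"
    unfolding smooth_def ball_bump_def using smooth_flat_quadratic[of _ 0] by blast
  show "0 \<le> ball_bump r x" by (auto simp: ball_bump_def flat_def)
  assume "0 < r"
  then have "norm x < r \<longleftrightarrow> (norm x)\<^sup>2 < r\<^sup>2"
    by (meson norm_ge_zero not_less order_le_less power_mono power_strict_mono zero_less_numeral)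
  then show "0 < ball_bump r x \<longleftrightarrow> norm x < r"
    by (auto simp: ball_bump_def flat_def power2_norm_eq_inner)
qed

section \<open>Convolution and mollifiers\<close>

lemma lebesgue_reflect:
  fixes c :: "'a::euclidean_space"
  shows "(\<lambda>z. c - z) \<in> lebesgue \<rightarrow>\<^sub>M lebesgue" "distr lebesgue lebesgue (\<lambda>z. c - z) = lebesgue"
proof -
  have eq: "(\<lambda>z. c + (\<Sum>j\<in>Basis. ((-1) * (z \<bullet> j)) *\<^sub>R j)) = (\<lambda>z. c - z)"
    by (simp add: sum_negf euclidean_representation)
  show "(\<lambda>z. c - z) \<in> lebesgue \<rightarrow>\<^sub>M lebesgue"
    using lebesgue_affine_measurable[of "\<lambda>_. -1" c] unfolding eq by simp
  show "distr lebesgue lebesgue (\<lambda>z. c - z) = lebesgue"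
    using lebesgue_affine_euclidean[of "\<lambda>_. -1" c] unfolding eq by (simp add: density_1)
qed

lemma lebesgue_shift:
  fixes c :: "'a::euclidean_space"
  shows "(\<lambda>z. z + c) \<in> lebesgue \<rightarrow>\<^sub>M lebesgue" "distr lebesgue lebesgue (\<lambda>z. z + c) = lebesgue"
proof -
  have eq: "(\<lambda>z. c + (\<Sum>j\<in>Basis. (1 * (z \<bullet> j)) *\<^sub>R j)) = (\<lambda>z. z + c)"
    by (simp add: euclidean_representation add.commute)
  show "(\<lambda>z. z + c) \<in> lebesgue \<rightarrow>\<^sub>M lebesgue"
    using lebesgue_affine_measurable[of "\<lambda>_. 1" c] unfolding eq by simp
  show "distr lebesgue lebesgue (\<lambda>z. z + c) = lebesgue"
    using lebesgue_affine_euclidean[of "\<lambda>_. 1" c] unfolding eq by (simp add: density_1)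
qed

lemma integral_lebesgue_reflect:
  fixes f :: "'a::euclidean_space \<Rightarrow> 'b::{banach, second_countable_topology}"
  assumes "f \<in> borel_measurable lebesgue"
  shows "(LINT z|lebesgue. f (c - z)) = (LINT z|lebesgue. f z)"
  using integral_distr[OF lebesgue_reflect(1) assms, of c] by (simp add: lebesgue_reflect(2))

lemma integral_lebesgue_shift:
  fixes f :: "'a::euclidean_space \<Rightarrow> 'b::{banach, second_countable_topology}"
  assumes "f \<in> borel_measurable lebesgue"
  shows "(LINT z|lebesgue. f (z + c)) = (LINT z|lebesgue. f z)"
  using integral_distr[OF lebesgue_shift(1) assms, of c] by (simp add: lebesgue_shift(2))

lemma integrable_lebesgue_shift:
  fixes f :: "'a::euclidean_space \<Rightarrow> 'b::{banach, second_countable_topology}"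
  assumes "integrable lebesgue f"
  shows "integrable lebesgue (\<lambda>z. f (z + c))"
  using assms integrable_distr_eq[OF lebesgue_shift(1), of f c] by (simp add: lebesgue_shift(2))

lemma AE_lebesgue_shift:
  assumes "AE x in lebesgue. P x"
  shows "AE x in lebesgue. P (x + (c::'a::euclidean_space))"
proof (rule AE_distrD[OF lebesgue_shift(1)])
  show "AE x in distr lebesgue lebesgue (\<lambda>x. x + c). P x" unfolding lebesgue_shift(2) by (rule assms)
qed

lemma continuous_borel_measurable_lebesgue:
  fixes f :: "'a::euclidean_space \<Rightarrow> 'b::topological_space"
  assumes "continuous_on UNIV f"
  shows "f \<in> borel_measurable lebesgue"
  using borel_measurable_continuous_onI[OF assms] by (intro measurable_completion) simp

lemma lipschitz_borel_measurable_lebesgue: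
  fixes f :: "'a::euclidean_space \<Rightarrow> real"
  assumes "L-lipschitz_on UNIV f"
  shows "f \<in> borel_measurable lebesgue"
  using assms by (intro continuous_borel_measurable_lebesgue lipschitz_on_continuous_on)

lemma integrable_bounded_support:
  fixes f :: "'a::euclidean_space \<Rightarrow> 'b::{banach, second_countable_topology}"
  assumes "f \<in> borel_measurable lebesgue" "bounded S"
    and "AE x in lebesgue. norm (f x) \<le> B"
    and "\<And>x. x \<notin> S \<Longrightarrow> f x = 0"
  shows "integrable lebesgue f"
proof -
  obtain R where R: "S \<subseteq> cball 0 R" using assms(2) by (metis ball_subset_cball bounded_subset_ballD order_trans)
  show ?thesis
  proof (rule Bochner_Integration.integrable_bound[OF _ assms(1)])
    have "emeasure lebesgue (cball (0::'a) R) < \<infinity>"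
      using lmeasurable_cball[of "0::'a" R] unfolding fmeasurable_def by blast
    then have "integrable lebesgue (indicator (cball 0 R) :: 'a \<Rightarrow> real)"
      by (intro integrable_real_indicator) auto
    then show "integrable lebesgue (\<lambda>x::'a. \<bar>B\<bar> *\<^sub>R indicator (cball 0 R) x :: real)"
      by (intro integrable_scaleR_right)
    show "AE x in lebesgue. norm (f x) \<le> norm (\<bar>B\<bar> *\<^sub>R indicator (cball 0 R) x :: real)"
      using assms(3)
    proof eventually_elim
      case (elim x)
      then show ?case using R assms(4)[of x] by (cases "x \<in> S") (auto simp: indicator_def)
    qed
  qed
qed

lemma continuous_bounded_support:
  fixes f :: "'a::euclidean_space \<Rightarrow> 'b::real_normed_vector"
  assumes "continuous_on UNIV f" "bounded S" "\<And>x. x \<notin> S \<Longrightarrow> f x = 0"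
  obtains B where "0 \<le> B" "\<And>x. norm (f x) \<le> B"
proof -
  have "compact (f ` closure S)"
    using assms(1,2) by (intro compact_continuous_image continuous_on_subset[OF assms(1)]) auto
  then obtain B where B: "\<forall>y\<in>f ` closure S. norm y \<le> B" using bounded_iff compact_imp_bounded by blast
  have "norm (f x) \<le> \<bar>B\<bar>" for x
    using B assms(3)[of x] closure_subset[of S] by (cases "x \<in> S") fastforce+
  then show ?thesis using that[of "\<bar>B\<bar>"] by simp
qed

lemma integrable_continuous_bounded_support:
  fixes f :: "'a::euclidean_space \<Rightarrow> 'b::{banach, second_countable_topology}"
  assumes "continuous_on UNIV f" "bounded S" "\<And>x. x \<notin> S \<Longrightarrow> f x = 0"
  shows "integrable lebesgue f"
proof -
  obtain B where "\<And>x. norm (f x) \<le> B" using continuous_bounded_support[OF assms] by blast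
  then show ?thesis
    using assms by (intro integrable_bounded_support[of f S B] continuous_borel_measurable_lebesgue) auto
qed

lemma GDERIV_mvt:
  fixes f :: "'a::euclidean_space \<Rightarrow> real"
  assumes "\<And>x. GDERIV f x :> D x"
  obtains t where "0 < t" "t < 1" "f (x + h) - f x = h \<bullet> D (x + t *\<^sub>R h)"
proof -
  have "((\<lambda>t. f (x + t *\<^sub>R h)) has_real_derivative (h \<bullet> D (x + t *\<^sub>R h))) (at t)" for t
  proof -
    have "((\<lambda>t. x + t *\<^sub>R h) has_derivative (\<lambda>s. s *\<^sub>R h)) (at t)"
      by (auto intro!: derivative_eq_intros)
    moreover have "(f has_derivative (\<lambda>k. k \<bullet> D (x + t *\<^sub>R h))) (at (x + t *\<^sub>R h))"
      using assms unfolding gderiv_def by blast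
    ultimately have "((\<lambda>t. f (x + t *\<^sub>R h)) has_derivative (\<lambda>s. (s *\<^sub>R h) \<bullet> D (x + t *\<^sub>R h))) (at t)"
      using has_derivative_compose by blast
    then show ?thesis by (simp add: has_field_derivative_def mult.commute[of "h \<bullet> _"] mult_commute_abs)
  qed
  then obtain t where "0 < t" "t < 1" "f (x + 1 *\<^sub>R h) - f (x + 0 *\<^sub>R h) = (1 - 0) * (h \<bullet> D (x + t *\<^sub>R h))"
    using MVT2[of 0 1 "\<lambda>t. f (x + t *\<^sub>R h)"] by force
  with that show ?thesis by simp
qed

text \<open>Moving a small step in the direction of the gradient increases the function at the rate \<open>norm D\<close>.\<close>

lemma GDERIV_lipschitz_bound:
  fixes f :: "'a::euclidean_space \<Rightarrow> real"
  assumes "GDERIV f x :> D" "L-lipschitz_on UNIV f"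
  shows "norm D \<le> L"
proof (cases "D = 0")
  case True
  then show ?thesis using lipschitz_on_nonneg[OF assms(2)] by simp
next
  case False
  have L: "0 \<le> L" using lipschitz_on_nonneg[OF assms(2)] .
  show ?thesis
  proof (rule field_le_epsilon)
    fix e :: real assume "0 < e"
    then obtain d where d: "0 < d" "\<And>y. norm (y - x) < d \<Longrightarrow> norm (f y - f x - (y - x) \<bullet> D) \<le> e * norm (y - x)"
      using assms(1) unfolding gderiv_def has_derivative_at_alt by meson
    define s where "s = d / (2 * norm D)"
    have s: "0 < s" using d False by (simp add: s_def)
    have "norm (x + s *\<^sub>R D - x) < d" using d False by (simp add: s_def)
    from d(2)[OF this] have "\<bar>f (x + s *\<^sub>R D) - f x - s * (norm D)\<^sup>2\<bar> \<le> e * (s * norm D)"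
      using s by (simp add: power2_norm_eq_inner)
    moreover have "\<bar>f (x + s *\<^sub>R D) - f x\<bar> \<le> L * (s * norm D)"
      using lipschitz_onD[OF assms(2), of "x + s *\<^sub>R D" x] s by (simp add: dist_real_def dist_norm)
    ultimately have "s * (norm D)\<^sup>2 \<le> e * (s * norm D) + L * (s * norm D)" by linarith
    then have "(s * norm D) * norm D \<le> (s * norm D) * (L + e)" by (simp add: power2_eq_square algebra_simps)
    then show "norm D \<le> L + e" using s False by simp
  qed
qed

lemma GDERIV_zero_off_support:
  fixes f :: "'a::euclidean_space \<Rightarrow> real"
  assumes "GDERIV f x :> D" "open U" "x \<in> U" "\<And>y. y \<in> U \<Longrightarrow> f y = 0"
  shows "D = 0"
proof -
  have "(f has_derivative (\<lambda>h. h \<bullet> 0)) (at x)"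
  proof -
    have "((\<lambda>_. 0) has_derivative (\<lambda>h. h \<bullet> 0)) (at x)" by simp
    then show ?thesis
      by (rule has_derivative_transform_within_open[OF _ assms(2,3)]) (simp add: assms(4))
  qed
  then show ?thesis using GDERIV_unique[OF assms(1)] by (simp add: gderiv_def)
qed

definition conv :: "('a::euclidean_space \<Rightarrow> real) \<Rightarrow> ('a \<Rightarrow> 'b) \<Rightarrow> 'a \<Rightarrow> 'b::{banach, second_countable_topology}" where
  "conv v r x = (LINT y|lebesgue. v y *\<^sub>R r (x - y))"

lemma conv_integrable:
  fixes v :: "'a::euclidean_space \<Rightarrow> real" and r :: "'a \<Rightarrow> 'b::{banach, second_countable_topology}"
  assumes "continuous_on UNIV v" "continuous_on UNIV r" "\<forall>x. e < norm x \<longrightarrow> r x = 0"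
  shows "integrable lebesgue (\<lambda>y. v y *\<^sub>R r (x - y))" "integrable lebesgue (\<lambda>z. v (x - z) *\<^sub>R r z)"
proof -
  have sub: "continuous_on UNIV (\<lambda>z. x - z)" by (intro continuous_intros)
  have c: "continuous_on UNIV (\<lambda>y. r (x - y))" "continuous_on UNIV (\<lambda>z. v (x - z))"
    using continuous_on_compose2[OF assms(2) sub] continuous_on_compose2[OF assms(1) sub] by auto
  show "integrable lebesgue (\<lambda>y. v y *\<^sub>R r (x - y))"
    by (rule integrable_continuous_bounded_support[of _ "cball x e"])
      (use assms(3) in \<open>auto intro!: continuous_intros c assms(1,2) simp: dist_norm\<close>)
  show "integrable lebesgue (\<lambda>z. v (x - z) *\<^sub>R r z)"
    by (rule integrable_continuous_bounded_support[of _ "cball 0 e"])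
      (use assms(3) in \<open>auto intro!: continuous_intros c assms(1,2) simp: dist_norm\<close>)
qed

lemma conv_commute:
  fixes v :: "'a::euclidean_space \<Rightarrow> real" and r :: "'a \<Rightarrow> 'b::{banach, second_countable_topology}"
  assumes "continuous_on UNIV v" "continuous_on UNIV r" "\<forall>x. e < norm x \<longrightarrow> r x = 0"
  shows "conv v r x = (LINT z|lebesgue. v (x - z) *\<^sub>R r z)"
proof -
  have "(LINT z|lebesgue. (\<lambda>y. v y *\<^sub>R r (x - y)) (x - z)) = (LINT y|lebesgue. v y *\<^sub>R r (x - y))"
    using conv_integrable(1)[OF assms]
    by (intro integral_lebesgue_reflect borel_measurable_integrable) auto
  then show ?thesis by (simp add: conv_def)
qed

text \<open>The gradient of a compactly supported kernel is uniformly continuous, so the error of its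
  linearization is uniformly small relative to the step; integrating it against \<open>v\<close> over a ball
  containing all supports involved keeps it small.\<close>

lemma GDERIV_conv:
  fixes v :: "'a::euclidean_space \<Rightarrow> real"
  assumes v: "continuous_on UNIV v" and D: "\<And>x. GDERIV r x :> D x" "continuous_on UNIV D"
    and supp: "\<forall>x. e < norm x \<longrightarrow> r x = 0"
  shows "GDERIV (conv v r) x :> conv v D x"
proof -
  have D0: "\<forall>z. e < norm z \<longrightarrow> D z = 0"
    using GDERIV_zero_off_support[OF D(1), of "- cball 0 e"] supp by force
  have r: "continuous_on UNIV r"
    using D(1) has_derivative_continuous unfolding gderiv_def
    by (metis continuous_on_eq_continuous_at open_UNIV)
  define I where "I = (LINT y|lebesgue. indicator (cball x (e + 1)) y *\<^sub>R \<bar>v y\<bar>)"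
  have int_I: "integrable lebesgue (\<lambda>y. indicator (cball x (e + 1)) y *\<^sub>R \<bar>v y\<bar>)"
  proof -
    obtain B where "\<forall>z\<in>v ` cball x (e + 1). norm z \<le> B"
      using compact_imp_bounded[OF compact_continuous_image[OF continuous_on_subset[OF v subset_UNIV] compact_cball[of x "e + 1"]]]
      unfolding bounded_iff by blast
    then have B: "\<bar>v y\<bar> \<le> \<bar>B\<bar>" if "y \<in> cball x (e + 1)" for y using that by force
    show ?thesis
      by (rule integrable_bounded_support[of _ "cball x (e + 1)" "\<bar>B\<bar>"])
        (use B continuous_borel_measurable_lebesgue[OF v] in \<open>auto intro!: borel_measurable_times borel_measurable_indicator simp del: of_bool_eq simp: indicator_le_1 split: split_indicator\<close>)
  qed
  have "0 \<le> I" unfolding I_def by (intro integral_nonneg_AE) auto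
  show ?thesis unfolding gderiv_def has_derivative_at_alt
  proof (intro conjI allI impI)
    show "bounded_linear (\<lambda>h. h \<bullet> conv v D x)" by (rule bounded_linear_inner_left)
    fix \<epsilon> :: real assume "0 < \<epsilon>"
    define \<eta> where "\<eta> = \<epsilon> / (I + 1)"
    have \<eta>: "0 < \<eta>" using \<open>0 < \<epsilon>\<close> \<open>0 \<le> I\<close> by (simp add: \<eta>_def)
    have "uniformly_continuous_on (cball 0 (e + 2)) D"
      by (intro compact_uniformly_continuous continuous_on_subset[OF D(2)]) auto
    then obtain d0 where d0: "0 < d0" "\<And>z z'. z \<in> cball 0 (e + 2) \<Longrightarrow> z' \<in> cball 0 (e + 2) \<Longrightarrow> dist z' z < d0 \<Longrightarrow> dist (D z') (D z) < \<eta>"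
      using \<eta> unfolding uniformly_continuous_on_def by metis
    define d where "d = min d0 1"
    have d: "0 < d" "d \<le> d0" "d \<le> 1" using d0(1) by (auto simp: d_def)
    have D_close: "norm (D (z + k) - D z) \<le> \<eta>" if k: "norm k < d" for z k
    proof (cases "norm z \<le> e + 1")
      case True
      have "norm (z + k) \<le> e + 2" using True k d norm_triangle_ineq[of z k] by linarith
      then have "dist (D (z + k)) (D z) < \<eta>" using True k d by (intro d0(2)) (auto simp: dist_norm[of _ z] simp flip: norm_conv_dist)
      then show ?thesis by (simp add: dist_norm)
    next
      case False
      have "norm z \<le> norm (z + k) + norm k" using norm_triangle_ineq4[of "z + k" k] by simp
      then have "D z = 0" "D (z + k) = 0" using False k d by (auto intro!: D0[rule_format])
      then show ?thesis using \<eta> by simp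
    qed
    have r_close: "\<bar>r (z + k) - r z - k \<bullet> D z\<bar> \<le> \<eta> * norm k" if k: "norm k < d" for z k
    proof -
      obtain t where t: "0 < t" "t < 1" "r (z + k) - r z = k \<bullet> D (z + t *\<^sub>R k)"
        using GDERIV_mvt[OF D(1)] by metis
      have "norm (t *\<^sub>R k) \<le> norm k" using t mult_right_mono[of t 1 "norm k"] by simp
      then have "norm (D (z + t *\<^sub>R k) - D z) \<le> \<eta>" using k by (intro D_close) linarith
      moreover have "\<bar>k \<bullet> (D (z + t *\<^sub>R k) - D z)\<bar> \<le> norm k * norm (D (z + t *\<^sub>R k) - D z)"
        by (rule Cauchy_Schwarz_ineq2)
      ultimately show ?thesis
        using t(3) mult_left_mono[of "norm (D (z + t *\<^sub>R k) - D z)" \<eta> "norm k"]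
        by (simp add: inner_diff_right mult.commute)
    qed
    have "norm (conv v r y - conv v r x - (y - x) \<bullet> conv v D x) \<le> \<epsilon> * norm (y - x)"
      if y: "norm (y - x) < d" for y
    proof -
      let ?k = "y - x"
      let ?f = "\<lambda>w. v w * (r (x - w + ?k) - r (x - w) - ?k \<bullet> D (x - w))"
      note ints = conv_integrable(1)[OF v r supp, of y] conv_integrable(1)[OF v r supp, of x]
        conv_integrable(1)[OF v D(2) D0, of x]
      have "conv v r y - conv v r x - ?k \<bullet> conv v D x =
        (LINT w|lebesgue. v w *\<^sub>R r (y - w) - v w *\<^sub>R r (x - w) - ?k \<bullet> (v w *\<^sub>R D (x - w)))"
      proof -
        have "?k \<bullet> conv v D x = (LINT w|lebesgue. ?k \<bullet> (v w *\<^sub>R D (x - w)))"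
          unfolding conv_def by (rule integral_inner_right[symmetric]) (rule ints(3))
        moreover have "integrable lebesgue (\<lambda>w. ?k \<bullet> (v w *\<^sub>R D (x - w)))"
          by (rule integrable_inner_right) (rule ints(3))
        ultimately show ?thesis
          using ints(1,2) by (simp only: conv_def Bochner_Integration.integral_diff Bochner_Integration.integrable_diff)
      qed
      also have "\<dots> = (LINT w|lebesgue. ?f w)"
        by (intro Bochner_Integration.integral_cong) (auto simp: algebra_simps)
      finally have eq: "conv v r y - conv v r x - ?k \<bullet> conv v D x = (LINT w|lebesgue. ?f w)" .
      have "norm (LINT w|lebesgue. ?f w) \<le> (LINT w|lebesgue. \<eta> * norm ?k * (indicator (cball x (e + 1)) w *\<^sub>R \<bar>v w\<bar>))"
      proof (rule Bochner_Integration.integral_norm_bound_integral)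
        have "integrable lebesgue (\<lambda>w. v w *\<^sub>R r (y - w) - v w *\<^sub>R r (x - w) - ?k \<bullet> (v w *\<^sub>R D (x - w)))"
          using ints by (intro Bochner_Integration.integrable_diff integrable_inner_right)
        then show "integrable lebesgue ?f"
          by (rule Bochner_Integration.integrable_cong[THEN iffD1, rotated 2]) (auto simp: algebra_simps)
        show "integrable lebesgue (\<lambda>w. \<eta> * norm ?k * (indicator (cball x (e + 1)) w *\<^sub>R \<bar>v w\<bar>))"
          using int_I by (rule integrable_mult_right)
        fix w
        show "norm (?f w) \<le> \<eta> * norm ?k * (indicator (cball x (e + 1)) w *\<^sub>R \<bar>v w\<bar>)"
        proof (cases "w \<in> cball x (e + 1)")
          case True
          then show ?thesis
            using mult_left_mono[OF r_close[OF y, of "x - w"], of "\<bar>v w\<bar>"]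
            by (simp only: abs_mult real_norm_def indicator_simps real_scaleR_def mult.commute
                mult.left_commute mult_1 abs_ge_zero TrueI)
        next
          case False
          then have nw: "e + 1 < norm (x - w)" by (simp add: dist_norm)
          moreover have "norm (x - w) \<le> norm (x - w + ?k) + norm ?k"
            using norm_triangle_ineq4[of "x - w + ?k" ?k] by simp
          ultimately have "e < norm (x - w)" "e < norm (x - w + ?k)" using y d by auto
          then have "r (x - w) = 0" "r (x - w + ?k) = 0" "D (x - w) = 0" using supp D0 by blast+
          then show ?thesis using False by simp
        qed
      qed
      also have "\<dots> = \<eta> * norm ?k * I" unfolding I_def by (rule integral_mult_right_zero)
      also have "\<dots> \<le> \<epsilon> * norm ?k"
      proof -
        have "\<eta> * I \<le> \<epsilon>" using \<open>0 \<le> I\<close> \<open>0 < \<epsilon>\<close> by (simp add: \<eta>_def field_simps)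
        then show ?thesis using mult_right_mono[of "\<eta> * I" \<epsilon> "norm ?k"] by (simp add: algebra_simps)
      qed
      finally show ?thesis using eq by simp
    qed
    then show "\<exists>d>0. \<forall>y. norm (y - x) < d \<longrightarrow> norm (conv v r y - conv v r x - (y - x) \<bullet> conv v D x) \<le> \<epsilon> * norm (y - x)"
      using d(1) by blast
  qed
qed

lemma smooth_conv:
  fixes v r :: "'a::euclidean_space \<Rightarrow> real"
  assumes v: "continuous_on UNIV v" and "smooth r" "\<forall>x. e < norm x \<longrightarrow> r x = 0"
  shows "smooth (conv v r)"
proof -
  have "times_cont_diff k (conv v r)" if "smooth r" "\<forall>x. e < norm x \<longrightarrow> r x = 0" for k r
    using that
  proof (induction k arbitrary: r)
    case 0
    have "continuous (at x) (conv v r)" for x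
      using GDERIV_conv[OF v GDERIV_gradient[OF 0(1)] smooth_continuous_gradient[OF 0(1)] 0(2)]
        has_derivative_continuous unfolding gderiv_def by blast
    then show ?case by (simp add: continuous_on_eq_continuous_at)
  next
    case (Suc k)
    note G = GDERIV_conv[OF v GDERIV_gradient[OF Suc.prems(1)] smooth_continuous_gradient[OF Suc.prems(1)] Suc.prems(2)]
    have supp: "\<forall>z. e < norm z \<longrightarrow> gradient r z = 0"
      using GDERIV_zero_off_support[OF GDERIV_gradient[OF Suc.prems(1)], of "- cball 0 e"] Suc.prems(2) by force
    have "times_cont_diff k (\<lambda>x. conv v (gradient r) x \<bullet> b)" if "b \<in> Basis" for b
    proof -
      have "(\<lambda>x. conv v (gradient r) x \<bullet> b) = conv v (\<lambda>z. gradient r z \<bullet> b)"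
        using conv_integrable(1)[OF v smooth_continuous_gradient[OF Suc.prems(1)] supp]
        by (auto simp: conv_def integral_inner_left[symmetric])
      moreover have "times_cont_diff k (conv v (\<lambda>z. gradient r z \<bullet> b))"
        by (rule Suc.IH) (auto simp: smooth_gradient_inner[OF Suc.prems(1) that] supp)
      ultimately show ?thesis by simp
    qed
    then show ?case using G by auto
  qed
  then show ?thesis using assms(2,3) by (simp add: smooth_def)
qed

definition mollifiers :: "real \<Rightarrow> ('a::euclidean_space \<Rightarrow> real) set" where
  "mollifiers e = {r. smooth r \<and> (\<forall>x. 0 \<le> r x) \<and> (\<forall>x. e < norm x \<longrightarrow> r x = 0) \<and> (LINT x|lebesgue. r x) = 1}"

lemma mollifiersD:
  assumes "r \<in> mollifiers e"
  shows "smooth r" "0 \<le> r x" "\<forall>x. e < norm x \<longrightarrow> r x = 0" "(LINT x|lebesgue. r x) = 1"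
    "continuous_on UNIV r" "integrable lebesgue r"
proof -
  show r: "smooth r" "0 \<le> r x" "\<forall>x. e < norm x \<longrightarrow> r x = 0" "(LINT x|lebesgue. r x) = 1" for x
    using assms by (auto simp: mollifiers_def)
  then show "continuous_on UNIV r" using smooth_continuous by blast
  then show "integrable lebesgue r"
    by (rule integrable_continuous_bounded_support[of _ "cball 0 e"]) (use r(3) in auto)
qed

lemma mollifiers_nonempty:
  assumes "0 < e"
  shows "mollifiers e \<noteq> ({} :: ('a::euclidean_space \<Rightarrow> real) set)"
proof -
  let ?b = "ball_bump e :: 'a \<Rightarrow> real"
  have supp: "?b x = 0" if "\<not> norm x < e" for x
    using that ball_bump_nonneg[of e x] ball_bump_pos_iff[OF assms, of x] by linarith
  have int: "integrable lebesgue ?b"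
    using supp by (intro integrable_continuous_bounded_support[of _ "cball 0 e"] smooth_continuous smooth_ball_bump) auto
  have "0 < (LINT x|lebesgue. ?b x)"
  proof -
    have "(LINT x|lebesgue. ?b x) \<noteq> 0"
    proof
      assume "(LINT x|lebesgue. ?b x) = 0"
      then have "AE x in lebesgue. ?b x = 0"
        using integral_nonneg_eq_0_iff_AE[OF int] ball_bump_nonneg by auto
      then have "AE x in lebesgue. (x::'a) \<notin> ball 0 e"
        by (rule AE_mp) (use ball_bump_pos_iff[OF assms] in \<open>force intro!: AE_I2\<close>)
      then have "ball (0::'a) e \<in> null_sets lebesgue"
        by (subst AE_iff_null_sets) auto
      then have "ball (0::'a) e = {}" using open_not_negligible negligible_iff_null_sets open_ball by blast
      then show False using assms by simp
    qed
    moreover have "0 \<le> (LINT x|lebesgue. ?b x)" by (intro integral_nonneg_AE) (simp add: ball_bump_nonneg)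
    ultimately show ?thesis by linarith
  qed
  moreover have "smooth (\<lambda>x. (1 / (LINT x|lebesgue. ?b x)) * ?b x)"
    by (intro smooth_cmult smooth_ball_bump)
  ultimately have "(\<lambda>x. (1 / (LINT x|lebesgue. ?b x)) * ?b x) \<in> mollifiers e"
    using supp by (auto simp: mollifiers_def ball_bump_nonneg)
  then show ?thesis by blast
qed

lemma mollifiers_mono: "e \<le> e' \<Longrightarrow> mollifiers e \<subseteq> mollifiers e'"
  unfolding mollifiers_def by force

text \<open>Convexity of the set of kernels is what allows gradients of mollified functions to be selected by
  norm minimization below.\<close>

lemma mollifiers_midpoint:
  assumes "r \<in> mollifiers e" "s \<in> mollifiers e"
  shows "(\<lambda>x. (1/2) * (r x + s x)) \<in> mollifiers e"
proof -
  have "smooth (\<lambda>x. (1/2) * (r x + s x))"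
    using assms by (intro smooth_cmult smooth_add mollifiersD(1))
  then show ?thesis
    using assms mollifiersD(6)[OF assms(1)] mollifiersD(6)[OF assms(2)] by (auto simp: mollifiers_def)
qed

lemma mollify:
  fixes v :: "'a::euclidean_space \<Rightarrow> real"
  assumes v: "L-lipschitz_on UNIV v" and r: "r \<in> mollifiers e"
  shows smooth_mollify: "smooth (conv v r)"
    and mollify_close: "\<bar>conv v r x - v x\<bar> \<le> L * e"
    and mollify_lipschitz: "L-lipschitz_on UNIV (conv v r)"
    and mollify_gradient_bound: "norm (gradient (conv v r) x) \<le> L"
    and mollify_zero: "(\<And>y. dist x y \<le> e \<Longrightarrow> v y = 0) \<Longrightarrow> conv v r x = 0"
proof -
  have vc: "continuous_on UNIV v" using v lipschitz_on_continuous_on by blast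
  note m = mollifiersD[OF r]
  have L: "0 \<le> L" using lipschitz_on_nonneg[OF v] .
  have eq: "conv v r x = (LINT z|lebesgue. v (x - z) * r z)" for x
    using conv_commute[OF vc m(5) m(3)] by simp
  have int: "integrable lebesgue (\<lambda>z. v (x - z) * r z)" for x
    using conv_integrable(2)[OF vc m(5) m(3)] by simp
  show sm: "smooth (conv v r)" by (rule smooth_conv[OF vc m(1) m(3)])
  show lip: "L-lipschitz_on UNIV (conv v r)"
  proof (rule lipschitz_onI[OF _ L])
    fix x y :: 'a
    have "conv v r x - conv v r y = (LINT z|lebesgue. v (x - z) * r z - v (y - z) * r z)"
      using int by (simp add: eq)
    also have "norm \<dots> \<le> (LINT z|lebesgue. (L * dist x y) * r z)"
    proof (rule Bochner_Integration.integral_norm_bound_integral)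
      fix z
      have "\<bar>v (x - z) - v (y - z)\<bar> \<le> L * dist x y"
        using lipschitz_onD[OF v, of "x - z" "y - z"] by (simp add: dist_norm)
      from mult_right_mono[OF this, of "r z"]
      show "norm (v (x - z) * r z - v (y - z) * r z) \<le> (L * dist x y) * r z"
        using m(2)[of z] by (simp add: left_diff_distrib[symmetric] abs_mult)
    qed (use int m(6) in auto)
    also have "\<dots> = L * dist x y" using m(4) by simp
    finally show "dist (conv v r x) (conv v r y) \<le> L * dist x y" by (simp add: dist_norm)
  qed
  show "norm (gradient (conv v r) x) \<le> L"
    using GDERIV_lipschitz_bound[OF GDERIV_gradient[OF sm] lip] .
  show "\<bar>conv v r x - v x\<bar> \<le> L * e"
  proof -
    have "conv v r x - v x = (LINT z|lebesgue. v (x - z) * r z - v x * r z)"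
      using int m(4,6) by (simp add: eq)
    also have "norm \<dots> \<le> (LINT z|lebesgue. (L * e) * r z)"
    proof (rule Bochner_Integration.integral_norm_bound_integral)
      fix z
      show "norm (v (x - z) * r z - v x * r z) \<le> (L * e) * r z"
      proof (cases "e < norm z")
        case True
        then show ?thesis using m(3) by simp
      next
        case False
        have "\<bar>v (x - z) - v x\<bar> \<le> L * norm z"
          using lipschitz_onD[OF v, of "x - z" x] by (simp add: dist_norm)
        also have "\<dots> \<le> L * e" using False L by (intro mult_left_mono) auto
        finally show ?thesis
          using mult_right_mono[of "\<bar>v (x - z) - v x\<bar>" "L * e" "r z"] m(2)[of z]
          by (simp add: left_diff_distrib[symmetric] abs_mult)
      qed
    qed (use int m(6) in auto)
    also have "\<dots> = L * e" using m(4) by simp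
    finally show ?thesis by simp
  qed
  show "conv v r x = 0" if "\<And>y. dist x y \<le> e \<Longrightarrow> v y = 0"
  proof -
    have "v (x - z) * r z = 0" for z
      using that[of "x - z"] m(3) by (cases "e < norm z") (auto simp: dist_norm)
    then have "(\<lambda>z. v (x - z) * r z) = (\<lambda>_. 0)" by blast
    then show ?thesis by (simp only: eq integral_zero)
  qed
qed

section \<open>Uniqueness and permanence of weak gradients\<close>

lemma integral_lebesgue_on_open:
  fixes f :: "'a::euclidean_space \<Rightarrow> 'b::{banach, second_countable_topology}"
  assumes "open U" "\<And>x. x \<notin> U \<Longrightarrow> f x = 0"
  shows "(LINT x|lebesgue_on U. f x) = (LINT x|lebesgue. f x)"
proof -
  have "(\<lambda>x. indicator U x *\<^sub>R f x) = f" using assms(2) by (auto simp: indicator_def)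
  then show ?thesis using assms(1) integral_restrict_space[of U lebesgue f] by simp
qed

lemma test_functionD:
  assumes "test_function U \<phi>"
  shows "smooth \<phi>" "continuous_on UNIV \<phi>" "continuous_on UNIV (gradient \<phi>)"
    "compact (closure {x. \<phi> x \<noteq> 0})" "closure {x. \<phi> x \<noteq> 0} \<subseteq> U"
    "x \<notin> closure {x. \<phi> x \<noteq> 0} \<Longrightarrow> \<phi> x = 0"
    "x \<notin> closure {x. \<phi> x \<noteq> 0} \<Longrightarrow> gradient \<phi> x = 0"
    "x \<notin> U \<Longrightarrow> \<phi> x = 0" "x \<notin> U \<Longrightarrow> gradient \<phi> x = 0"
proof -
  show s: "smooth \<phi>" and c: "compact (closure {x. \<phi> x \<noteq> 0})" and sub: "closure {x. \<phi> x \<noteq> 0} \<subseteq> U"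
    using assms by (auto simp: test_function_def smooth_def)
  show "continuous_on UNIV \<phi>" "continuous_on UNIV (gradient \<phi>)"
    using s smooth_continuous smooth_continuous_gradient by blast+
  have 0: "\<phi> x = 0" if "x \<notin> closure {x. \<phi> x \<noteq> 0}" for x
    using that closure_subset[of "{x. \<phi> x \<noteq> 0}"] by blast
  have 1: "gradient \<phi> x = 0" if "x \<notin> closure {x. \<phi> x \<noteq> 0}" for x
  proof (rule GDERIV_zero_off_support[OF GDERIV_gradient[OF s] open_Compl[OF closed_closure]])
    show "x \<in> - closure {x. \<phi> x \<noteq> 0}" using that by blast
    show "\<phi> y = 0" if "y \<in> - closure {x. \<phi> x \<noteq> 0}" for y using 0[of y] that by blast
  qed
  show "x \<notin> closure {x. \<phi> x \<noteq> 0} \<Longrightarrow> \<phi> x = 0" by (rule 0)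
  show "x \<notin> closure {x. \<phi> x \<noteq> 0} \<Longrightarrow> gradient \<phi> x = 0" by (rule 1)
  show "x \<notin> U \<Longrightarrow> \<phi> x = 0" using 0[of x] sub by blast
  show "x \<notin> U \<Longrightarrow> gradient \<phi> x = 0" using 1[of x] sub by blast
qed

lemma test_functionI:
  assumes "smooth \<phi>" "compact K" "K \<subseteq> U" "\<And>x. x \<notin> K \<Longrightarrow> \<phi> x = 0"
  shows "test_function U \<phi>"
proof -
  have "{x. \<phi> x \<noteq> 0} \<subseteq> K" using assms(4) by blast
  then have sub: "closure {x. \<phi> x \<noteq> 0} \<subseteq> K"
    using assms(2) by (simp add: closure_minimal compact_imp_closed)
  moreover have "compact (closure {x. \<phi> x \<noteq> 0})"
    using compact_Int_closed[OF assms(2) closed_closure] sub by (metis Int_absorb1)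
  ultimately show ?thesis using assms by (auto simp: test_function_def smooth_def)
qed

lemma test_function_mono: "test_function U \<phi> \<Longrightarrow> U \<subseteq> W \<Longrightarrow> test_function W \<phi>"
  by (auto simp: test_function_def)

lemma integrable_test_scaleR:
  fixes W :: "'a::euclidean_space \<Rightarrow> 'b::{banach, second_countable_topology}"
  assumes W: "locally_integrable U W" and h: "continuous_on UNIV h"
    and K: "compact K" "K \<subseteq> U" "\<And>x. x \<notin> K \<Longrightarrow> h x = 0"
  shows "integrable lebesgue (\<lambda>x. h x *\<^sub>R W x)"
proof -
  have WK: "integrable lebesgue (\<lambda>x. indicator K x *\<^sub>R W x)"
    using W K by (simp add: locally_integrable_def set_integrable_def)
  obtain B where B: "0 \<le> B" "\<And>x. norm (h x) \<le> B"
    using continuous_bounded_support[OF h compact_imp_bounded[OF K(1)] K(3)] by blast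
  have "integrable lebesgue (\<lambda>x. h x *\<^sub>R (indicator K x *\<^sub>R W x))"
  proof (rule Bochner_Integration.integrable_bound)
    show "integrable lebesgue (\<lambda>x. B *\<^sub>R norm (indicator K x *\<^sub>R W x))"
      using WK by (intro integrable_scaleR_right integrable_norm)
    show "(\<lambda>x. h x *\<^sub>R (indicator K x *\<^sub>R W x)) \<in> borel_measurable lebesgue"
      using borel_measurable_integrable[OF WK] continuous_borel_measurable_lebesgue[OF h]
      by (rule borel_measurable_scaleR[rotated])
    show "AE x in lebesgue. norm (h x *\<^sub>R (indicator K x *\<^sub>R W x)) \<le> norm (B *\<^sub>R norm (indicator K x *\<^sub>R W x))"
    proof (rule AE_I2)
      fix x
      show "norm (h x *\<^sub>R (indicator K x *\<^sub>R W x)) \<le> norm (B *\<^sub>R norm (indicator K x *\<^sub>R W x))"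
        using mult_right_mono[OF B(2)[of x] norm_ge_zero[of "indicator K x *\<^sub>R W x"]] B(1)
        by (simp add: abs_mult)
    qed
  qed
  moreover have "(\<lambda>x. h x *\<^sub>R (indicator K x *\<^sub>R W x)) = (\<lambda>x. h x *\<^sub>R W x)"
  proof
    show "h x *\<^sub>R (indicator K x *\<^sub>R W x) = h x *\<^sub>R W x" for x
      using K(3)[of x] by (cases "x \<in> K") auto
  qed
  ultimately show ?thesis by simp
qed

lemma integrable_test_function:
  assumes "test_function U \<phi>" "locally_integrable U V"
  shows "integrable lebesgue (\<lambda>x. \<phi> x *\<^sub>R V x)"
  by (rule integrable_test_scaleR[OF assms(2) test_functionD(2,4,5,6)[OF assms(1)]])

lemma integrable_test_gradient:
  assumes "test_function U \<phi>" "locally_integrable U v"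
  shows "integrable lebesgue (\<lambda>x. v x *\<^sub>R gradient \<phi> x)"
proof -
  have "integrable lebesgue (\<lambda>x. \<Sum>b\<in>Basis. ((gradient \<phi> x \<bullet> b) *\<^sub>R v x) *\<^sub>R b)"
  proof (intro Bochner_Integration.integrable_sum integrable_scaleR_left)
    fix b :: 'a
    show "integrable lebesgue (\<lambda>x. (gradient \<phi> x \<bullet> b) *\<^sub>R v x)"
    proof (rule integrable_test_scaleR[OF assms(2) _ test_functionD(4,5)[OF assms(1)]])
      show "continuous_on UNIV (\<lambda>x. gradient \<phi> x \<bullet> b)"
        by (intro continuous_intros test_functionD(3)[OF assms(1)])
      show "gradient \<phi> x \<bullet> b = 0" if "x \<notin> closure {x. \<phi> x \<noteq> 0}" for x
        using test_functionD(7)[OF assms(1) that] by simp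
    qed
  qed
  moreover have "(\<Sum>b\<in>Basis. ((gradient \<phi> x \<bullet> b) *\<^sub>R v x) *\<^sub>R b) = v x *\<^sub>R gradient \<phi> x" for x
  proof -
    have "(\<Sum>b\<in>Basis. ((gradient \<phi> x \<bullet> b) *\<^sub>R v x) *\<^sub>R b) = v x *\<^sub>R (\<Sum>b\<in>Basis. (gradient \<phi> x \<bullet> b) *\<^sub>R b)"
      unfolding scaleR_sum_right by (intro sum.cong) (auto simp: mult.commute)
    then show ?thesis by (simp add: euclidean_representation)
  qed
  ultimately show ?thesis by simp
qed

lemma has_weak_gradient_iff:
  assumes "open U"
  shows "has_weak_gradient U v V \<longleftrightarrow> locally_integrable U v \<and> locally_integrable U V \<and>
    (\<forall>\<phi>. test_function U \<phi> \<longrightarrow> (LINT x|lebesgue. \<phi> x *\<^sub>R V x) = - (LINT x|lebesgue. v x *\<^sub>R gradient \<phi> x))"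
proof -
  have "(\<forall>\<phi> D. test_function U \<phi> \<and> (\<forall>x. GDERIV \<phi> x :> D x) \<longrightarrow> Q \<phi> D) \<longleftrightarrow>
    (\<forall>\<phi>. test_function U \<phi> \<longrightarrow> Q \<phi> (gradient \<phi>))" for Q
  proof (intro iffI allI impI)
    fix \<phi> assume "\<forall>\<phi> D. test_function U \<phi> \<and> (\<forall>x. GDERIV \<phi> x :> D x) \<longrightarrow> Q \<phi> D" "test_function U \<phi>"
    then show "Q \<phi> (gradient \<phi>)" using GDERIV_gradient[OF test_functionD(1)] by blast
  next
    fix \<phi> D assume *: "\<forall>\<phi>. test_function U \<phi> \<longrightarrow> Q \<phi> (gradient \<phi>)"
      and \<phi>: "test_function U \<phi> \<and> (\<forall>x. GDERIV \<phi> x :> D x)"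
    then have "gradient \<phi> = D" using gradient_eq by blast
    then show "Q \<phi> D" using * \<phi> by blast
  qed
  moreover have "(LINT x|lebesgue_on U. \<phi> x *\<^sub>R V x) = (LINT x|lebesgue. \<phi> x *\<^sub>R V x)"
      "(LINT x|lebesgue_on U. v x *\<^sub>R gradient \<phi> x) = (LINT x|lebesgue. v x *\<^sub>R gradient \<phi> x)"
      if "test_function U \<phi>" for \<phi>
    using test_functionD(8,9)[OF that] by (auto intro!: integral_lebesgue_on_open[OF assms])
  ultimately show ?thesis unfolding has_weak_gradient_def by simp
qed

text \<open>Mollify the functions \<open>max 0 (1 - c m * infdist x C)\<close>, whose slopes \<open>c m\<close> tend to infinity, with
  kernels so small that the error \<open>c m * e m\<close> tends to \<open>0\<close> and the supports stay in a
  fixed neighbourhood of \<open>C\<close>.\<close>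

lemma test_functions_to_indicator:
  fixes U :: "'a::euclidean_space set"
  assumes "compact C" "open U" "C \<subseteq> U"
  obtains \<phi> K where "compact K" "K \<subseteq> U" "\<And>m. test_function U (\<phi> m)"
    "\<And>m x. \<bar>\<phi> m x\<bar> \<le> 2" "\<And>m x. x \<notin> K \<Longrightarrow> \<phi> m x = 0"
    "\<And>x. (\<lambda>m::nat. \<phi> m x) \<longlonglongrightarrow> indicator C x"
proof (cases "C = {}")
  case True
  show ?thesis
    by (rule that[of "{}" "\<lambda>_ _. 0"]) (use True in \<open>auto intro!: test_functionI[of _ "{}"] smooth_const\<close>)
next
  case False
  obtain \<delta> where \<delta>: "0 < \<delta>" "{x. infdist x C \<le> \<delta>} \<subseteq> U"
    using compact_in_open_separated[OF False assms] by blast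
  define c where "c m = (real m + 1) * (2 / \<delta>)" for m
  define e where "e m = min (\<delta> / 2) (1 / (c m * (real m + 1)))" for m
  define \<psi> where "\<psi> m x = max 0 (1 - c m * infdist x C)" for m x
  have c: "0 < c m" "2 / \<delta> \<le> c m" for m using \<delta> by (auto simp: c_def field_simps)
  have e: "0 < e m" "e m \<le> \<delta> / 2" "c m * e m \<le> 1 / (real m + 1)" for m
  proof -
    show "0 < e m" "e m \<le> \<delta> / 2" using \<delta> c[of m] by (auto simp: e_def)
    have "c m * e m \<le> c m * (1 / (c m * (real m + 1)))" using c(1)[of m] by (intro mult_left_mono) (auto simp: e_def)
    then show "c m * e m \<le> 1 / (real m + 1)" using c(1)[of m] by simp
  qed
  have lip: "(c m)-lipschitz_on UNIV (\<psi> m)" for m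
  proof (rule lipschitz_onI)
    fix x y
    have "\<bar>infdist x C - infdist y C\<bar> \<le> dist x y" by (rule infdist_triangle_abs)
    then have "c m * \<bar>infdist x C - infdist y C\<bar> \<le> c m * dist x y" using c(1)[of m] by (intro mult_left_mono) auto
    moreover have "\<bar>c m * infdist x C - c m * infdist y C\<bar> = c m * \<bar>infdist x C - infdist y C\<bar>"
      using c(1)[of m] by (simp add: right_diff_distrib[symmetric] abs_mult)
    ultimately show "dist (\<psi> m x) (\<psi> m y) \<le> c m * dist x y"
      unfolding \<psi>_def dist_real_def by linarith
  qed (use c(1)[of m] in simp)
  have "\<exists>r. r \<in> mollifiers (e m)" for m
    using mollifiers_nonempty[OF e(1)[of m]] by blast
  then obtain r :: "nat \<Rightarrow> 'a \<Rightarrow> real" where r: "\<And>m. r m \<in> mollifiers (e m)" by metis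
  define \<phi> where "\<phi> m = conv (\<psi> m) (r m)" for m
  let ?K = "{x. infdist x C \<le> \<delta>}"
  have close: "\<bar>\<phi> m x - \<psi> m x\<bar> \<le> 1 / (real m + 1)" for m x
    using mollify_close[OF lip[of m] r[of m], of x] e(3)[of m] by (simp add: \<phi>_def)
  have supp: "\<phi> m x = 0" if "x \<notin> ?K" for m x
    unfolding \<phi>_def
  proof (rule mollify_zero[OF lip[of m] r[of m]])
    fix y assume y: "dist x y \<le> e m"
    have "infdist x C \<le> infdist y C + dist x y" by (rule infdist_triangle)
    then have "\<delta> / 2 \<le> infdist y C" using y that e(2)[of m] by simp
    then have "(2 / \<delta>) * (\<delta> / 2) \<le> c m * infdist y C" using c[of m] \<delta> by (intro mult_mono) auto
    then show "\<psi> m y = 0" using \<delta> by (simp add: \<psi>_def)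
  qed
  show ?thesis
  proof (rule that[of ?K \<phi>])
    show K: "compact ?K" using compact_infdist_le[OF False assms(1) \<delta>(1)] .
    show "?K \<subseteq> U" by (rule \<delta>(2))
    show "test_function U (\<phi> m)" for m
      by (rule test_functionI[OF _ K \<delta>(2) supp]) (auto simp: \<phi>_def intro: smooth_mollify[OF lip r])
    show "\<bar>\<phi> m x\<bar> \<le> 2" for m x
    proof -
      have "\<bar>\<psi> m x\<bar> \<le> 1" using c(1)[of m] infdist_nonneg[of x C] by (simp add: \<psi>_def)
      moreover have "1 / (real m + 1) \<le> 1" by simp
      ultimately show ?thesis using close[of m x] by linarith
    qed
    show "\<phi> m x = 0" if "x \<notin> ?K" for m x using supp that .
    show "(\<lambda>m. \<phi> m x) \<longlonglongrightarrow> indicator C x" for x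
    proof -
      have "(\<lambda>m. \<psi> m x) \<longlonglongrightarrow> indicator C x"
      proof (cases "x \<in> C")
        case True
        then show ?thesis by (simp add: \<psi>_def)
      next
        case False
        then have pos: "0 < infdist x C"
          using assms(1) \<open>C \<noteq> {}\<close> by (simp add: compact_imp_closed infdist_pos_not_in_closed)
        obtain N where N: "\<delta> / (2 * infdist x C) < real N" using reals_Archimedean2 by blast
        have "\<psi> m x = 0" if "N \<le> m" for m
        proof -
          have "\<delta> / (2 * infdist x C) \<le> real m + 1" using N that by linarith
          then have "1 \<le> c m * infdist x C" using pos \<delta>(1) by (simp add: c_def field_simps)
          then show ?thesis by (simp add: \<psi>_def)
        qed
        then have "\<forall>\<^sub>F m in sequentially. \<psi> m x = 0" by (auto simp: eventually_sequentially)
        then show ?thesis using False by (simp add: tendsto_eventually)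
      qed
      moreover have "(\<lambda>m. \<phi> m x - \<psi> m x) \<longlonglongrightarrow> 0"
      proof (rule Lim_null_comparison)
        show "\<forall>\<^sub>F m in sequentially. norm (\<phi> m x - \<psi> m x) \<le> 1 / (real m + 1)" using close by simp
        show "(\<lambda>m. 1 / (real m + 1)) \<longlonglongrightarrow> 0" using LIMSEQ_inverse_real_of_nat by (simp add: inverse_eq_divide add.commute)
      qed
      ultimately have "(\<lambda>m. \<phi> m x - \<psi> m x + \<psi> m x) \<longlonglongrightarrow> 0 + indicator C x" by (rule tendsto_add[rotated])
      then show ?thesis by simp
    qed
  qed
qed

text \<open>By inner regularity the set where \<open>f\<close> is positive is exhausted, up to a null set, by compact sets, and each
  of them is null because a positive function integrates to \<open>0\<close> over it.\<close>

lemma AE_nonpos_if_integrals_over_compacts_vanish: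
  fixes f :: "'a::euclidean_space \<Rightarrow> real"
  assumes "open U" and int: "\<And>C. compact C \<Longrightarrow> C \<subseteq> U \<Longrightarrow> integrable lebesgue (\<lambda>x. indicator C x * f x)"
    and zero: "\<And>C. compact C \<Longrightarrow> C \<subseteq> U \<Longrightarrow> (LINT x|lebesgue. indicator C x * f x) = 0"
  shows "AE x in lebesgue. x \<in> U \<longrightarrow> f x \<le> 0"
proof -
  obtain C :: "nat \<Rightarrow> 'a set" where C: "\<And>n. compact (C n)" "\<And>n. C n \<subseteq> U" "\<Union>(range C) = U"
    using open_Union_compact_subsets[OF assms(1)] by metis
  have "AE x in lebesgue. x \<in> C n \<longrightarrow> f x \<le> 0" for n
  proof -
    define A where "A = {x \<in> space lebesgue. 0 < indicator (C n) x * f x}"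
    have A: "A \<in> sets lebesgue" unfolding A_def
      using borel_measurable_integrable[OF int[OF C(1,2)]] by (intro borel_measurable_less) auto
    have sub: "x \<in> C n \<and> 0 < f x" if "x \<in> A" for x using that by (cases "x \<in> C n") (auto simp: A_def)
    have small: "emeasure lebesgue A \<le> ennreal \<epsilon>" if "0 < \<epsilon>" for \<epsilon>
    proof -
      obtain T where T: "closed T" "T \<subseteq> A" "A - T \<in> lmeasurable" "emeasure lebesgue (A - T) < ennreal \<epsilon>"
        using sets_lebesgue_inner_closed[OF A \<open>0 < \<epsilon>\<close>] by blast
      have "T \<subseteq> C n" using T(2) sub by blast
      then have Tc: "compact T" "T \<subseteq> U"
        using T(1) C(1)[of n] C(2)[of n] by (auto simp: compact_eq_bounded_closed intro: bounded_subset)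
      have "AE x in lebesgue. indicator T x * f x = 0"
        using integral_nonneg_eq_0_iff_AE[OF int[OF Tc]] zero[OF Tc] T(2) sub
        by (fastforce simp: indicator_def)
      then have "AE x in lebesgue. x \<notin> T"
        by eventually_elim (use T(2) sub in \<open>fastforce simp: indicator_def split: if_splits\<close>)
      then have "T \<in> null_sets lebesgue" using T(1) by (subst AE_iff_null_sets) auto
      moreover have "emeasure lebesgue A \<le> emeasure lebesgue T + emeasure lebesgue (A - T)"
        using emeasure_subadditive[of T lebesgue "A - T"] T A by (auto simp: Un_absorb1)
      ultimately show ?thesis using T(4) by (simp add: null_setsD1)
    qed
    have "emeasure lebesgue A = 0"
    proof (rule ccontr)
      assume ne: "emeasure lebesgue A \<noteq> 0"
      have fin: "emeasure lebesgue A \<le> ennreal 1" using small[of 1] by simp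
      define t where "t = measure lebesgue A"
      have t: "emeasure lebesgue A = ennreal t"
        unfolding t_def using fin by (intro emeasure_eq_ennreal_measure) (auto simp: top_unique)
      have "0 < t" using ne t by (cases "t > 0") (auto simp: ennreal_neg)
      then have "ennreal t \<le> ennreal (t / 2)" using small[of "t / 2"] t by simp
      then show False using \<open>0 < t\<close> by simp
    qed
    then have "AE x in lebesgue. x \<notin> A" using A by (subst AE_iff_null_sets[symmetric]) auto
    then show ?thesis by eventually_elim (auto simp: A_def indicator_def not_le)
  qed
  then have "AE x in lebesgue. \<forall>n. x \<in> C n \<longrightarrow> f x \<le> 0" by (intro AE_all_countable[THEN iffD2] allI)
  then show ?thesis by eventually_elim (use C(3) in blast)
qed

text \<open>The difference of two weak gradients integrates to zero against all test functions, hence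
  over all compact subsets.\<close>

lemma has_weak_gradient_unique:
  fixes V V' :: "'a::euclidean_space \<Rightarrow> 'a"
  assumes U: "open U" and V: "has_weak_gradient U v V" and V': "has_weak_gradient U v V'"
  shows "AE x in lebesgue. x \<in> U \<longrightarrow> V x = V' x"
proof -
  note li = V[unfolded has_weak_gradient_iff[OF U]] V'[unfolded has_weak_gradient_iff[OF U]]
  define W where "W x = V x - V' x" for x
  have intV: "integrable lebesgue (\<lambda>x. indicator C x *\<^sub>R V x)" "integrable lebesgue (\<lambda>x. indicator C x *\<^sub>R V' x)"
    if "compact C" "C \<subseteq> U" for C
    using li that by (auto simp: locally_integrable_def set_integrable_def)
  have intW: "integrable lebesgue (\<lambda>x. indicator C x *\<^sub>R W x)" if "compact C" "C \<subseteq> U" for C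
  proof -
    have "(\<lambda>x. indicator C x *\<^sub>R W x) = (\<lambda>x. indicator C x *\<^sub>R V x - indicator C x *\<^sub>R V' x)"
      by (auto simp: W_def scaleR_diff_right)
    then show ?thesis using intV[OF that] by auto
  qed
  have test0: "(LINT x|lebesgue. \<phi> x *\<^sub>R W x) = 0" if "test_function U \<phi>" for \<phi>
  proof -
    have "(LINT x|lebesgue. \<phi> x *\<^sub>R W x) = (LINT x|lebesgue. \<phi> x *\<^sub>R V x - \<phi> x *\<^sub>R V' x)"
      by (simp add: W_def scaleR_diff_right)
    also have "\<dots> = (LINT x|lebesgue. \<phi> x *\<^sub>R V x) - (LINT x|lebesgue. \<phi> x *\<^sub>R V' x)"
      using integrable_test_function[OF that] li by (intro Bochner_Integration.integral_diff) auto
    finally show ?thesis using li that by auto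
  qed
  have zero: "(LINT x|lebesgue. indicator C x *\<^sub>R W x) = 0" if C: "compact C" "C \<subseteq> U" for C
  proof -
    obtain \<phi> K where \<phi>: "compact K" "K \<subseteq> U" "\<And>m. test_function U (\<phi> m)"
      "\<And>m x. \<bar>\<phi> m x\<bar> \<le> 2" "\<And>m x. x \<notin> K \<Longrightarrow> \<phi> m x = 0"
      "\<And>x. (\<lambda>m::nat. \<phi> m x) \<longlonglongrightarrow> indicator C x"
      using test_functions_to_indicator[OF C(1) U C(2)] by metis
    have LW: "locally_integrable U W" using intW by (simp add: locally_integrable_def set_integrable_def)
    have "(\<lambda>m. LINT x|lebesgue. \<phi> m x *\<^sub>R W x) \<longlonglongrightarrow> (LINT x|lebesgue. indicator C x *\<^sub>R W x)"
    proof (rule integral_dominated_convergence[where w="\<lambda>x. 2 * norm (indicator K x *\<^sub>R W x)"])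
      show "(\<lambda>x. indicator C x *\<^sub>R W x) \<in> borel_measurable lebesgue" using intW[OF C] by simp
      show "(\<lambda>x. \<phi> m x *\<^sub>R W x) \<in> borel_measurable lebesgue" for m
        using integrable_test_function[OF \<phi>(3) LW] by simp
      show "integrable lebesgue (\<lambda>x. 2 * norm (indicator K x *\<^sub>R W x))"
        using intW[OF \<phi>(1,2)] by (intro integrable_mult_right integrable_norm)
      show "AE x in lebesgue. (\<lambda>m. \<phi> m x *\<^sub>R W x) \<longlonglongrightarrow> indicator C x *\<^sub>R W x"
        by (intro AE_I2 tendsto_scaleR \<phi>(6) tendsto_const)
      show "AE x in lebesgue. norm (\<phi> m x *\<^sub>R W x) \<le> 2 * norm (indicator K x *\<^sub>R W x)" for m
      proof (rule AE_I2)
        fix x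
        show "norm (\<phi> m x *\<^sub>R W x) \<le> 2 * norm (indicator K x *\<^sub>R W x)"
          using \<phi>(4)[of m x] \<phi>(5)[of x m] by (cases "x \<in> K") (auto intro!: mult_right_mono)
      qed
    qed
    then show ?thesis using test0[OF \<phi>(3)] by (simp add: LIMSEQ_const_iff)
  qed
  have comp: "AE x in lebesgue. x \<in> U \<longrightarrow> W x \<bullet> c \<le> 0" for c
  proof (rule AE_nonpos_if_integrals_over_compacts_vanish[OF U])
    fix C :: "'a set" assume C: "compact C" "C \<subseteq> U"
    have eq: "(\<lambda>x. indicator C x * (W x \<bullet> c)) = (\<lambda>x. (indicator C x *\<^sub>R W x) \<bullet> c)" by simp
    show "integrable lebesgue (\<lambda>x. indicator C x * (W x \<bullet> c))"
      unfolding eq using intW[OF C] by (intro integrable_inner_left)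
    have "(LINT x|lebesgue. (indicator C x *\<^sub>R W x) \<bullet> c) = (LINT x|lebesgue. indicator C x *\<^sub>R W x) \<bullet> c"
      by (rule integral_inner_left) (rule intW[OF C])
    then show "(LINT x|lebesgue. indicator C x * (W x \<bullet> c)) = 0" unfolding eq using zero[OF C] by simp
  qed
  have "AE x in lebesgue. \<forall>b\<in>Basis. (x \<in> U \<longrightarrow> W x \<bullet> b \<le> 0) \<and> (x \<in> U \<longrightarrow> W x \<bullet> (- b) \<le> 0)"
  proof (subst AE_finite_all, simp, intro ballI AE_conjI)
    show "AE x in lebesgue. x \<in> U \<longrightarrow> W x \<bullet> b \<le> 0" for b by (rule comp)
    show "AE x in lebesgue. x \<in> U \<longrightarrow> W x \<bullet> (- b) \<le> 0" for b by (rule comp)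
  qed
  then show ?thesis
  proof eventually_elim
    case (elim x)
    show ?case
    proof
      assume "x \<in> U"
      then have "W x \<bullet> b = 0" if "b \<in> Basis" for b using elim that by fastforce
      then have "W x = 0" by (simp add: euclidean_eq_iff[of "W x" 0])
      then show "V x = V' x" by (simp add: W_def)
    qed
  qed
qed

lemma locally_integrable_bounded:
  fixes V :: "'a::euclidean_space \<Rightarrow> 'b::{banach, second_countable_topology}"
  assumes "V \<in> borel_measurable lebesgue" "AE x in lebesgue. norm (V x) \<le> M"
  shows "locally_integrable U V"
  unfolding locally_integrable_def set_integrable_def
proof (intro allI impI)
  fix C :: "'a set" assume C: "compact C \<and> C \<subseteq> U"
  have m: "(indicator C :: 'a \<Rightarrow> real) \<in> borel_measurable lebesgue"
    using C by (intro borel_measurable_indicator) (auto simp: compact_imp_closed)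
  show "integrable lebesgue (\<lambda>x. indicator C x *\<^sub>R V x)"
  proof (rule integrable_bounded_support[of _ C "\<bar>M\<bar>"])
    show "AE x in lebesgue. norm (indicator C x *\<^sub>R V x) \<le> \<bar>M\<bar>"
      using assms(2) by eventually_elim (auto simp: indicator_def)
  qed (use C assms(1) m in \<open>auto intro: compact_imp_bounded\<close>)
qed

lemma locally_integrable_continuous:
  fixes v :: "'a::euclidean_space \<Rightarrow> real"
  assumes "continuous_on UNIV v"
  shows "locally_integrable U v"
  unfolding locally_integrable_def set_integrable_def
proof (intro allI impI)
  fix C :: "'a set" assume C: "compact C \<and> C \<subseteq> U"
  have m: "(indicator C :: 'a \<Rightarrow> real) \<in> borel_measurable lebesgue"
    using C by (intro borel_measurable_indicator) (auto simp: compact_imp_closed)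
  have "bounded (v ` C)"
    using C by (intro compact_imp_bounded compact_continuous_image continuous_on_subset[OF assms]) auto
  then obtain B where B: "\<forall>x\<in>C. \<bar>v x\<bar> \<le> B" by (auto simp: bounded_iff)
  show "integrable lebesgue (\<lambda>x. indicator C x *\<^sub>R v x)"
  proof (rule integrable_bounded_support[of _ C "\<bar>B\<bar>"])
    show "AE x in lebesgue. norm (indicator C x *\<^sub>R v x) \<le> \<bar>B\<bar>"
      using B by (intro AE_I2) (fastforce simp: indicator_def)
  qed (use C continuous_borel_measurable_lebesgue[OF assms] m in \<open>auto intro: compact_imp_bounded\<close>)
qed

lemma locally_integrable_measurable:
  fixes V :: "'a::euclidean_space \<Rightarrow> 'b::{banach, second_countable_topology}"
  assumes "open U" "locally_integrable U V"
  shows "(\<lambda>x. indicator U x *\<^sub>R V x) \<in> borel_measurable lebesgue"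
    and "V \<in> borel_measurable (lebesgue_on U)"
proof -
  obtain C :: "nat \<Rightarrow> 'a set" where C: "\<And>n. compact (C n)" "\<And>n. C n \<subseteq> U"
    "\<And>n. C n \<subseteq> interior (C (Suc n))" "\<Union>(range C) = U"
    using open_Union_compact_subsets[OF assms(1)] by metis
  have mono: "C n \<subseteq> C m" if "n \<le> m" for n m
    using that by (induction rule: dec_induct) (use C(3) interior_subset in blast)+
  have m: "(\<lambda>x. indicator (C n) x *\<^sub>R V x) \<in> borel_measurable lebesgue" for n
    using assms(2) C(1,2) by (intro borel_measurable_integrable) (auto simp: locally_integrable_def set_integrable_def)
  show *: "(\<lambda>x. indicator U x *\<^sub>R V x) \<in> borel_measurable lebesgue"
  proof (rule borel_measurable_LIMSEQ_metric[OF m])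
    fix x
    show "(\<lambda>n. indicator (C n) x *\<^sub>R V x) \<longlonglongrightarrow> indicator U x *\<^sub>R V x"
    proof (cases "x \<in> U")
      case True
      then obtain N where "x \<in> C N" using C(4) by blast
      then have "\<forall>\<^sub>F n in sequentially. indicator (C n) x *\<^sub>R V x = V x"
        using mono by (auto simp: eventually_sequentially indicator_def intro!: exI[of _ N])
      then show ?thesis using True by (simp add: tendsto_eventually)
    next
      case False
      then have "x \<notin> C n" for n using C(2) by blast
      then show ?thesis using False by simp
    qed
  qed
  show "V \<in> borel_measurable (lebesgue_on U)"
    using * assms(1) by (subst borel_measurable_restrict_space_iff) auto
qed

lemma has_weak_gradientD:
  assumes "has_weak_gradient U v V"
  shows "locally_integrable U v" "locally_integrable U V"
  using assms by (auto simp: has_weak_gradient_def)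

lemma has_weak_gradient_testD:
  assumes "open U" "has_weak_gradient U v V" "test_function U \<phi>"
  shows "(LINT x|lebesgue. \<phi> x *\<^sub>R V x) = - (LINT x|lebesgue. v x *\<^sub>R gradient \<phi> x)"
  using assms by (simp add: has_weak_gradient_iff)

lemma has_weak_gradient_restrict:
  assumes "open U" "open W" "U \<subseteq> W" "has_weak_gradient W v V"
  shows "has_weak_gradient U v V"
  using assms test_function_mono[OF _ assms(3)]
  unfolding has_weak_gradient_iff[OF assms(1)] has_weak_gradient_iff[OF assms(2)]
  by (auto simp: locally_integrable_def)

lemma locally_integrable_cong:
  assumes "\<And>x. x \<in> U \<Longrightarrow> v x = v' x"
  shows "locally_integrable U v \<longleftrightarrow> locally_integrable U v'"
proof -
  have "indicator C x *\<^sub>R v x = indicator C x *\<^sub>R v' x" if "C \<subseteq> U" for C x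
    using that assms[of x] by (cases "x \<in> C") auto
  then have "(\<lambda>x. indicator C x *\<^sub>R v x) = (\<lambda>x. indicator C x *\<^sub>R v' x)" if "C \<subseteq> U" for C
    using that by auto
  then show ?thesis by (auto simp: locally_integrable_def set_integrable_def)
qed

lemma has_weak_gradient_cong:
  assumes "\<And>x. x \<in> U \<Longrightarrow> v x = v' x"
  shows "has_weak_gradient U v V \<longleftrightarrow> has_weak_gradient U v' V"
proof -
  have "(LINT x|lebesgue_on U. v x *\<^sub>R D x) = (LINT x|lebesgue_on U. v' x *\<^sub>R D x)" for D :: "'a \<Rightarrow> 'a"
    using assms by (intro Bochner_Integration.integral_cong) auto
  moreover have "locally_integrable U v \<longleftrightarrow> locally_integrable U v'" by (rule locally_integrable_cong[OF assms])
  ultimately show ?thesis by (simp add: has_weak_gradient_def)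
qed

lemma weak_gradient_cong:
  assumes "\<And>x. x \<in> U \<Longrightarrow> v x = v' x"
  shows "weak_gradient U v = weak_gradient U v'"
proof -
  have "has_weak_gradient U v = has_weak_gradient U v'"
    by (rule ext) (rule has_weak_gradient_cong[OF assms])
  then show ?thesis by (simp add: weak_gradient_def)
qed

lemma has_weak_gradient_weak_gradient:
  "has_weak_gradient U v V \<Longrightarrow> has_weak_gradient U v (weak_gradient U v)"
  unfolding weak_gradient_def by (rule someI[of "has_weak_gradient U v"])

lemma has_weak_gradient_add:
  assumes "open U" "has_weak_gradient U v V" "has_weak_gradient U w W"
  shows "has_weak_gradient U (\<lambda>x. v x + w x) (\<lambda>x. V x + W x)"
  unfolding has_weak_gradient_iff[OF assms(1)]
proof (intro conjI allI impI)
  note li = has_weak_gradientD[OF assms(2)] has_weak_gradientD[OF assms(3)]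
  show "locally_integrable U (\<lambda>x. v x + w x)" "locally_integrable U (\<lambda>x. V x + W x)"
    using li unfolding locally_integrable_def by (auto intro: set_integral_add)
  fix \<phi> assume \<phi>: "test_function U \<phi>"
  note i = integrable_test_function[OF \<phi> li(2)] integrable_test_function[OF \<phi> li(4)]
    integrable_test_gradient[OF \<phi> li(1)] integrable_test_gradient[OF \<phi> li(3)]
  show "(LINT x|lebesgue. \<phi> x *\<^sub>R (V x + W x)) = - (LINT x|lebesgue. (v x + w x) *\<^sub>R gradient \<phi> x)"
    using i has_weak_gradient_testD[OF assms(1,2) \<phi>] has_weak_gradient_testD[OF assms(1,3) \<phi>]
    by (simp add: scaleR_add_right scaleR_add_left)
qed

lemma has_weak_gradient_cmult:
  assumes "open U" "has_weak_gradient U v V"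
  shows "has_weak_gradient U (\<lambda>x. c * v x) (\<lambda>x. c *\<^sub>R V x)"
  unfolding has_weak_gradient_iff[OF assms(1)]
proof (intro conjI allI impI)
  note li = has_weak_gradientD[OF assms(2)]
  show "locally_integrable U (\<lambda>x. c * v x)" "locally_integrable U (\<lambda>x. c *\<^sub>R V x)"
    using li unfolding locally_integrable_def by auto
  fix \<phi> assume \<phi>: "test_function U \<phi>"
  have "(LINT x|lebesgue. \<phi> x *\<^sub>R (c *\<^sub>R V x)) = (LINT x|lebesgue. c *\<^sub>R (\<phi> x *\<^sub>R V x))"
    by (simp add: mult.commute)
  also have "\<dots> = c *\<^sub>R (LINT x|lebesgue. \<phi> x *\<^sub>R V x)" by (rule integral_scaleR_right)
  also have "\<dots> = - (c *\<^sub>R (LINT x|lebesgue. v x *\<^sub>R gradient \<phi> x))"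
    using has_weak_gradient_testD[OF assms \<phi>] by simp
  also have "c *\<^sub>R (LINT x|lebesgue. v x *\<^sub>R gradient \<phi> x) = (LINT x|lebesgue. c *\<^sub>R (v x *\<^sub>R gradient \<phi> x))"
    by (rule integral_scaleR_right[symmetric])
  finally show "(LINT x|lebesgue. \<phi> x *\<^sub>R (c *\<^sub>R V x)) = - (LINT x|lebesgue. (c * v x) *\<^sub>R gradient \<phi> x)"
    by simp
qed

lemma has_weak_gradient_diff:
  assumes "open U" "has_weak_gradient U v V" "has_weak_gradient U w W"
  shows "has_weak_gradient U (\<lambda>x. v x - w x) (\<lambda>x. V x - W x)"
  using has_weak_gradient_add[OF assms(1,2) has_weak_gradient_cmult[OF assms(1,3), of "-1"]] by simp

lemma has_weak_gradient_shift:
  fixes v :: "'a::euclidean_space \<Rightarrow> real"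
  assumes "has_weak_gradient UNIV v V" "continuous_on UNIV v" "V \<in> borel_measurable lebesgue"
    "AE x in lebesgue. norm (V x) \<le> M"
  shows "has_weak_gradient UNIV (\<lambda>x. v (x + \<tau>)) (\<lambda>x. V (x + \<tau>))"
  unfolding has_weak_gradient_iff[OF open_UNIV]
proof (intro conjI allI impI)
  have c: "continuous_on UNIV (\<lambda>x. v (x + \<tau>))"
    by (rule continuous_on_compose2[OF assms(2)]) (auto intro!: continuous_intros)
  show "locally_integrable UNIV (\<lambda>x. v (x + \<tau>))" using c by (rule locally_integrable_continuous)
  show "locally_integrable UNIV (\<lambda>x. V (x + \<tau>))"
    by (rule locally_integrable_bounded[of _ M])
      (rule measurable_compose[OF lebesgue_shift(1) assms(3)], rule AE_lebesgue_shift[OF assms(4)])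
  fix \<phi> :: "'a \<Rightarrow> real" assume \<phi>: "test_function UNIV \<phi>"
  define \<phi>' where "\<phi>' x = \<phi> (x - \<tau>)" for x
  have G: "GDERIV \<phi>' x :> gradient \<phi> (x - \<tau>)" for x
  proof -
    have "(\<phi> has_derivative (\<lambda>h. h \<bullet> gradient \<phi> (x - \<tau>))) (at (x - \<tau>))"
      using GDERIV_gradient[OF test_functionD(1)[OF \<phi>]] by (simp add: gderiv_def)
    moreover have "((\<lambda>x. x - \<tau>) has_derivative (\<lambda>h. h)) (at x)" by (auto intro!: derivative_eq_intros)
    ultimately show ?thesis unfolding gderiv_def \<phi>'_def by (rule has_derivative_compose[rotated])
  qed
  have "times_cont_diff k (\<lambda>x. f (x - \<tau>))" if "times_cont_diff k f" for k and f :: "'a \<Rightarrow> real"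
    using that
  proof (induction k arbitrary: f)
    case 0
    then show ?case unfolding times_cont_diff.simps
      by (rule continuous_on_compose2) (auto intro!: continuous_intros)
  next
    case (Suc k)
    then obtain D where D: "\<forall>x. GDERIV f x :> D x" "\<forall>b\<in>Basis. times_cont_diff k (\<lambda>x. D x \<bullet> b)" by auto
    have "GDERIV (\<lambda>x. f (x - \<tau>)) x :> D (x - \<tau>)" for x
    proof -
      have "((\<lambda>x. x - \<tau>) has_derivative (\<lambda>h. h)) (at x)" by (auto intro!: derivative_eq_intros)
      then show ?thesis using D(1) unfolding gderiv_def by (auto intro: has_derivative_compose)
    qed
    moreover have "times_cont_diff k (\<lambda>x. D (x - \<tau>) \<bullet> b)" if "b \<in> Basis" for b
      using Suc.IH[of "\<lambda>x. D x \<bullet> b"] D(2) that by simp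
    ultimately show ?case unfolding times_cont_diff.simps by (intro exI[of _ "\<lambda>x. D (x - \<tau>)"]) blast
  qed
  then have "smooth \<phi>'" using test_functionD(1)[OF \<phi>] by (simp add: smooth_def \<phi>'_def[abs_def])
  moreover have "compact ((\<lambda>x. x + \<tau>) ` closure {x. \<phi> x \<noteq> 0})"
    using test_functionD(4)[OF \<phi>] by (intro compact_continuous_image continuous_intros)
  moreover have "\<phi>' x = 0" if "x \<notin> (\<lambda>x. x + \<tau>) ` closure {x. \<phi> x \<noteq> 0}" for x
  proof -
    have "x - \<tau> \<notin> closure {x. \<phi> x \<noteq> 0}" using that by (metis diff_add_cancel image_eqI)
    from test_functionD(6)[OF \<phi> this] show ?thesis by (simp add: \<phi>'_def)
  qed
  ultimately have \<phi>': "test_function UNIV \<phi>'" by (intro test_functionI[of _ "(\<lambda>x. x + \<tau>) ` closure {x. \<phi> x \<noteq> 0}"]) auto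
  have 1: "(LINT x|lebesgue. \<phi> x *\<^sub>R V (x + \<tau>)) = (LINT x|lebesgue. \<phi>' x *\<^sub>R V x)"
    using integral_lebesgue_shift[of "\<lambda>x. \<phi>' x *\<^sub>R V x" \<tau>]
      integrable_test_function[OF \<phi>' has_weak_gradientD(2)[OF assms(1)]]
    by (simp add: \<phi>'_def borel_measurable_integrable)
  have gr: "gradient \<phi>' x = gradient \<phi> (x - \<tau>)" for x using G by (rule gradient_eq)
  have 2: "(LINT x|lebesgue. v (x + \<tau>) *\<^sub>R gradient \<phi> x) = (LINT x|lebesgue. v x *\<^sub>R gradient \<phi>' x)"
    using integral_lebesgue_shift[of "\<lambda>x. v x *\<^sub>R gradient \<phi>' x" \<tau>]
      integrable_test_gradient[OF \<phi>' has_weak_gradientD(1)[OF assms(1)]]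
    by (simp add: gr borel_measurable_integrable)
  show "(LINT x|lebesgue. \<phi> x *\<^sub>R V (x + \<tau>)) = - (LINT x|lebesgue. v (x + \<tau>) *\<^sub>R gradient \<phi> x)"
    unfolding 1 2 by (rule has_weak_gradient_testD[OF open_UNIV assms(1) \<phi>'])
qed

text \<open>The integral of a difference quotient vanishes by translation invariance; let the step tend to \<open>0\<close>.\<close>

lemma integral_gradient_zero:
  fixes h :: "'a::euclidean_space \<Rightarrow> real"
  assumes G: "\<And>x. GDERIV h x :> E x" and E: "continuous_on UNIV E" and S: "bounded S" "\<And>x. x \<notin> S \<Longrightarrow> h x = 0"
  shows "(LINT x|lebesgue. E x) = 0"
proof -
  obtain R where R: "S \<subseteq> cball 0 R" using S(1) by (metis ball_subset_cball bounded_subset_ballD order_trans)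
  have h0: "h x = 0" if "R < norm x" for x using S(2) R that by fastforce
  have E0: "E x = 0" if "x \<notin> cball 0 R" for x
    by (rule GDERIV_zero_off_support[OF G, of "- cball 0 R"]) (use h0 that in auto)
  have hc: "continuous_on UNIV h"
    using G has_derivative_continuous unfolding gderiv_def by (metis continuous_on_eq_continuous_at open_UNIV)
  have hi: "integrable lebesgue h"
    by (rule integrable_continuous_bounded_support[OF hc, of "cball 0 R"]) (use h0 in auto)
  have Ei: "integrable lebesgue E"
    by (rule integrable_continuous_bounded_support[OF E, of "cball 0 R"]) (use E0 in auto)
  obtain B where B: "0 \<le> B" "\<And>x. norm (E x) \<le> B"
    using continuous_bounded_support[OF E bounded_cball E0] by blast
  have "(LINT x|lebesgue. E x \<bullet> b) = 0" if b: "b \<in> Basis" for b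
  proof -
    define q where "q n x = (h (x + (1 / (real n + 1)) *\<^sub>R b) - h x) * (real n + 1)" for n x
    have q: "integrable lebesgue (q n)" "(LINT x|lebesgue. q n x) = 0" for n
    proof -
      note i = integrable_lebesgue_shift[OF hi, of "(1 / (real n + 1)) *\<^sub>R b"]
      show "integrable lebesgue (q n)" unfolding q_def using i hi by auto
      have "(LINT x|lebesgue. h (x + (1 / (real n + 1)) *\<^sub>R b) - h x) = 0"
        using i hi integral_lebesgue_shift[OF borel_measurable_integrable[OF hi]] by simp
      then show "(LINT x|lebesgue. q n x) = 0" unfolding q_def by simp
    qed
    have mv: "\<exists>t. 0 < t \<and> t < 1 \<and> q n x = b \<bullet> E (x + (t / (real n + 1)) *\<^sub>R b)" for n x
    proof -
      obtain t where "0 < t" "t < 1"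
        "h (x + (1 / (real n + 1)) *\<^sub>R b) - h x = ((1 / (real n + 1)) *\<^sub>R b) \<bullet> E (x + t *\<^sub>R (1 / (real n + 1)) *\<^sub>R b)"
        using GDERIV_mvt[OF G] by metis
      then show ?thesis by (intro exI[of _ t]) (simp add: q_def)
    qed
    have "(\<lambda>n. LINT x|lebesgue. q n x) \<longlonglongrightarrow> (LINT x|lebesgue. E x \<bullet> b)"
    proof (rule integral_dominated_convergence[where w="\<lambda>x. B * indicator (cball 0 (R + 1)) x"])
      show "integrable lebesgue (\<lambda>x::'a. B * indicator (cball 0 (R + 1)) x)"
      proof (rule integrable_bounded_support[of _ "cball 0 (R + 1)" B])
        show "(\<lambda>x::'a. B * indicator (cball 0 (R + 1)) x) \<in> borel_measurable lebesgue"
          by (intro borel_measurable_times borel_measurable_indicator) auto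
      qed (use B(1) in \<open>auto simp: indicator_def\<close>)
      show "AE x in lebesgue. norm (q n x) \<le> B * indicator (cball 0 (R + 1)) x" for n
      proof (rule AE_I2)
        fix x
        show "norm (q n x) \<le> B * indicator (cball 0 (R + 1)) x"
        proof (cases "x \<in> cball 0 (R + 1)")
          case True
          obtain t where "q n x = b \<bullet> E (x + (t / (real n + 1)) *\<^sub>R b)" using mv by blast
          then have "\<bar>q n x\<bar> \<le> norm b * norm (E (x + (t / (real n + 1)) *\<^sub>R b))"
            using Cauchy_Schwarz_ineq2 by metis
          also have "\<dots> \<le> B" using b B(2) by simp
          finally show ?thesis using True by simp
        next
          case False
          have "norm x \<le> norm (x + (1 / (real n + 1)) *\<^sub>R b) + norm ((1 / (real n + 1)) *\<^sub>R b)"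
            using norm_triangle_ineq4[of "x + (1 / (real n + 1)) *\<^sub>R b" "(1 / (real n + 1)) *\<^sub>R b"] by simp
          moreover have "norm ((1 / (real n + 1)) *\<^sub>R b) \<le> 1" using b by simp
          moreover have "R + 1 < norm x" using False by simp
          ultimately have "R < norm (x + (1 / (real n + 1)) *\<^sub>R b)" "R < norm x" by linarith+
          then show ?thesis using h0 B(1) by (simp add: q_def)
        qed
      qed
      show "AE x in lebesgue. (\<lambda>n. q n x) \<longlonglongrightarrow> E x \<bullet> b"
      proof (rule AE_I2)
        fix x
        obtain t where t: "\<And>n. 0 < t n \<and> t n < 1 \<and> q n x = b \<bullet> E (x + (t n / (real n + 1)) *\<^sub>R b)"
          using mv[of _ x] by metis
        have l0: "(\<lambda>n. 1 / (real n + 1)) \<longlonglongrightarrow> 0"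
          using LIMSEQ_inverse_real_of_nat by (simp add: inverse_eq_divide add.commute)
        have "(\<lambda>n. t n / (real n + 1)) \<longlonglongrightarrow> 0"
        proof (rule Lim_null_comparison[OF _ l0])
          show "\<forall>\<^sub>F n in sequentially. norm (t n / (real n + 1)) \<le> 1 / (real n + 1)"
          proof (rule always_eventually, rule allI)
            show "norm (t n / (real n + 1)) \<le> 1 / (real n + 1)" for n
              using t[of n] divide_right_mono[of "t n" 1 "real n + 1"] by (simp add: abs_of_pos)
          qed
        qed
        then have "(\<lambda>n. x + (t n / (real n + 1)) *\<^sub>R b) \<longlonglongrightarrow> x + 0 *\<^sub>R b" by (intro tendsto_intros)
        moreover have "isCont E (x + 0 *\<^sub>R b)" using E by (simp add: continuous_on_eq_continuous_at)
        ultimately have "(\<lambda>n. E (x + (t n / (real n + 1)) *\<^sub>R b)) \<longlonglongrightarrow> E (x + 0 *\<^sub>R b)"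
          by (rule isCont_tendsto_compose[rotated])
        then have "(\<lambda>n. b \<bullet> E (x + (t n / (real n + 1)) *\<^sub>R b)) \<longlonglongrightarrow> b \<bullet> E x"
          by (intro tendsto_inner tendsto_const) simp
        then show "(\<lambda>n. q n x) \<longlonglongrightarrow> E x \<bullet> b" using t by (simp add: inner_commute)
      qed
    qed (use q Ei in auto)
    then show ?thesis using q(2) by (simp add: LIMSEQ_const_iff)
  qed
  then have "(LINT x|lebesgue. E x) \<bullet> b = 0" if "b \<in> Basis" for b
    using integral_inner_left[of b lebesgue E] Ei that by simp
  then show ?thesis by (simp add: euclidean_eq_iff[of "LINT x|lebesgue. E x" 0])
qed

lemma has_weak_gradient_C1:
  fixes v :: "'a::euclidean_space \<Rightarrow> real"
  assumes G: "\<And>x. GDERIV v x :> D x" and D: "continuous_on UNIV D"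
  shows "has_weak_gradient UNIV v D"
  unfolding has_weak_gradient_iff[OF open_UNIV]
proof (intro conjI allI impI)
  have vc: "continuous_on UNIV v"
    using G has_derivative_continuous unfolding gderiv_def by (metis continuous_on_eq_continuous_at open_UNIV)
  show lv: "locally_integrable UNIV v" by (rule locally_integrable_continuous[OF vc])
  show lD: "locally_integrable UNIV D"
    unfolding locally_integrable_def set_integrable_def
  proof (intro allI impI)
    fix C :: "'a set" assume C: "compact C \<and> C \<subseteq> UNIV"
    have "locally_integrable UNIV (\<lambda>x. D x \<bullet> b)" for b
      by (intro locally_integrable_continuous continuous_intros D)
    then have "integrable lebesgue (\<lambda>x. \<Sum>b\<in>Basis. (indicator C x *\<^sub>R (D x \<bullet> b)) *\<^sub>R b)"
      using C by (intro Bochner_Integration.integrable_sum integrable_scaleR_left)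
        (auto simp: locally_integrable_def set_integrable_def)
    moreover have "(\<Sum>b\<in>Basis. (indicator C x *\<^sub>R (D x \<bullet> b)) *\<^sub>R b) = indicator C x *\<^sub>R D x" for x
    proof -
      have "(\<Sum>b\<in>Basis. (indicator C x *\<^sub>R (D x \<bullet> b)) *\<^sub>R b) = indicator C x *\<^sub>R (\<Sum>b\<in>Basis. (D x \<bullet> b) *\<^sub>R b)"
        by (simp add: scaleR_sum_right)
      then show ?thesis by (simp add: euclidean_representation)
    qed
    ultimately show "integrable lebesgue (\<lambda>x. indicator C x *\<^sub>R D x)" by simp
  qed
  fix \<phi> :: "'a \<Rightarrow> real" assume \<phi>: "test_function UNIV \<phi>"
  have "(LINT x|lebesgue. \<phi> x *\<^sub>R D x + v x *\<^sub>R gradient \<phi> x) = 0"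
  proof (rule integral_gradient_zero[of "\<lambda>x. \<phi> x * v x" _ "closure {x. \<phi> x \<noteq> 0}"])
    show "GDERIV (\<lambda>x. \<phi> x * v x) x :> \<phi> x *\<^sub>R D x + v x *\<^sub>R gradient \<phi> x" for x
      by (rule GDERIV_mult[OF GDERIV_gradient[OF test_functionD(1)[OF \<phi>]] G])
    show "continuous_on UNIV (\<lambda>x. \<phi> x *\<^sub>R D x + v x *\<^sub>R gradient \<phi> x)"
      by (intro continuous_intros test_functionD[OF \<phi>] vc D)
    show "bounded (closure {x. \<phi> x \<noteq> 0})" using test_functionD(4)[OF \<phi>] by (rule compact_imp_bounded)
    show "\<phi> x * v x = 0" if "x \<notin> closure {x. \<phi> x \<noteq> 0}" for x using test_functionD(6)[OF \<phi> that] by simp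
  qed
  then show "(LINT x|lebesgue. \<phi> x *\<^sub>R D x) = - (LINT x|lebesgue. v x *\<^sub>R gradient \<phi> x)"
    using integrable_test_function[OF \<phi> lD] integrable_test_gradient[OF \<phi> lv]
    by (simp add: eq_neg_iff_add_eq_0)
qed

text \<open>Both sides of the defining identity pass to the limit by dominated convergence, the gradients
  being uniformly bounded.\<close>

lemma has_weak_gradient_limit:
  fixes v :: "nat \<Rightarrow> 'a::euclidean_space \<Rightarrow> real"
  assumes hwg: "\<And>k. has_weak_gradient UNIV (v k) (V k)"
    and B: "continuous_on UNIV B" "\<And>k x. \<bar>v k x\<bar> \<le> B x"
    and v0: "continuous_on UNIV v0" "\<And>x. (\<lambda>k. v k x) \<longlonglongrightarrow> v0 x"
    and M: "\<And>k. AE x in lebesgue. norm (V k x) \<le> M"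
    and V0: "V0 \<in> borel_measurable lebesgue" "AE x in lebesgue. (\<lambda>k. V k x) \<longlonglongrightarrow> V0 x"
  shows "has_weak_gradient UNIV v0 V0" "AE x in lebesgue. norm (V0 x) \<le> M"
proof -
  have M': "AE x in lebesgue. \<forall>k. norm (V k x) \<le> M" using M by (intro AE_all_countable[THEN iffD2] allI)
  show VM: "AE x in lebesgue. norm (V0 x) \<le> M"
    using M' V0(2)
  proof eventually_elim
    case (elim x)
    then show ?case by (intro Lim_bounded[OF tendsto_norm[OF elim(2)], of 0]) auto
  qed
  show "has_weak_gradient UNIV v0 V0"
    unfolding has_weak_gradient_iff[OF open_UNIV]
  proof (intro conjI allI impI)
    show "locally_integrable UNIV v0" by (rule locally_integrable_continuous[OF v0(1)])
    show lV: "locally_integrable UNIV V0" by (rule locally_integrable_bounded[OF V0(1) VM])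
    fix \<phi> :: "'a \<Rightarrow> real" assume \<phi>: "test_function UNIV \<phi>"
    note t = test_functionD[OF \<phi>]
    have 1: "(\<lambda>k. LINT x|lebesgue. \<phi> x *\<^sub>R V k x) \<longlonglongrightarrow> (LINT x|lebesgue. \<phi> x *\<^sub>R V0 x)"
    proof (rule integral_dominated_convergence[where w="\<lambda>x. \<bar>\<phi> x\<bar> * M"])
      show "integrable lebesgue (\<lambda>x. \<bar>\<phi> x\<bar> * M)"
      proof (rule integrable_continuous_bounded_support[OF _ compact_imp_bounded[OF t(4)]])
        show "continuous_on UNIV (\<lambda>x. \<bar>\<phi> x\<bar> * M)" by (intro continuous_intros t(2))
        show "\<bar>\<phi> x\<bar> * M = 0" if "x \<notin> closure {x. \<phi> x \<noteq> 0}" for x using t(6)[OF that] by simp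
      qed
      show "AE x in lebesgue. (\<lambda>k. \<phi> x *\<^sub>R V k x) \<longlonglongrightarrow> \<phi> x *\<^sub>R V0 x"
        using V0(2) by eventually_elim (intro tendsto_intros)
      show "AE x in lebesgue. norm (\<phi> x *\<^sub>R V k x) \<le> \<bar>\<phi> x\<bar> * M" for k
        using M[of k] by eventually_elim (auto intro: mult_left_mono)
    qed (use integrable_test_function[OF \<phi> lV] integrable_test_function[OF \<phi> has_weak_gradientD(2)[OF hwg]] in auto)
    have 2: "(\<lambda>k. LINT x|lebesgue. v k x *\<^sub>R gradient \<phi> x) \<longlonglongrightarrow> (LINT x|lebesgue. v0 x *\<^sub>R gradient \<phi> x)"
    proof (rule integral_dominated_convergence[where w="\<lambda>x. B x * norm (gradient \<phi> x)"])
      show "integrable lebesgue (\<lambda>x. B x * norm (gradient \<phi> x))"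
      proof (rule integrable_continuous_bounded_support[OF _ compact_imp_bounded[OF t(4)]])
        show "continuous_on UNIV (\<lambda>x. B x * norm (gradient \<phi> x))" by (intro continuous_intros t(3) B(1))
        show "B x * norm (gradient \<phi> x) = 0" if "x \<notin> closure {x. \<phi> x \<noteq> 0}" for x using t(7)[OF that] by simp
      qed
      show "AE x in lebesgue. (\<lambda>k. v k x *\<^sub>R gradient \<phi> x) \<longlonglongrightarrow> v0 x *\<^sub>R gradient \<phi> x"
        by (intro AE_I2 tendsto_intros v0(2))
      show "AE x in lebesgue. norm (v k x *\<^sub>R gradient \<phi> x) \<le> B x * norm (gradient \<phi> x)" for k
        using B(2)[of k] by (intro AE_I2) (auto intro: mult_right_mono)
    qed (use integrable_test_gradient[OF \<phi> locally_integrable_continuous[OF v0(1)]]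
          integrable_test_gradient[OF \<phi> has_weak_gradientD(1)[OF hwg]] in auto)
    have "(\<lambda>k. LINT x|lebesgue. \<phi> x *\<^sub>R V k x) \<longlonglongrightarrow> - (LINT x|lebesgue. v0 x *\<^sub>R gradient \<phi> x)"
      using tendsto_minus[OF 2] has_weak_gradient_testD[OF open_UNIV hwg \<phi>] by simp
    then show "(LINT x|lebesgue. \<phi> x *\<^sub>R V0 x) = - (LINT x|lebesgue. v0 x *\<^sub>R gradient \<phi> x)"
      using 1 LIMSEQ_unique by blast
  qed
qed

section \<open>Lipschitz functions have bounded weak gradients\<close>

text \<open>Choose a subsequence whose successive differences have squared norm at most \<open>(1/8)^n\<close>.  Then
  \<open>4^n\<close> times the squared differences are summable almost everywhere, so the differences
  decay like \<open>(1/2)^n\<close>.\<close>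

lemma L2_Cauchy_imp_AE_convergent_subseq:
  fixes f :: "nat \<Rightarrow> 'a \<Rightarrow> 'b::{banach, second_countable_topology}"
  assumes meas: "\<And>n. f n \<in> borel_measurable M"
    and Cauchy: "\<And>e. 0 < e \<Longrightarrow> \<exists>N. \<forall>j\<ge>N. \<forall>k\<ge>N. (\<integral>\<^sup>+x. ennreal ((norm (f j x - f k x))\<^sup>2) \<partial>M) \<le> ennreal e"
  obtains r :: "nat \<Rightarrow> nat" where "strict_mono r" "AE x in M. convergent (\<lambda>n. f (r n) x)"
proof -
  have "\<exists>N. \<forall>j\<ge>N. \<forall>k\<ge>N. (\<integral>\<^sup>+x. ennreal ((norm (f j x - f k x))\<^sup>2) \<partial>M) \<le> ennreal ((1/8)^n)" for n
    by (rule Cauchy) simp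
  then have "\<exists>N. \<forall>n. \<forall>j\<ge>N n. \<forall>k\<ge>N n. (\<integral>\<^sup>+x. ennreal ((norm (f j x - f k x))\<^sup>2) \<partial>M) \<le> ennreal ((1/8)^n)"
    by (rule choice[OF allI])
  then obtain N where N: "\<And>n j k. N n \<le> j \<Longrightarrow> N n \<le> k \<Longrightarrow>
      (\<integral>\<^sup>+x. ennreal ((norm (f j x - f k x))\<^sup>2) \<partial>M) \<le> ennreal ((1/8)^n)"
    by blast
  define r where "r = rec_nat (N 0) (\<lambda>n k. max (Suc k) (N (Suc n)))"
  have r: "r 0 = N 0" "r (Suc n) = max (Suc (r n)) (N (Suc n))" for n by (auto simp: r_def)
  have mono: "strict_mono r" by (rule strict_monoI_Suc) (simp add: r)
  have rN: "N n \<le> r n" for n by (cases n) (auto simp: r)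
  define d where "d n x = norm (f (r (Suc n)) x - f (r n) x)" for n x
  have dm: "(\<lambda>x. ennreal (4^n * (d n x)\<^sup>2)) \<in> borel_measurable M" for n
    unfolding d_def using meas by measurable
  have bound: "(\<integral>\<^sup>+x. ennreal (4^n * (d n x)\<^sup>2) \<partial>M) \<le> ennreal ((1/2)^n)" for n
  proof -
    have "(\<integral>\<^sup>+x. ennreal (4^n * (d n x)\<^sup>2) \<partial>M) = (\<integral>\<^sup>+x. ennreal (4^n) * ennreal ((d n x)\<^sup>2) \<partial>M)"
      by (simp add: ennreal_mult)
    also have "\<dots> = ennreal (4^n) * (\<integral>\<^sup>+x. ennreal ((d n x)\<^sup>2) \<partial>M)"
      unfolding d_def using meas by (intro nn_integral_cmult) measurable
    also have "\<dots> \<le> ennreal (4^n) * ennreal ((1/8)^n)"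
      unfolding d_def by (intro mult_left_mono N) (use rN[of n] in \<open>auto simp: r\<close>)
    also have "\<dots> = ennreal (4^n * (1/8)^n)" by (rule ennreal_mult[symmetric]) auto
    also have "(4::real)^n * (1/8)^n = (1/2)^n" by (simp add: power_mult_distrib[symmetric])
    finally show ?thesis .
  qed
  have "(\<integral>\<^sup>+x. (\<Sum>n. ennreal (4^n * (d n x)\<^sup>2)) \<partial>M) = (\<Sum>n. \<integral>\<^sup>+x. ennreal (4^n * (d n x)\<^sup>2) \<partial>M)"
    by (rule nn_integral_suminf[OF dm])
  also have "\<dots> \<le> (\<Sum>n. ennreal ((1/2)^n))" by (intro suminf_le bound) auto
  also have "\<dots> < \<infinity>"
  proof -
    have "(\<Sum>n. ennreal ((1/2)^n)) = ennreal (\<Sum>n. (1/2)^n)"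
      by (rule suminf_ennreal2) (simp, rule summable_geometric, simp)
    then show ?thesis by simp
  qed
  finally have "(\<integral>\<^sup>+x. (\<Sum>n. ennreal (4^n * (d n x)\<^sup>2)) \<partial>M) \<noteq> \<infinity>" by simp
  then have "AE x in M. (\<Sum>n. ennreal (4^n * (d n x)\<^sup>2)) \<noteq> \<infinity>"
    using dm by (intro nn_integral_PInf_AE borel_measurable_suminf_order) auto
  then have "AE x in M. convergent (\<lambda>n. f (r n) x)"
  proof eventually_elim
    case (elim x)
    define s where "s = enn2real (\<Sum>n. ennreal (4^n * (d n x)\<^sup>2))"
    have s: "(\<Sum>n. ennreal (4^n * (d n x)\<^sup>2)) = ennreal s" "0 \<le> s"
      using elim by (simp_all only: s_def ennreal_enn2real less_top infinity_ennreal_def enn2real_nonneg)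
    have le: "d n x \<le> sqrt s * (1/2)^n" for n
    proof -
      have "ennreal (4^n * (d n x)\<^sup>2) = (\<Sum>i\<in>{n}. ennreal (4^i * (d i x)\<^sup>2))" by simp
      also have "\<dots> \<le> (\<Sum>n. ennreal (4^n * (d n x)\<^sup>2))" by (intro sum_le_suminf) auto
      finally have "4^n * (d n x)\<^sup>2 \<le> s" using s by simp
      moreover have "(2^n * d n x)\<^sup>2 = (2^n * 2^n) * (d n x)\<^sup>2" by (simp add: power2_eq_square)
      moreover have "(2^n * 2^n :: real) = 4^n" by (simp add: power_mult_distrib[symmetric])
      ultimately have "(2^n * d n x)\<^sup>2 \<le> s" by simp
      then have "2^n * d n x \<le> sqrt s" by (rule real_le_rsqrt)
      then show ?thesis by (simp add: field_simps)
    qed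
    have "summable (\<lambda>n. d n x)"
    proof (rule summable_comparison_test)
      show "summable (\<lambda>n. sqrt s * (1/2)^n)" by (intro summable_mult summable_geometric) simp
      show "\<exists>N. \<forall>n\<ge>N. norm (d n x) \<le> sqrt s * (1/2)^n" using le by (simp add: d_def)
    qed
    then have "summable (\<lambda>n. norm (f (r (Suc n)) x - f (r n) x))" by (simp only: d_def)
    then have "summable (\<lambda>n. f (r (Suc n)) x - f (r n) x)" by (rule summable_norm_cancel)
    then have "convergent (\<lambda>n. \<Sum>i<n. f (r (Suc i)) x - f (r i) x)" by (simp add: summable_iff_convergent)
    then have "convergent (\<lambda>n. f (r n) x - f (r 0) x)" 
      by (simp only: sum_lessThan_telescope[of "\<lambda>n. f (r n) x"])
    then have "convergent (\<lambda>n. (f (r n) x - f (r 0) x) + f (r 0) x)" by (intro convergent_add convergent_const)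
    then show ?case by simp
  qed
  with mono show ?thesis by (rule that)
qed

text \<open>The gradients of mollified Lipschitz functions are bounded, but as long as no weak gradient is known
  to exist, boundedness alone gives no convergence in norm.  The kernels of radius at most \<open>1/(m+1)\<close> form a convex set, so
  one may choose in each of these sets a kernel that almost minimizes the \<open>L\<^sup>2\<close> norm of the gradient,
  for a finite measure with positive density; by the parallelogram identity
  the gradients are then a Cauchy sequence, and a subsequence converges almost everywhere.\<close>

theorem lipschitz_smooth_approximation:
  fixes v :: "'a::euclidean_space \<Rightarrow> real"
  assumes v: "L-lipschitz_on UNIV v"
  obtains r V where "\<And>n. r n \<in> mollifiers (1 / (real n + 1))" "V \<in> borel_measurable lebesgue"
    "\<And>x. norm (V x) \<le> L" "AE x in lebesgue. (\<lambda>n. gradient (conv v (r n)) x) \<longlonglongrightarrow> V x"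
proof -
  have L: "0 \<le> L" using lipschitz_on_nonneg[OF v] .
  obtain h :: "'a \<Rightarrow> ennreal" where h: "h \<in> borel_measurable lborel" "(\<integral>\<^sup>+x. h x \<partial>lborel) \<noteq> \<infinity>" "\<And>x. 0 < h x"
    using sigma_finite_measure.Ex_finite_integrable_function[OF sigma_finite_lborel] by (auto simp: space_lborel)
  define \<mu> where "\<mu> = density lborel h"
  have "finite_measure \<mu>"
    by (rule finite_measureI) (use h in \<open>simp add: \<mu>_def emeasure_density\<close>)
  then interpret finite_measure \<mu> .
  have AE_\<mu>: "AE x in lebesgue. P x" if "AE x in \<mu>. P x" for P
  proof -
    have "AE x in lborel. 0 < h x \<longrightarrow> P x" using that unfolding \<mu>_def AE_density[OF h(1)] .
    then show ?thesis using h(3) by (intro AE_completion) simp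
  qed
  define D where "D r = gradient (conv v r)" for r
  define A where "A m = (mollifiers (1 / (real m + 1)) :: ('a \<Rightarrow> real) set)" for m
  have A_ne: "A m \<noteq> {}" for m unfolding A_def by (rule mollifiers_nonempty) simp
  have A_mono: "A n \<subseteq> A m" if "m \<le> n" for m n
    unfolding A_def by (intro mollifiers_mono) (use that in \<open>auto intro!: divide_left_mono\<close>)
  have sm: "smooth (conv v r)" if "r \<in> A m" for r m
    using smooth_mollify[OF v] that by (auto simp: A_def)
  have Dm: "D r \<in> borel_measurable \<mu>" if "r \<in> A m" for r m
    using borel_measurable_continuous_onI[OF smooth_continuous_gradient[OF sm[OF that]]]
    by (simp add: D_def \<mu>_def)
  have Db: "norm (D r x) \<le> L" if "r \<in> A m" for r m x
    using mollify_gradient_bound[OF v] that by (auto simp: A_def D_def)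
  have Dmid: "D (\<lambda>x. (1/2) * (r x + s x)) x = (1/2) *\<^sub>R (D r x + D s x)" if "r \<in> A m" "s \<in> A m" for r s m x
  proof -
    have vc: "continuous_on UNIV v" using v lipschitz_on_continuous_on by blast
    have i: "integrable lebesgue (\<lambda>y. v y *\<^sub>R r (x - y))" if "r \<in> A m" for r x
      using that mollifiersD[of r "1 / (real m + 1)"] unfolding A_def
      by (intro conv_integrable(1)[OF vc, of _ "1 / (real m + 1)"]) auto
    have "conv v (\<lambda>x. (1/2) * (r x + s x)) = (\<lambda>x. (1/2) * (conv v r x + conv v s x))"
    proof
      fix x
      have "(LINT y|lebesgue. v y *\<^sub>R ((1/2) * (r (x - y) + s (x - y)))) =
          (LINT y|lebesgue. (1/2) * (v y *\<^sub>R r (x - y) + v y *\<^sub>R s (x - y)))"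
        by (intro Bochner_Integration.integral_cong) (auto simp: algebra_simps)
      also have "\<dots> = (1/2) * ((LINT y|lebesgue. v y *\<^sub>R r (x - y)) + (LINT y|lebesgue. v y *\<^sub>R s (x - y)))"
        using i that by (simp only: integral_mult_right_zero Bochner_Integration.integral_add)
      finally show "conv v (\<lambda>x. (1/2) * (r x + s x)) x = (1/2) * (conv v r x + conv v s x)"
        by (simp add: conv_def)
    qed
    moreover have "GDERIV (\<lambda>x. (1/2) * (conv v r x + conv v s x)) x :>
        (1/2) *\<^sub>R (D r x + D s x) + (conv v r x + conv v s x) *\<^sub>R 0"
      unfolding D_def by (intro GDERIV_mult GDERIV_const GDERIV_add GDERIV_gradient sm[of _ m] that)
    ultimately have "D (\<lambda>x. (1/2) * (r x + s x)) x = (1/2) *\<^sub>R (D r x + D s x) + (conv v r x + conv v s x) *\<^sub>R 0"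
      unfolding D_def[of "\<lambda>x. (1/2) * (r x + s x)"] by (simp only: gradient_eq)
    then show ?thesis by simp
  qed
  define N where "N r = (LINT x|\<mu>. (norm (D r x))\<^sup>2)" for r
  have int: "integrable \<mu> g" if "g \<in> borel_measurable \<mu>" "\<And>x. \<bar>g x\<bar> \<le> B" for g :: "'a \<Rightarrow> real" and B
    by (rule integrable_const_bound[of _ B]) (use that in auto)
  have sq: "(norm (D r x))\<^sup>2 \<le> L\<^sup>2" if "r \<in> A m" for r m x
    using Db[OF that, of x] by (intro power_mono) auto
  have N_int: "integrable \<mu> (\<lambda>x. (norm (D r x))\<^sup>2)" if "r \<in> A m" for r m
    using Dm[OF that] sq[OF that] by (intro int[of _ "L\<^sup>2"]) auto
  have N_nonneg: "0 \<le> N r" for r unfolding N_def by (intro integral_nonneg_AE) auto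
  define C where "C = L\<^sup>2 * measure \<mu> (space \<mu>)"
  have N_le: "N r \<le> C" if "r \<in> A m" for r m
  proof -
    have "N r \<le> (LINT x|\<mu>. L\<^sup>2)" unfolding N_def using N_int[OF that] sq[OF that] by (intro integral_mono) auto
    then show ?thesis by (simp add: C_def mult.commute)
  qed
  define d where "d m = Inf (N ` A m)" for m
  have bdd: "bdd_below (N ` A m)" for m using N_nonneg by (auto intro!: bdd_belowI[of _ 0])
  have d_le: "d m \<le> N r" if "r \<in> A m" for r m unfolding d_def using that bdd by (intro cInf_lower) auto
  have d_mono: "d m \<le> d n" if "m \<le> n" for m n
    unfolding d_def using A_ne bdd A_mono[OF that] by (intro cInf_superset_mono) auto
  have "d m \<le> C" for m using A_ne[of m] d_le N_le by (metis all_not_in_conv order_trans)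
  then obtain l where l: "d \<longlonglongrightarrow> l" "\<And>m. d m \<le> l"
    using incseq_convergent[of d C] d_mono by (auto simp: incseq_def)
  have "\<exists>r\<in>A m. N r \<le> d m + 1 / (real m + 1)" for m
  proof -
    have "Inf (N ` A m) < d m + 1 / (real m + 1)" by (simp add: d_def)
    then show ?thesis using cInf_lessD[of "N ` A m"] A_ne[of m] by fastforce
  qed
  then obtain \<rho> where \<rho>: "\<And>m. \<rho> m \<in> A m" "\<And>m. N (\<rho> m) \<le> d m + 1 / (real m + 1)" by metis
  have close: "(LINT x|\<mu>. (norm (D (\<rho> j) x - D (\<rho> k) x))\<^sup>2) \<le> 4 * (l - d n) + 4 / (real n + 1)"
    if "n \<le> j" "n \<le> k" for n j k
  proof -
    let ?m = "\<lambda>x. (1/2) * (\<rho> j x + \<rho> k x)"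
    have in_n: "\<rho> j \<in> A n" "\<rho> k \<in> A n" using A_mono \<rho>(1) that by blast+
    then have mid: "?m \<in> A n" unfolding A_def by (rule mollifiers_midpoint)
    have "(norm (D (\<rho> j) x - D (\<rho> k) x))\<^sup>2 = 2 * (norm (D (\<rho> j) x))\<^sup>2 + 2 * (norm (D (\<rho> k) x))\<^sup>2 - 4 * (norm (D ?m x))\<^sup>2" for x
      unfolding Dmid[OF in_n] by (simp add: power2_norm_eq_inner inner_commute algebra_simps)
    then have "(LINT x|\<mu>. (norm (D (\<rho> j) x - D (\<rho> k) x))\<^sup>2) = 2 * N (\<rho> j) + 2 * N (\<rho> k) - 4 * N ?m"
      using N_int[OF in_n(1)] N_int[OF in_n(2)] N_int[OF mid] by (simp add: N_def)
    moreover have "N (\<rho> j) \<le> l + 1 / (real n + 1)"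
    proof -
      have "1 / (real j + 1) \<le> 1 / (real n + 1)" using that by (intro divide_left_mono) auto
      then show ?thesis using \<rho>(2)[of j] l(2)[of j] by linarith
    qed
    moreover have "N (\<rho> k) \<le> l + 1 / (real n + 1)"
    proof -
      have "1 / (real k + 1) \<le> 1 / (real n + 1)" using that by (intro divide_left_mono) auto
      then show ?thesis using \<rho>(2)[of k] l(2)[of k] by linarith
    qed
    moreover have "d n \<le> N ?m" by (rule d_le[OF mid])
    ultimately show ?thesis by (simp add: algebra_simps)
  qed
  have "(\<lambda>n. 4 * (l - d n) + 4 * (1 / (real n + 1))) \<longlonglongrightarrow> 4 * (l - l) + 4 * 0"
  proof -
    have "(\<lambda>n. 1 / (real n + 1)) \<longlonglongrightarrow> 0"
      using LIMSEQ_inverse_real_of_nat by (simp add: inverse_eq_divide add.commute)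
    then show ?thesis by (intro tendsto_intros l(1))
  qed
  then have lim0: "(\<lambda>n. 4 * (l - d n) + 4 / (real n + 1)) \<longlonglongrightarrow> 0" by simp
  have cau: "\<exists>N. \<forall>j\<ge>N. \<forall>k\<ge>N. (\<integral>\<^sup>+x. ennreal ((norm (D (\<rho> j) x - D (\<rho> k) x))\<^sup>2) \<partial>\<mu>) \<le> ennreal e" if e: "0 < e" for e
  proof -
    obtain n where n: "4 * (l - d n) + 4 / (real n + 1) < e"
      using order_tendstoD(2)[OF lim0 e] by (auto simp: eventually_sequentially)
    have "(\<integral>\<^sup>+x. ennreal ((norm (D (\<rho> j) x - D (\<rho> k) x))\<^sup>2) \<partial>\<mu>) \<le> ennreal e" if jk: "n \<le> j" "n \<le> k" for j k
    proof -
      have b: "(norm (D (\<rho> j) x - D (\<rho> k) x))\<^sup>2 \<le> (2 * L)\<^sup>2" for x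
      proof (rule power_mono)
        show "norm (D (\<rho> j) x - D (\<rho> k) x) \<le> 2 * L"
          using norm_triangle_ineq4[of "D (\<rho> j) x" "D (\<rho> k) x"] Db[OF \<rho>(1), of j x] Db[OF \<rho>(1), of k x] by linarith
      qed simp
      have "integrable \<mu> (\<lambda>x. (norm (D (\<rho> j) x - D (\<rho> k) x))\<^sup>2)"
        using Dm[OF \<rho>(1), of j] Dm[OF \<rho>(1), of k] b by (intro int[of _ "(2 * L)\<^sup>2"]) auto
      then have "(\<integral>\<^sup>+x. ennreal ((norm (D (\<rho> j) x - D (\<rho> k) x))\<^sup>2) \<partial>\<mu>) =
          ennreal (LINT x|\<mu>. (norm (D (\<rho> j) x - D (\<rho> k) x))\<^sup>2)"
        by (intro nn_integral_eq_integral) auto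
      then show ?thesis using close[OF jk] n by (simp add: ennreal_leI)
    qed
    then show ?thesis by blast
  qed
  obtain s where s: "strict_mono s" "AE x in \<mu>. convergent (\<lambda>n. D (\<rho> (s n)) x)"
    by (rule L2_Cauchy_imp_AE_convergent_subseq[of "\<lambda>n. D (\<rho> n)" \<mu>, OF Dm[OF \<rho>(1)] cau])
  define W where "W x = lim (\<lambda>n. D (\<rho> (s n)) x)" for x
  define V where "V x = (if norm (W x) \<le> L then W x else 0)" for x
  have Dm': "D (\<rho> n) \<in> borel_measurable lebesgue" for n
    unfolding D_def by (intro continuous_borel_measurable_lebesgue smooth_continuous_gradient sm[OF \<rho>(1)])
  show ?thesis
  proof (rule that[of "\<lambda>n. \<rho> (s n)" V])
    show "\<rho> (s n) \<in> mollifiers (1 / (real n + 1))" for n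
      using A_mono[OF seq_suble[OF s(1), of n]] \<rho>(1) by (auto simp: A_def)
    have W[measurable]: "W \<in> borel_measurable lebesgue"
      unfolding W_def[abs_def] by (rule borel_measurable_lim_metric[OF Dm'])
    show "V \<in> borel_measurable lebesgue" unfolding V_def[abs_def] by measurable
    show "norm (V x) \<le> L" for x using L by (simp add: V_def)
    show "AE x in lebesgue. (\<lambda>n. gradient (conv v (\<rho> (s n))) x) \<longlonglongrightarrow> V x"
      using AE_\<mu>[OF s(2)]
    proof eventually_elim
      case (elim x)
      then have lim: "(\<lambda>n. D (\<rho> (s n)) x) \<longlonglongrightarrow> W x" by (simp add: W_def convergent_LIMSEQ_iff)
      then have "norm (W x) \<le> L" using Db[OF \<rho>(1)]
        by (intro Lim_bounded[OF tendsto_norm[OF lim], of 0]) auto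
      then show ?case using lim by (simp add: V_def D_def)
    qed
  qed
qed

abbreviation grad :: "('a::euclidean_space \<Rightarrow> real) \<Rightarrow> 'a \<Rightarrow> 'a" where
  "grad \<equiv> weak_gradient UNIV"

lemma grad_AE_eq:
  assumes "has_weak_gradient UNIV v V"
  shows "AE x in lebesgue. grad v x = V x"
  using has_weak_gradient_unique[OF open_UNIV has_weak_gradient_weak_gradient[OF assms] assms] by simp

lemma lipschitz_smooth_approximation_grad:
  fixes v :: "'a::euclidean_space \<Rightarrow> real"
  assumes v: "L-lipschitz_on UNIV v"
  obtains r where "\<And>n. r n \<in> mollifiers (1 / (real n + 1))"
    "AE x in lebesgue. (\<lambda>n. gradient (conv v (r n)) x) \<longlonglongrightarrow> grad v x"
    and "has_weak_gradient UNIV v (grad v)" "grad v \<in> borel_measurable lebesgue"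
    "AE x in lebesgue. norm (grad v x) \<le> L"
proof -
  obtain r V where r: "\<And>n. r n \<in> mollifiers (1 / (real n + 1))" and V: "V \<in> borel_measurable lebesgue"
    "\<And>x. norm (V x) \<le> L" "AE x in lebesgue. (\<lambda>n. gradient (conv v (r n)) x) \<longlonglongrightarrow> V x"
    by (rule lipschitz_smooth_approximation[OF v]) (rule that)
  have vc: "continuous_on UNIV v" using v lipschitz_on_continuous_on by blast
  have L: "0 \<le> L" using lipschitz_on_nonneg[OF v] .
  have l0: "(\<lambda>n. L * (1 / (real n + 1))) \<longlonglongrightarrow> 0"
    using tendsto_mult_right_zero[OF LIMSEQ_inverse_real_of_nat, of L] by (simp add: inverse_eq_divide add.commute)
  have close: "\<bar>conv v (r n) x - v x\<bar> \<le> L * (1 / (real n + 1))" for n x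
    by (rule mollify_close[OF v r])
  have hv: "has_weak_gradient UNIV v V"
  proof (rule has_weak_gradient_limit(1))
    show "has_weak_gradient UNIV (conv v (r n)) (gradient (conv v (r n)))" for n
      by (intro has_weak_gradient_C1 GDERIV_gradient smooth_continuous_gradient smooth_mollify[OF v r])
    show "continuous_on UNIV (\<lambda>x. \<bar>v x\<bar> + L)" by (intro continuous_intros vc)
    show "\<bar>conv v (r n) x\<bar> \<le> \<bar>v x\<bar> + L" for n x
    proof -
      have "L * (1 / (real n + 1)) \<le> L * 1" by (rule mult_left_mono[OF _ L]) simp
      then show ?thesis using close[of n x] by linarith
    qed
    show "(\<lambda>n. conv v (r n) x) \<longlonglongrightarrow> v x" for x
    proof -
      have "(\<lambda>n. conv v (r n) x - v x) \<longlonglongrightarrow> 0"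
        by (rule Lim_null_comparison[OF _ l0]) (use close in simp)
      then show ?thesis by (simp add: LIM_zero_iff)
    qed
    show "AE x in lebesgue. norm (gradient (conv v (r n)) x) \<le> L" for n
      by (intro AE_I2 mollify_gradient_bound[OF v r])
  qed (use vc V in auto)
  have eq: "AE x in lebesgue. grad v x = V x" by (rule grad_AE_eq[OF hv])
  show ?thesis
  proof (rule that[OF r])
    show "AE x in lebesgue. (\<lambda>n. gradient (conv v (r n)) x) \<longlonglongrightarrow> grad v x"
      using V(3) eq by eventually_elim simp
    show h: "has_weak_gradient UNIV v (grad v)" by (rule has_weak_gradient_weak_gradient[OF hv])
    show "grad v \<in> borel_measurable lebesgue"
      using locally_integrable_measurable(1)[OF open_UNIV has_weak_gradientD(2)[OF h]] by simp
    show "AE x in lebesgue. norm (grad v x) \<le> L" using eq by eventually_elim (simp add: V(2))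
  qed
qed

lemma lipschitz_grad:
  fixes v :: "'a::euclidean_space \<Rightarrow> real"
  assumes v: "L-lipschitz_on UNIV v"
  shows has_weak_gradient_grad: "has_weak_gradient UNIV v (grad v)"
    and grad_measurable: "grad v \<in> borel_measurable lebesgue"
    and grad_bound: "AE x in lebesgue. norm (grad v x) \<le> L"
  by (rule lipschitz_smooth_approximation_grad[OF v], assumption)+

lemma grad_add:
  assumes "L-lipschitz_on UNIV v" "M-lipschitz_on UNIV w"
  shows "AE x in lebesgue. grad (\<lambda>x. v x + w x) x = grad v x + grad w x"
  using assms by (intro grad_AE_eq has_weak_gradient_add has_weak_gradient_grad) auto

lemma grad_diff:
  assumes "L-lipschitz_on UNIV v" "M-lipschitz_on UNIV w"
  shows "AE x in lebesgue. grad (\<lambda>x. v x - w x) x = grad v x - grad w x"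
  using assms by (intro grad_AE_eq has_weak_gradient_diff has_weak_gradient_grad) auto

lemma grad_cmult:
  assumes "L-lipschitz_on UNIV v"
  shows "AE x in lebesgue. grad (\<lambda>x. c * v x) x = c *\<^sub>R grad v x"
  using assms by (intro grad_AE_eq has_weak_gradient_cmult has_weak_gradient_grad) auto

lemma grad_shift:
  assumes "L-lipschitz_on UNIV v"
  shows "AE x in lebesgue. grad (\<lambda>x. v (x + \<tau>)) x = grad v (x + \<tau>)"
  by (intro grad_AE_eq has_weak_gradient_shift[where M=L] lipschitz_grad[OF assms]
      lipschitz_on_continuous_on[OF assms])

lemma grad_affine:
  fixes b :: "'a::euclidean_space"
  shows "AE x in lebesgue. grad (\<lambda>x. b \<bullet> x + c) x = b"
proof (intro grad_AE_eq has_weak_gradient_C1)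
  show "GDERIV (\<lambda>x. b \<bullet> x + c) x :> b" for x
    unfolding gderiv_def by (auto intro!: derivative_eq_intros simp: inner_commute)
qed auto

text \<open>The classical chain rule for the smooth approximations of \<open>v\<close> passes to the limit because their
  gradients converge almost everywhere, not merely weakly.\<close>

lemma has_weak_gradient_chain:
  fixes v :: "'a::euclidean_space \<Rightarrow> real" and \<theta> :: "real \<Rightarrow> real"
  assumes v: "L-lipschitz_on UNIV v"
    and \<theta>: "\<And>t. (\<theta> has_real_derivative \<theta>' t) (at t)" "continuous_on UNIV \<theta>'" "\<And>t. \<bar>\<theta>' t\<bar> \<le> 1"
  shows "has_weak_gradient UNIV (\<lambda>x. \<theta> (v x)) (\<lambda>x. \<theta>' (v x) *\<^sub>R grad v x)"
proof -
  obtain r where r: "\<And>n. r n \<in> mollifiers (1 / (real n + 1))"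
    and lim: "AE x in lebesgue. (\<lambda>n. gradient (conv v (r n)) x) \<longlonglongrightarrow> grad v x"
    by (rule lipschitz_smooth_approximation_grad[OF v]) (rule that)
  define s where "s n = conv v (r n)" for n
  have vc: "continuous_on UNIV v" using v lipschitz_on_continuous_on by blast
  have L: "0 \<le> L" using lipschitz_on_nonneg[OF v] .
  have \<theta>c: "continuous_on UNIV \<theta>" using DERIV_isCont[OF \<theta>(1)] by (simp add: continuous_on_eq_continuous_at)
  have \<theta>lip: "\<bar>\<theta> a - \<theta> b\<bar> \<le> \<bar>a - b\<bar>" for a b
    using field_differentiable_bound[of UNIV \<theta> \<theta>' 1 a b] \<theta>(1,3) by auto
  have sm: "smooth (s n)" for n unfolding s_def by (rule smooth_mollify[OF v r])
  have l0: "(\<lambda>n. L * (1 / (real n + 1))) \<longlonglongrightarrow> 0"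
    using tendsto_mult_right_zero[OF LIMSEQ_inverse_real_of_nat, of L] by (simp add: inverse_eq_divide add.commute)
  have close: "\<bar>s n x - v x\<bar> \<le> L * (1 / (real n + 1))" for n x
    unfolding s_def by (rule mollify_close[OF v r])
  have slim: "(\<lambda>n. s n x) \<longlonglongrightarrow> v x" for x
  proof -
    have "(\<lambda>n. s n x - v x) \<longlonglongrightarrow> 0"
      by (rule Lim_null_comparison[OF _ l0]) (use close in simp)
    then show ?thesis by (simp add: LIM_zero_iff)
  qed
  show ?thesis
  proof (rule has_weak_gradient_limit(1)[where v = "\<lambda>n x. \<theta> (s n x)" and V = "\<lambda>n x. \<theta>' (s n x) *\<^sub>R gradient (s n) x"
        and B = "\<lambda>x. \<bar>\<theta> (v x)\<bar> + L" and M = L])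
    show "has_weak_gradient UNIV (\<lambda>x. \<theta> (s n x)) (\<lambda>x. \<theta>' (s n x) *\<^sub>R gradient (s n) x)" for n
    proof (rule has_weak_gradient_C1)
      show "GDERIV (\<lambda>x. \<theta> (s n x)) x :> \<theta>' (s n x) *\<^sub>R gradient (s n) x" for x
        by (rule GDERIV_DERIV_compose[OF GDERIV_gradient[OF sm] \<theta>(1)])
      show "continuous_on UNIV (\<lambda>x. \<theta>' (s n x) *\<^sub>R gradient (s n) x)"
        by (intro continuous_intros smooth_continuous_gradient sm
            continuous_on_compose2[OF \<theta>(2) smooth_continuous[OF sm]]) auto
    qed
    show "continuous_on UNIV (\<lambda>x. \<bar>\<theta> (v x)\<bar> + L)" "continuous_on UNIV (\<lambda>x. \<theta> (v x))"
      by (intro continuous_intros continuous_on_compose2[OF \<theta>c vc]; simp)+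
    show "\<bar>\<theta> (s n x)\<bar> \<le> \<bar>\<theta> (v x)\<bar> + L" for n x
    proof -
      have "L * (1 / (real n + 1)) \<le> L * 1" by (rule mult_left_mono[OF _ L]) simp
      then show ?thesis using close[of n x] \<theta>lip[of "s n x" "v x"] by linarith
    qed
    have \<theta>'lim: "(\<lambda>n. \<theta>' (s n x)) \<longlonglongrightarrow> \<theta>' (v x)" for x
      using \<theta>(2) slim[of x] by (intro continuous_on_tendsto_compose[OF \<theta>(2)]) auto
    show "(\<lambda>n. \<theta> (s n x)) \<longlonglongrightarrow> \<theta> (v x)" for x
      using slim[of x] by (intro continuous_on_tendsto_compose[OF \<theta>c]) auto
    show "AE x in lebesgue. norm (\<theta>' (s n x) *\<^sub>R gradient (s n) x) \<le> L" for n
    proof (rule AE_I2)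
      fix x
      have "norm (gradient (s n) x) \<le> L" unfolding s_def by (rule mollify_gradient_bound[OF v r])
      then show "norm (\<theta>' (s n x) *\<^sub>R gradient (s n) x) \<le> L"
        using mult_mono[OF \<theta>(3)[of "s n x"], of "norm (gradient (s n) x)" L] by simp
    qed
    show "(\<lambda>x. \<theta>' (v x) *\<^sub>R grad v x) \<in> borel_measurable lebesgue"
      using continuous_borel_measurable_lebesgue[OF continuous_on_compose2[OF \<theta>(2) vc]] grad_measurable[OF v]
      by (intro borel_measurable_scaleR) auto
    show "AE x in lebesgue. (\<lambda>n. \<theta>' (s n x) *\<^sub>R gradient (s n) x) \<longlonglongrightarrow> \<theta>' (v x) *\<^sub>R grad v x"
      using lim by eventually_elim (auto simp: s_def[symmetric] intro!: tendsto_scaleR \<theta>'lim)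
  qed
qed

text \<open>The functions \<open>\<theta> k t = t - arctan (k * t) / k\<close> converge uniformly to the identity while their
  derivatives vanish at \<open>0\<close> and tend to \<open>1\<close> elsewhere.  By the chain rule the gradient of \<open>v\<close>,
  cut off to \<open>0\<close> on the zero set, is thus also a weak gradient of \<open>v\<close>.\<close>

theorem grad_zero_on_zero_set:
  fixes v :: "'a::euclidean_space \<Rightarrow> real"
  assumes v: "L-lipschitz_on UNIV v"
  shows "AE x in lebesgue. v x = 0 \<longrightarrow> grad v x = 0"
proof -
  have vc: "continuous_on UNIV v" using v lipschitz_on_continuous_on by blast
  define \<kappa> where "\<kappa> n = real n + 1" for n
  define \<theta> where "\<theta> n t = t - arctan (\<kappa> n * t) / \<kappa> n" for n t
  define \<theta>' where "\<theta>' n t = 1 - 1 / (1 + (\<kappa> n * t)\<^sup>2)" for n t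
  have \<kappa>: "0 < \<kappa> n" "1 \<le> \<kappa> n" for n by (auto simp: \<kappa>_def)
  have pos: "0 < 1 + (\<kappa> n * t)\<^sup>2" for n t by (simp add: add_pos_nonneg)
  have \<theta>'b: "0 \<le> \<theta>' n t" "\<theta>' n t \<le> 1" for n t using pos[of n t] by (auto simp: \<theta>'_def)
  have d: "(\<theta> n has_real_derivative \<theta>' n t) (at t)" for n t
  proof -
    have "(\<theta> n has_real_derivative 1 - (inverse (1 + (\<kappa> n * t)\<^sup>2) * \<kappa> n) / \<kappa> n) (at t)"
      unfolding \<theta>_def by (auto intro!: derivative_eq_intros)
    then show ?thesis using \<kappa>(1)[of n] by (simp add: \<theta>'_def inverse_eq_divide)
  qed
  have c: "continuous_on UNIV (\<theta>' n)" for n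
    unfolding \<theta>'_def using pos[of n] by (intro continuous_intros) (auto simp: less_imp_neq[symmetric])
  have l0: "(\<lambda>n. (pi/2) * (1 / \<kappa> n)) \<longlonglongrightarrow> 0"
    using tendsto_mult_right_zero[OF LIMSEQ_inverse_real_of_nat, of "pi/2"] by (simp add: \<kappa>_def inverse_eq_divide add.commute)
  have close: "\<bar>\<theta> n t - t\<bar> \<le> (pi/2) * (1 / \<kappa> n)" for n t
  proof -
    have "\<bar>arctan (\<kappa> n * t)\<bar> \<le> pi / 2" using arctan_bounded[of "\<kappa> n * t"] by linarith
    then have "\<bar>arctan (\<kappa> n * t)\<bar> / \<kappa> n \<le> (pi / 2) / \<kappa> n" by (rule divide_right_mono) (simp add: less_imp_le \<kappa>)
    then show ?thesis using \<kappa>(1)[of n] by (simp add: \<theta>_def)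
  qed
  define V where "V x = (if v x = 0 then 0 else grad v x)" for x
  have "has_weak_gradient UNIV v V"
  proof (rule has_weak_gradient_limit(1)[where v = "\<lambda>n x. \<theta> n (v x)" and V = "\<lambda>n x. \<theta>' n (v x) *\<^sub>R grad v x"
        and B = "\<lambda>x. \<bar>v x\<bar> + pi/2" and M = L])
    show "has_weak_gradient UNIV (\<lambda>x. \<theta> n (v x)) (\<lambda>x. \<theta>' n (v x) *\<^sub>R grad v x)" for n
      by (rule has_weak_gradient_chain[OF v d c]) (use \<theta>'b in \<open>simp add: abs_le_iff\<close>)
    show "continuous_on UNIV (\<lambda>x. \<bar>v x\<bar> + pi/2)" by (intro continuous_intros vc)
    show "\<bar>\<theta> n (v x)\<bar> \<le> \<bar>v x\<bar> + pi/2" for n x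
    proof -
      have "(pi/2) * (1 / \<kappa> n) \<le> (pi/2) * 1" using \<kappa>(2)[of n] by (intro mult_left_mono) auto
      then show ?thesis using close[of n "v x"] by linarith
    qed
    show "(\<lambda>n. \<theta> n (v x)) \<longlonglongrightarrow> v x" for x
    proof -
      have "(\<lambda>n. \<theta> n (v x) - v x) \<longlonglongrightarrow> 0"
        by (rule Lim_null_comparison[OF _ l0]) (use close in simp)
      then show ?thesis by (simp add: LIM_zero_iff)
    qed
    show "AE x in lebesgue. norm (\<theta>' n (v x) *\<^sub>R grad v x) \<le> L" for n
      using grad_bound[OF v]
    proof eventually_elim
      case (elim x)
      then show ?case using mult_mono[OF \<theta>'b(2)[of n "v x"] elim] \<theta>'b(1)[of n "v x"] by simp
    qed
    have [measurable]: "v \<in> borel_measurable lebesgue" "grad v \<in> borel_measurable lebesgue"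
      using lipschitz_borel_measurable_lebesgue[OF v] grad_measurable[OF v] by auto
    show "V \<in> borel_measurable lebesgue" unfolding V_def by measurable
    show "AE x in lebesgue. (\<lambda>n. \<theta>' n (v x) *\<^sub>R grad v x) \<longlonglongrightarrow> V x"
    proof (rule AE_I2)
      fix x
      show "(\<lambda>n. \<theta>' n (v x) *\<^sub>R grad v x) \<longlonglongrightarrow> V x"
      proof (cases "v x = 0")
        case True
        then show ?thesis by (simp add: \<theta>'_def V_def)
      next
        case False
        have k: "filterlim \<kappa> at_top sequentially"
          unfolding \<kappa>_def by (rule filterlim_at_top_mono[OF filterlim_real_sequentially]) simp
        have "filterlim (\<lambda>n. 1 + (\<kappa> n * v x)\<^sup>2) at_top sequentially"
        proof -
          have "filterlim (\<lambda>n. \<kappa> n * (v x)\<^sup>2) at_top sequentially"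
            using False by (intro filterlim_at_top_mult_tendsto_pos[OF tendsto_const _ k]) auto
          moreover have "\<kappa> n * (v x)\<^sup>2 \<le> 1 + (\<kappa> n * v x)\<^sup>2" for n
          proof -
            have "\<kappa> n * 1 \<le> \<kappa> n * \<kappa> n" using \<kappa>[of n] by (intro mult_left_mono) auto
            then have "\<kappa> n * (v x)\<^sup>2 \<le> (\<kappa> n * \<kappa> n) * (v x)\<^sup>2" by (intro mult_right_mono) auto
            then show ?thesis by (simp add: power2_eq_square algebra_simps)
          qed
          ultimately show ?thesis by (rule filterlim_at_top_mono[OF _ always_eventually[OF allI]])
        qed
        then have "(\<lambda>n. 1 / (1 + (\<kappa> n * v x)\<^sup>2)) \<longlonglongrightarrow> 0"
          by (intro tendsto_divide_0[OF tendsto_const] filterlim_at_top_imp_at_infinity)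
        then have "(\<lambda>n. (1 - 1 / (1 + (\<kappa> n * v x)\<^sup>2)) *\<^sub>R grad v x) \<longlonglongrightarrow> (1 - 0) *\<^sub>R grad v x"
          by (intro tendsto_intros)
        then show ?thesis using False by (simp add: V_def \<theta>'_def)
      qed
    qed
  qed (rule vc)
  from grad_AE_eq[OF this] show ?thesis
  proof eventually_elim
    case (elim x)
    then show ?case unfolding V_def by presburger
  qed
qed

text \<open>On the open set \<open>A\<close> both gradients are weak gradients of the same function.\<close>

lemma grad_local:
  assumes v: "L-lipschitz_on UNIV v" and w: "M-lipschitz_on UNIV w" and A: "open A"
    and on: "\<And>x. x \<in> A \<Longrightarrow> v x = w x"
  shows "AE x in lebesgue. x \<in> A \<longrightarrow> grad v x = grad w x"
proof (rule has_weak_gradient_unique[OF A])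
  show "has_weak_gradient A v (grad v)"
    by (rule has_weak_gradient_restrict[OF A open_UNIV _ has_weak_gradient_grad[OF v]]) simp
  have "has_weak_gradient A w (grad w)"
    by (rule has_weak_gradient_restrict[OF A open_UNIV _ has_weak_gradient_grad[OF w]]) simp
  then show "has_weak_gradient A v (grad w)" using has_weak_gradient_cong[of A v w] on by blast
qed

section \<open>Sobolev functions with zero boundary values\<close>

lemma AE_lebesgue_on:
  assumes "open U" "AE x in lebesgue. x \<in> U \<longrightarrow> P x"
  shows "AE x in lebesgue_on U. P x"
  using assms by (subst AE_restrict_space_iff) auto

lemma AE_lebesgue_onD:
  assumes "open U" "AE x in lebesgue_on U. P x"
  shows "AE x in lebesgue. x \<in> U \<longrightarrow> P x"
  using assms by (subst (asm) AE_restrict_space_iff) auto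

lemma finite_measure_lebesgue_on_bounded_open:
  "open U \<Longrightarrow> bounded U \<Longrightarrow> finite_measure (lebesgue_on U)"
  by (intro finite_measure_lebesgue_on lmeasurable_open)

lemma weak_gradient_AE_grad:
  fixes v :: "'a::euclidean_space \<Rightarrow> real"
  assumes "open U" "L-lipschitz_on UNIV v"
  shows "AE x in lebesgue_on U. weak_gradient U v x = grad v x"
    and "has_weak_gradient U v (weak_gradient U v)"
    and "weak_gradient U v \<in> borel_measurable (lebesgue_on U)"
    and "AE x in lebesgue_on U. norm (weak_gradient U v x) \<le> L"
proof -
  have h: "has_weak_gradient U v (grad v)"
    by (rule has_weak_gradient_restrict[OF assms(1) open_UNIV _ has_weak_gradient_grad[OF assms(2)]]) simp
  then show w: "has_weak_gradient U v (weak_gradient U v)" by (rule has_weak_gradient_weak_gradient)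
  then show "weak_gradient U v \<in> borel_measurable (lebesgue_on U)"
    using locally_integrable_measurable(2)[OF assms(1)] has_weak_gradientD(2) by blast
  show eq: "AE x in lebesgue_on U. weak_gradient U v x = grad v x"
    by (rule AE_lebesgue_on[OF assms(1) has_weak_gradient_unique[OF assms(1) w h]])
  have "AE x in lebesgue_on U. norm (grad v x) \<le> L"
    by (rule AE_lebesgue_on[OF assms(1)]) (use grad_bound[OF assms(2)] in eventually_elim, simp)
  with eq show "AE x in lebesgue_on U. norm (weak_gradient U v x) \<le> L" by eventually_elim simp
qed

lemma power_add_le:
  fixes s t :: real
  assumes "0 \<le> s" "0 \<le> t"
  shows "(s + t) ^ n \<le> 2 ^ n * (s ^ n + t ^ n)"
proof -
  have "(s + t) ^ n \<le> (2 * max s t) ^ n" using assms by (intro power_mono) auto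
  also have "\<dots> = 2 ^ n * max s t ^ n" by (rule power_mult_distrib)
  also have "max s t ^ n \<le> s ^ n + t ^ n" using assms by (auto simp: max_def)
  finally show ?thesis by simp
qed

lemma norm_diff_power_le:
  fixes u v w :: "'a::real_normed_vector"
  shows "norm (u - w) ^ n \<le> 2 ^ n * (norm (u - v) ^ n + norm (v - w) ^ n)"
proof -
  have "norm (u - w) ^ n \<le> (norm (u - v) + norm (v - w)) ^ n"
    using norm_triangle_ineq[of "u - v" "v - w"] by (intro power_mono) auto
  also have "\<dots> \<le> 2 ^ n * (norm (u - v) ^ n + norm (v - w) ^ n)" by (intro power_add_le) auto
  finally show ?thesis .
qed

lemma Lp_space_diff_integrable:
  fixes v w :: "'a::euclidean_space \<Rightarrow> 'b::{banach, second_countable_topology}"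
  assumes "v \<in> Lp_space n \<Omega>" "w \<in> Lp_space n \<Omega>"
  shows "integrable (lebesgue_on \<Omega>) (\<lambda>x. norm (v x - w x) ^ n)"
proof (rule Bochner_Integration.integrable_bound)
  show "integrable (lebesgue_on \<Omega>) (\<lambda>x. 2 ^ n * (norm (v x) ^ n + norm (w x) ^ n))"
    using assms by (auto simp: Lp_space_def)
  have [measurable]: "v \<in> borel_measurable (lebesgue_on \<Omega>)" "w \<in> borel_measurable (lebesgue_on \<Omega>)"
    using assms by (auto simp: Lp_space_def)
  show "(\<lambda>x. norm (v x - w x) ^ n) \<in> borel_measurable (lebesgue_on \<Omega>)" by measurable
  show "AE x in lebesgue_on \<Omega>. norm (norm (v x - w x) ^ n) \<le> norm (2 ^ n * (norm (v x) ^ n + norm (w x) ^ n))"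
  proof (rule AE_I2)
    fix x
    show "norm (norm (v x - w x) ^ n) \<le> norm (2 ^ n * (norm (v x) ^ n + norm (w x) ^ n))"
      using norm_diff_power_le[of "v x" "w x" n 0] by (simp add: abs_of_nonneg)
  qed
qed

lemma Lp_space_bounded:
  fixes v :: "'a::euclidean_space \<Rightarrow> 'b::{banach, second_countable_topology}"
  assumes "open \<Omega>" "bounded \<Omega>" "v \<in> borel_measurable (lebesgue_on \<Omega>)" "AE x in lebesgue_on \<Omega>. norm (v x) \<le> B"
  shows "v \<in> Lp_space n \<Omega>"
proof -
  interpret finite_measure "lebesgue_on \<Omega>" by (rule finite_measure_lebesgue_on_bounded_open[OF assms(1,2)])
  have "integrable (lebesgue_on \<Omega>) (\<lambda>x. norm (v x) ^ n)"
  proof (rule integrable_const_bound[of _ "B ^ n"])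
    show "AE x in lebesgue_on \<Omega>. norm (norm (v x) ^ n) \<le> B ^ n"
      using assms(4) by eventually_elim (simp add: power_mono)
  qed (use assms(3) in measurable)
  then show ?thesis using assms(3) by (simp add: Lp_space_def)
qed

lemma borel_measurable_lebesgue_on_continuous:
  fixes f :: "'a::euclidean_space \<Rightarrow> 'b::topological_space"
  assumes "continuous_on UNIV f"
  shows "f \<in> borel_measurable (lebesgue_on \<Omega>)"
  by (intro measurable_restrict_space1 continuous_borel_measurable_lebesgue assms)

lemma lipschitz_bounded_on_bounded:
  fixes v :: "'a::euclidean_space \<Rightarrow> real"
  assumes "L-lipschitz_on UNIV v" "bounded \<Omega>"
  obtains B where "0 \<le> B" "\<And>x. x \<in> \<Omega> \<Longrightarrow> \<bar>v x\<bar> \<le> B"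
proof -
  obtain R where R: "\<And>x. x \<in> \<Omega> \<Longrightarrow> norm x \<le> R" using assms(2) by (auto simp: bounded_iff)
  have L: "0 \<le> L" using lipschitz_on_nonneg[OF assms(1)] .
  have "\<bar>v x\<bar> \<le> \<bar>v 0\<bar> + L * \<bar>R\<bar>" if "x \<in> \<Omega>" for x
  proof -
    have "\<bar>v x - v 0\<bar> \<le> L * norm x" using lipschitz_onD[OF assms(1), of x 0] by (simp add: dist_norm)
    also have "\<dots> \<le> L * \<bar>R\<bar>" using R[OF that] L by (intro mult_left_mono) auto
    finally show ?thesis by linarith
  qed
  then show ?thesis using that[of "\<bar>v 0\<bar> + L * \<bar>R\<bar>"] L by simp
qed

lemma lipschitz_in_W1p:
  fixes v :: "'a::euclidean_space \<Rightarrow> real"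
  assumes "open \<Omega>" "bounded \<Omega>" "L-lipschitz_on UNIV v"
  shows "v \<in> W1p n \<Omega>"
proof -
  obtain B where B: "\<And>x. x \<in> \<Omega> \<Longrightarrow> \<bar>v x\<bar> \<le> B"
    by (rule lipschitz_bounded_on_bounded[OF assms(3,2)]) (rule that)
  have "v \<in> Lp_space n \<Omega>"
  proof (rule Lp_space_bounded[OF assms(1,2)])
    show "v \<in> borel_measurable (lebesgue_on \<Omega>)"
      by (intro borel_measurable_lebesgue_on_continuous lipschitz_on_continuous_on[OF assms(3)])
    show "AE x in lebesgue_on \<Omega>. norm (v x) \<le> B" by (rule AE_lebesgue_on[OF assms(1)]) (use B in auto)
  qed
  moreover have "weak_gradient \<Omega> v \<in> Lp_space n \<Omega>"
    by (rule Lp_space_bounded[OF assms(1,2) weak_gradient_AE_grad(3,4)[OF assms(1,3)]])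
  ultimately show ?thesis using weak_gradient_AE_grad(2)[OF assms(1,3)] by (auto simp: W1p_def)
qed

lemma test_function_Lp:
  assumes "open \<Omega>" "bounded \<Omega>" "test_function U \<phi>"
  shows "\<phi> \<in> Lp_space n \<Omega>" "gradient \<phi> \<in> Lp_space n \<Omega>"
proof -
  note t = test_functionD[OF assms(3)]
  note b = compact_imp_bounded[OF t(4)]
  obtain B where "\<And>x. norm (\<phi> x) \<le> B" using continuous_bounded_support[OF t(2) b t(6)] by blast
  then show "\<phi> \<in> Lp_space n \<Omega>"
    by (intro Lp_space_bounded[OF assms(1,2)] borel_measurable_lebesgue_on_continuous t(2) AE_I2)
  obtain B where "\<And>x. norm (gradient \<phi> x) \<le> B" using continuous_bounded_support[OF t(3) b t(7)] by blast
  then show "gradient \<phi> \<in> Lp_space n \<Omega>"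
    by (intro Lp_space_bounded[OF assms(1,2)] borel_measurable_lebesgue_on_continuous t(3) AE_I2)
qed

text \<open>Integrate the gradient of \<open>(x \<bullet> b) * (\<phi> x)\<^sup>2\<close> in the direction \<open>b\<close>, and absorb half of the
  integral of \<open>(\<phi> x)\<^sup>2\<close>.\<close>

lemma test_function_Poincare:
  fixes \<phi> :: "'a::euclidean_space \<Rightarrow> real"
  assumes \<phi>: "test_function U \<phi>" and R: "U \<subseteq> cball 0 R"
  shows "(LINT x|lebesgue. (\<phi> x)\<^sup>2) \<le> 4 * R\<^sup>2 * (LINT x|lebesgue. (norm (gradient \<phi> x))\<^sup>2)"
proof -
  note t = test_functionD[OF \<phi>]
  note bdd = compact_imp_bounded[OF t(4)]
  obtain b :: 'a where b: "b \<in> Basis" using nonempty_Basis by blast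
  define E where "E x = (x \<bullet> b) *\<^sub>R (\<phi> x *\<^sub>R gradient \<phi> x + \<phi> x *\<^sub>R gradient \<phi> x) + (\<phi> x * \<phi> x) *\<^sub>R b" for x
  have Ec: "continuous_on UNIV E" unfolding E_def by (intro continuous_intros t)
  have G: "GDERIV (\<lambda>x. (x \<bullet> b) * (\<phi> x * \<phi> x)) x :> E x" for x
    unfolding E_def by (intro GDERIV_mult GDERIV_inner_left GDERIV_gradient t(1))
  have "(LINT x|lebesgue. E x) = 0"
  proof (rule integral_gradient_zero[OF G Ec bdd])
    show "(x \<bullet> b) * (\<phi> x * \<phi> x) = 0" if "x \<notin> closure {x. \<phi> x \<noteq> 0}" for x using t(6)[OF that] by simp
  qed
  moreover have E0: "E x = 0" if "x \<notin> closure {x. \<phi> x \<noteq> 0}" for x using t(6)[OF that] by (simp add: E_def)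
  have Ei: "integrable lebesgue E" by (rule integrable_continuous_bounded_support[OF Ec bdd E0])
  ultimately have 0: "(LINT x|lebesgue. E x \<bullet> b) = 0" using integral_inner_left[of b lebesgue E] by simp
  have i1: "integrable lebesgue (\<lambda>x. (\<phi> x)\<^sup>2)"
  proof (rule integrable_continuous_bounded_support[OF _ bdd])
    show "(\<phi> x)\<^sup>2 = 0" if "x \<notin> closure {x. \<phi> x \<noteq> 0}" for x using t(6)[OF that] by simp
  qed (intro continuous_intros t)
  have i2: "integrable lebesgue (\<lambda>x. (norm (gradient \<phi> x))\<^sup>2)"
  proof (rule integrable_continuous_bounded_support[OF _ bdd])
    show "(norm (gradient \<phi> x))\<^sup>2 = 0" if "x \<notin> closure {x. \<phi> x \<noteq> 0}" for x using t(7)[OF that] by simp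
  qed (intro continuous_intros t)
  have "(LINT x|lebesgue. (1/2) * (\<phi> x)\<^sup>2 - 2 * R\<^sup>2 * (norm (gradient \<phi> x))\<^sup>2) \<le> (LINT x|lebesgue. E x \<bullet> b)"
  proof (rule integral_mono)
    fix x
    show "(1/2) * (\<phi> x)\<^sup>2 - 2 * R\<^sup>2 * (norm (gradient \<phi> x))\<^sup>2 \<le> E x \<bullet> b"
    proof (cases "x \<in> U")
      case True
      then have "norm x \<le> R" using R by auto
      then have xb: "\<bar>x \<bullet> b\<bar> \<le> R" using norm_bound_Basis_le[OF b] by blast
      have gb: "\<bar>gradient \<phi> x \<bullet> b\<bar> \<le> norm (gradient \<phi> x)" by (rule Basis_le_norm[OF b])
      have "\<bar>(x \<bullet> b) * (gradient \<phi> x \<bullet> b)\<bar> \<le> R * norm (gradient \<phi> x)"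
        unfolding abs_mult using xb gb by (intro mult_mono) auto
      then have "((x \<bullet> b) * (gradient \<phi> x \<bullet> b))\<^sup>2 \<le> (R * norm (gradient \<phi> x))\<^sup>2" by (rule abs_le_square_iff[THEN iffD1, OF order_trans]) simp
      moreover have "0 \<le> (\<phi> x + 2 * ((x \<bullet> b) * (gradient \<phi> x \<bullet> b)))\<^sup>2" by simp
      moreover have "E x \<bullet> b = 2 * \<phi> x * ((x \<bullet> b) * (gradient \<phi> x \<bullet> b)) + (\<phi> x)\<^sup>2"
        using b by (simp add: E_def inner_add_left power2_eq_square)
      ultimately show ?thesis by (simp add: power2_sum power_mult_distrib)
    next
      case False
      then have "\<phi> x = 0" by (rule t(8))
      then show ?thesis by (simp add: E_def)
    qed
  qed (use i1 i2 Ei in auto)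
  then show ?thesis using i1 i2 0 by simp
qed

text \<open>Where \<open>T \<le> \<epsilon>\<close> the lower power is at most \<open>\<epsilon> ^ m\<close>, and elsewhere it is at most
  \<open>T ^ n / \<epsilon> ^ (n - m)\<close>.\<close>

lemma Lp_null_imp_lower_null:
  fixes T :: "nat \<Rightarrow> 'a \<Rightarrow> real"
  assumes "finite_measure M" "1 \<le> m" "m \<le> n" "\<And>k x. 0 \<le> T k x" "\<And>k. T k \<in> borel_measurable M"
    "\<And>k. integrable M (\<lambda>x. T k x ^ n)" "(\<lambda>k. LINT x|M. T k x ^ n) \<longlonglongrightarrow> 0"
  shows "integrable M (\<lambda>x. T k x ^ m)" "(\<lambda>k. LINT x|M. T k x ^ m) \<longlonglongrightarrow> 0"
proof -
  interpret finite_measure M by fact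
  have bound: "T k x ^ m \<le> \<epsilon> ^ m + T k x ^ n / \<epsilon> ^ (n - m)" if "0 < \<epsilon>" for k x \<epsilon>
  proof (cases "T k x \<le> \<epsilon>")
    case True
    then have "T k x ^ m \<le> \<epsilon> ^ m" using assms(4) by (intro power_mono) auto
    then show ?thesis using that assms(4)[of k x] by (simp add: add_increasing2)
  next
    case False
    then have "\<epsilon> ^ (n - m) \<le> T k x ^ (n - m)" using that by (intro power_mono) auto
    then have "T k x ^ m * \<epsilon> ^ (n - m) \<le> T k x ^ m * T k x ^ (n - m)" using assms(4)[of k x] by (intro mult_left_mono) auto
    also have "\<dots> = T k x ^ (m + (n - m))" by (simp only: power_add)
    also have "m + (n - m) = n" using assms(3) by simp
    finally have "T k x ^ m \<le> T k x ^ n / \<epsilon> ^ (n - m)" using that by (simp add: field_simps)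
    then show ?thesis using that by (simp add: add_increasing)
  qed
  show int: "integrable M (\<lambda>x. T k x ^ m)" for k
  proof (rule Bochner_Integration.integrable_bound)
    show "integrable M (\<lambda>x. 1 + T k x ^ n)" using assms(6) by simp
    show "AE x in M. norm (T k x ^ m) \<le> norm (1 + T k x ^ n)"
      using bound[of 1 k] assms(4) by (intro AE_I2) (simp add: abs_of_nonneg)
  qed (use assms(5) in measurable)
  define \<mu> where "\<mu> = measure M (space M)"
  have I: "(LINT x|M. T k x ^ m) \<le> \<epsilon> ^ m * \<mu> + (LINT x|M. T k x ^ n) / \<epsilon> ^ (n - m)" if "0 < \<epsilon>" for k \<epsilon>
  proof -
    have "(LINT x|M. T k x ^ m) \<le> (LINT x|M. \<epsilon> ^ m + T k x ^ n / \<epsilon> ^ (n - m))"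
      using int assms(6) bound[OF that] by (intro integral_mono) auto
    then show ?thesis using assms(6) by (simp add: \<mu>_def mult.commute)
  qed
  show "(\<lambda>k. LINT x|M. T k x ^ m) \<longlonglongrightarrow> 0"
  proof (rule order_tendstoI)
    fix y :: real assume "y < 0"
    moreover have "0 \<le> (LINT x|M. T k x ^ m)" for k using assms(4) by (intro integral_nonneg_AE) auto
    ultimately show "\<forall>\<^sub>F k in sequentially. y < (LINT x|M. T k x ^ m)"
      by (intro always_eventually allI) (meson less_le_trans)
  next
    fix y :: real assume y: "0 < y"
    define \<epsilon> where "\<epsilon> = min 1 (y / (2 * (\<mu> + 1)))"
    have \<mu>: "0 \<le> \<mu>" by (simp add: \<mu>_def)
    have \<epsilon>: "0 < \<epsilon>" using y \<mu> by (simp add: \<epsilon>_def)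
    have "\<epsilon> ^ m * \<mu> \<le> \<epsilon> * (\<mu> + 1)"
    proof (rule mult_mono)
      have "\<epsilon> ^ m \<le> \<epsilon> ^ 1" using \<epsilon> assms(2) by (intro power_decreasing) (auto simp: \<epsilon>_def)
      then show "\<epsilon> ^ m \<le> \<epsilon>" by simp
    qed (use \<epsilon> \<mu> in auto)
    also have "\<dots> \<le> y / (2 * (\<mu> + 1)) * (\<mu> + 1)" using \<mu> by (intro mult_right_mono) (auto simp: \<epsilon>_def)
    also have "\<dots> = y / 2"
    proof -
      have "2 * \<mu> + 2 \<noteq> 0" using \<mu> by simp
      then show ?thesis by (simp add: field_simps)
    qed
    finally have a: "\<epsilon> ^ m * \<mu> \<le> y / 2" .
    have "(\<lambda>k. (LINT x|M. T k x ^ n) / \<epsilon> ^ (n - m)) \<longlonglongrightarrow> 0"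
      using tendsto_divide[OF assms(7) tendsto_const, of "\<epsilon> ^ (n - m)"] \<epsilon> by simp
    then have "\<forall>\<^sub>F k in sequentially. (LINT x|M. T k x ^ n) / \<epsilon> ^ (n - m) < y / 2"
      by (rule order_tendstoD(2)) (use y in simp)
    then show "\<forall>\<^sub>F k in sequentially. (LINT x|M. T k x ^ m) < y"
      by eventually_elim (use I[OF \<epsilon>] a in \<open>smt (verit) field_sum_of_halves\<close>)
  qed
qed

text \<open>The gradients of the differences of the approximating test functions tend to zero, hence so do these
  differences themselves by the Poincare inequality.\<close>

lemma W1p_0_eqI:
  fixes v w :: "'a::euclidean_space \<Rightarrow> real"
  assumes \<Omega>: "open \<Omega>" "bounded \<Omega>" and n: "2 \<le> n" and v: "v \<in> W1p_0 n \<Omega>" and w: "w \<in> W1p_0 n \<Omega>"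
    and eq: "AE x in lebesgue_on \<Omega>. weak_gradient \<Omega> v x = weak_gradient \<Omega> w x"
  shows "AE x in lebesgue_on \<Omega>. v x = w x"
proof -
  let ?M = "lebesgue_on \<Omega>"
  interpret finite_measure ?M by (rule finite_measure_lebesgue_on_bounded_open[OF \<Omega>])
  obtain R where R: "\<Omega> \<subseteq> cball 0 R" using \<Omega>(2) by (metis ball_subset_cball bounded_subset_ballD order_trans)
  obtain \<phi> D where \<phi>: "\<And>k. test_function \<Omega> (\<phi> k)" "\<And>k x. GDERIV (\<phi> k) x :> D k x"
    "(\<lambda>k::nat. LINT x|?M. \<bar>v x - \<phi> k x\<bar> ^ n) \<longlonglongrightarrow> 0"
    "(\<lambda>k. LINT x|?M. norm (weak_gradient \<Omega> v x - D k x) ^ n) \<longlonglongrightarrow> 0"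
    using v unfolding W1p_0_def by blast
  obtain \<theta> E where \<theta>: "\<And>k. test_function \<Omega> (\<theta> k)" "\<And>k x. GDERIV (\<theta> k) x :> E k x"
    "(\<lambda>k::nat. LINT x|?M. \<bar>w x - \<theta> k x\<bar> ^ n) \<longlonglongrightarrow> 0"
    "(\<lambda>k. LINT x|?M. norm (weak_gradient \<Omega> w x - E k x) ^ n) \<longlonglongrightarrow> 0"
    using w unfolding W1p_0_def by blast
  have DE: "D k = gradient (\<phi> k)" "E k = gradient (\<theta> k)" for k using gradient_eq[OF \<phi>(2)] gradient_eq[OF \<theta>(2)] by auto
  have Lp: "v \<in> Lp_space n \<Omega>" "weak_gradient \<Omega> v \<in> Lp_space n \<Omega>" "w \<in> Lp_space n \<Omega>" "weak_gradient \<Omega> w \<in> Lp_space n \<Omega>"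
    using v w by (auto simp: W1p_0_def W1p_def)
  have LpT: "\<phi> k \<in> Lp_space n \<Omega>" "D k \<in> Lp_space n \<Omega>" "\<theta> k \<in> Lp_space n \<Omega>" "E k \<in> Lp_space n \<Omega>" for k
    unfolding DE using test_function_Lp[OF \<Omega> \<phi>(1)] test_function_Lp[OF \<Omega> \<theta>(1)] by auto
  have meas[measurable]: "v \<in> borel_measurable ?M" "w \<in> borel_measurable ?M" "weak_gradient \<Omega> v \<in> borel_measurable ?M"
    "weak_gradient \<Omega> w \<in> borel_measurable ?M" "\<And>k. \<phi> k \<in> borel_measurable ?M" "\<And>k. \<theta> k \<in> borel_measurable ?M"
    "\<And>k. D k \<in> borel_measurable ?M" "\<And>k. E k \<in> borel_measurable ?M"
    using Lp LpT by (auto simp: Lp_space_def)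
  note int = Lp_space_diff_integrable[OF Lp(1) LpT(1)] Lp_space_diff_integrable[OF Lp(2) LpT(2)]
    Lp_space_diff_integrable[OF Lp(3) LpT(3)] Lp_space_diff_integrable[OF Lp(4) LpT(4)]
  have DElim: "(\<lambda>k. LINT x|?M. norm (D k x - E k x) ^ n) \<longlonglongrightarrow> 0"
  proof (rule tendsto_sandwich[OF _ _ tendsto_const])
    show "\<forall>\<^sub>F k in sequentially. 0 \<le> (LINT x|?M. norm (D k x - E k x) ^ n)" by (intro always_eventually allI integral_nonneg_AE) auto
    show "\<forall>\<^sub>F k in sequentially. (LINT x|?M. norm (D k x - E k x) ^ n) \<le>
      2 ^ n * ((LINT x|?M. norm (weak_gradient \<Omega> v x - D k x) ^ n) + (LINT x|?M. norm (weak_gradient \<Omega> w x - E k x) ^ n))"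
    proof (intro always_eventually allI)
      fix k
      have "(LINT x|?M. norm (D k x - E k x) ^ n) \<le>
        (LINT x|?M. 2 ^ n * (norm (weak_gradient \<Omega> v x - D k x) ^ n + norm (weak_gradient \<Omega> w x - E k x) ^ n))"
      proof (rule integral_mono_AE)
        show "AE x in ?M. norm (D k x - E k x) ^ n \<le> 2 ^ n * (norm (weak_gradient \<Omega> v x - D k x) ^ n + norm (weak_gradient \<Omega> w x - E k x) ^ n)"
          using eq
        proof eventually_elim
          case (elim x)
          then show ?case using norm_diff_power_le[of "D k x" "E k x" n "weak_gradient \<Omega> v x"] by (simp add: norm_minus_commute)
        qed
      qed (use int Lp_space_diff_integrable[OF LpT(2,4)] in auto)
      then show "(LINT x|?M. norm (D k x - E k x) ^ n) \<le>
        2 ^ n * ((LINT x|?M. norm (weak_gradient \<Omega> v x - D k x) ^ n) + (LINT x|?M. norm (weak_gradient \<Omega> w x - E k x) ^ n))"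
        using int by simp
    qed
    show "(\<lambda>k. 2 ^ n * ((LINT x|?M. norm (weak_gradient \<Omega> v x - D k x) ^ n) + (LINT x|?M. norm (weak_gradient \<Omega> w x - E k x) ^ n))) \<longlonglongrightarrow> 0"
      using tendsto_mult[OF tendsto_const[of "2 ^ n"] tendsto_add[OF \<phi>(4) \<theta>(4)]] by simp
  qed
  note L2D = Lp_null_imp_lower_null[OF finite_measure_axioms one_le_numeral n, of "\<lambda>k x. norm (D k x - E k x)"]
  have D2: "(\<lambda>k. LINT x|?M. (norm (D k x - E k x))\<^sup>2) \<longlonglongrightarrow> 0"
    by (rule L2D(2)) (use DElim Lp_space_diff_integrable[OF LpT(2,4)] in auto)
  have tst: "test_function \<Omega> (\<lambda>x. \<phi> k x - \<theta> k x)" for k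
  proof (rule test_functionI)
    show "smooth (\<lambda>x. \<phi> k x - \<theta> k x)" by (intro smooth_diff test_functionD(1)[OF \<phi>(1)] test_functionD(1)[OF \<theta>(1)])
    show "compact (closure {x. \<phi> k x \<noteq> 0} \<union> closure {x. \<theta> k x \<noteq> 0})"
      by (intro compact_Un test_functionD(4)[OF \<phi>(1)] test_functionD(4)[OF \<theta>(1)])
    show "closure {x. \<phi> k x \<noteq> 0} \<union> closure {x. \<theta> k x \<noteq> 0} \<subseteq> \<Omega>"
      using test_functionD(5)[OF \<phi>(1)] test_functionD(5)[OF \<theta>(1)] by (rule Un_least)
    fix x assume "x \<notin> closure {x. \<phi> k x \<noteq> 0} \<union> closure {x. \<theta> k x \<noteq> 0}"
    then have a: "x \<notin> closure {x. \<phi> k x \<noteq> 0}" and b: "x \<notin> closure {x. \<theta> k x \<noteq> 0}" by simp_all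
    show "\<phi> k x - \<theta> k x = 0" using test_functionD(6)[OF \<phi>(1) a] test_functionD(6)[OF \<theta>(1) b] by simp
  qed
  have gr: "gradient (\<lambda>x. \<phi> k x - \<theta> k x) x = D k x - E k x" for k x
    by (intro gradient_eq GDERIV_diff \<phi>(2) \<theta>(2))
  have on: "(LINT x|?M. (\<phi> k x - \<theta> k x)\<^sup>2) \<le> 4 * R\<^sup>2 * (LINT x|?M. (norm (D k x - E k x))\<^sup>2)" for k
  proof -
    have "(LINT x|?M. (\<phi> k x - \<theta> k x)\<^sup>2) = (LINT x|lebesgue. (\<phi> k x - \<theta> k x)\<^sup>2)"
      by (rule integral_lebesgue_on_open[OF \<Omega>(1)]) (use test_functionD(8)[OF tst] in simp)
    moreover have "(LINT x|?M. (norm (D k x - E k x))\<^sup>2) = (LINT x|lebesgue. (norm (D k x - E k x))\<^sup>2)"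
      by (rule integral_lebesgue_on_open[OF \<Omega>(1)]) (use test_functionD(9)[OF tst] gr in simp)
    ultimately show ?thesis using test_function_Poincare[OF tst R] gr by simp
  qed
  have lim2: "(\<lambda>k. LINT x|?M. (\<phi> k x - \<theta> k x)\<^sup>2) \<longlonglongrightarrow> 0"
  proof (rule tendsto_sandwich[OF _ _ tendsto_const])
    show "\<forall>\<^sub>F k in sequentially. 0 \<le> (LINT x|?M. (\<phi> k x - \<theta> k x)\<^sup>2)" by (intro always_eventually allI integral_nonneg_AE) auto
    show "\<forall>\<^sub>F k in sequentially. (LINT x|?M. (\<phi> k x - \<theta> k x)\<^sup>2) \<le> 4 * R\<^sup>2 * (LINT x|?M. (norm (D k x - E k x))\<^sup>2)"
      using on by simp
    show "(\<lambda>k. 4 * R\<^sup>2 * (LINT x|?M. (norm (D k x - E k x))\<^sup>2)) \<longlonglongrightarrow> 0"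
      using tendsto_mult[OF tendsto_const[of "4 * R\<^sup>2"] D2] by simp
  qed
  note Lv = Lp_null_imp_lower_null[OF finite_measure_axioms one_le_numeral n, of "\<lambda>k x. \<bar>v x - \<phi> k x\<bar>"]
  note Lw = Lp_null_imp_lower_null[OF finite_measure_axioms one_le_numeral n, of "\<lambda>k x. \<bar>w x - \<theta> k x\<bar>"]
  have v2: "(\<lambda>k. LINT x|?M. \<bar>v x - \<phi> k x\<bar>\<^sup>2) \<longlonglongrightarrow> 0" "integrable ?M (\<lambda>x. \<bar>v x - \<phi> k x\<bar>\<^sup>2)" for k
    by (rule Lv(2) Lv(1); use \<phi>(3) int(1) in auto)+
  have w2: "(\<lambda>k. LINT x|?M. \<bar>w x - \<theta> k x\<bar>\<^sup>2) \<longlonglongrightarrow> 0" "integrable ?M (\<lambda>x. \<bar>w x - \<theta> k x\<bar>\<^sup>2)" for k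
    by (rule Lw(2) Lw(1); use \<theta>(3) int(3) in auto)+
  have t2: "integrable ?M (\<lambda>x. (\<phi> k x - \<theta> k x)\<^sup>2)" for k
    using test_function_Lp(1)[OF \<Omega> tst, of k 2] by (simp add: Lp_space_def)
  have pw: "(v x - w x)\<^sup>2 \<le> 4 * (\<bar>v x - \<phi> k x\<bar>\<^sup>2 + (\<phi> k x - \<theta> k x)\<^sup>2 + \<bar>w x - \<theta> k x\<bar>\<^sup>2)" for k x
  proof -
    have "(a + b + c)\<^sup>2 \<le> 4 * (a\<^sup>2 + b\<^sup>2 + c\<^sup>2)" for a b c :: real
    proof -
      have "0 \<le> (a - b)\<^sup>2 + (b - c)\<^sup>2 + (a - c)\<^sup>2 + a\<^sup>2 + b\<^sup>2 + c\<^sup>2" by simp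
      then show ?thesis by (simp add: power2_eq_square algebra_simps)
    qed
    from this[of "v x - \<phi> k x" "\<phi> k x - \<theta> k x" "- (w x - \<theta> k x)"] show ?thesis
      by (simp add: power2_commute[of "\<theta> k x" "w x"])
  qed
  have vw: "integrable ?M (\<lambda>x. (v x - w x)\<^sup>2)"
  proof (rule Bochner_Integration.integrable_bound)
    show "integrable ?M (\<lambda>x. 4 * (\<bar>v x - \<phi> 0 x\<bar>\<^sup>2 + (\<phi> 0 x - \<theta> 0 x)\<^sup>2 + \<bar>w x - \<theta> 0 x\<bar>\<^sup>2))"
      using v2(2) w2(2) t2 by (intro integrable_mult_right Bochner_Integration.integrable_add)
    show "(\<lambda>x. (v x - w x)\<^sup>2) \<in> borel_measurable ?M" by measurable
    show "AE x in ?M. norm ((v x - w x)\<^sup>2) \<le> norm (4 * (\<bar>v x - \<phi> 0 x\<bar>\<^sup>2 + (\<phi> 0 x - \<theta> 0 x)\<^sup>2 + \<bar>w x - \<theta> 0 x\<bar>\<^sup>2))"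
      using pw[of _ 0] by (intro AE_I2) simp
  qed
  have "(LINT x|?M. (v x - w x)\<^sup>2) \<le> 0"
  proof (rule LIMSEQ_le_const)
    show "(\<lambda>k. 4 * ((LINT x|?M. \<bar>v x - \<phi> k x\<bar>\<^sup>2) + (LINT x|?M. (\<phi> k x - \<theta> k x)\<^sup>2) + (LINT x|?M. \<bar>w x - \<theta> k x\<bar>\<^sup>2))) \<longlonglongrightarrow> 0"
      using tendsto_mult[OF tendsto_const[of 4] tendsto_add[OF tendsto_add[OF v2(1) lim2] w2(1)]] by simp
    have "(LINT x|?M. (v x - w x)\<^sup>2) \<le> (LINT x|?M. 4 * (\<bar>v x - \<phi> k x\<bar>\<^sup>2 + (\<phi> k x - \<theta> k x)\<^sup>2 + \<bar>w x - \<theta> k x\<bar>\<^sup>2))" for k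
      by (rule integral_mono[OF vw _ pw]) (intro integrable_mult_right Bochner_Integration.integrable_add v2(2) w2(2) t2)
    also have "\<dots> k = 4 * ((LINT x|?M. \<bar>v x - \<phi> k x\<bar>\<^sup>2) + (LINT x|?M. (\<phi> k x - \<theta> k x)\<^sup>2) + (LINT x|?M. \<bar>w x - \<theta> k x\<bar>\<^sup>2))" for k
      using v2(2) w2(2) t2 by (simp only: integral_mult_right_zero Bochner_Integration.integral_add Bochner_Integration.integrable_add)
    finally show "\<exists>N. \<forall>k\<ge>N. (LINT x|?M. (v x - w x)\<^sup>2) \<le>
      4 * ((LINT x|?M. \<bar>v x - \<phi> k x\<bar>\<^sup>2) + (LINT x|?M. (\<phi> k x - \<theta> k x)\<^sup>2) + (LINT x|?M. \<bar>w x - \<theta> k x\<bar>\<^sup>2))" by blast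
  qed
  moreover have "0 \<le> (LINT x|?M. (v x - w x)\<^sup>2)" by (intro integral_nonneg_AE) auto
  ultimately have "AE x in ?M. (v x - w x)\<^sup>2 = 0"
    using integral_nonneg_eq_0_iff_AE[OF vw] by simp
  then show ?thesis by eventually_elim simp
qed

definition soft_threshold :: "real \<Rightarrow> real \<Rightarrow> real" where
  "soft_threshold \<epsilon> t = (if \<epsilon> < t then t - \<epsilon> else if t < - \<epsilon> then t + \<epsilon> else 0)"

lemma soft_threshold_lipschitz: "0 \<le> \<epsilon> \<Longrightarrow> \<bar>soft_threshold \<epsilon> s - soft_threshold \<epsilon> t\<bar> \<le> \<bar>s - t\<bar>"
  unfolding soft_threshold_def by (auto split: if_splits)

lemma soft_threshold_close: "0 \<le> \<epsilon> \<Longrightarrow> \<bar>soft_threshold \<epsilon> t - t\<bar> \<le> \<epsilon>"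
  unfolding soft_threshold_def by (auto split: if_splits)

text \<open>Thresholding pulls the support away from the boundary of the set where the function
  does not vanish, without increasing slopes.\<close>

lemma lipschitz_soft_threshold:
  fixes \<psi> :: "'a::euclidean_space \<Rightarrow> real"
  assumes \<psi>: "L-lipschitz_on UNIV \<psi>" and "0 \<le> \<epsilon>"
  shows "L-lipschitz_on UNIV (\<lambda>x. soft_threshold \<epsilon> (\<psi> x))"
    and "AE x in lebesgue. grad (\<lambda>x. soft_threshold \<epsilon> (\<psi> x)) x = (if \<epsilon> < \<bar>\<psi> x\<bar> then grad \<psi> x else 0)"
proof -
  show lip: "L-lipschitz_on UNIV (\<lambda>x. soft_threshold \<epsilon> (\<psi> x))"
  proof (rule lipschitz_onI)
    fix x y
    show "dist (soft_threshold \<epsilon> (\<psi> x)) (soft_threshold \<epsilon> (\<psi> y)) \<le> L * dist x y"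
      using soft_threshold_lipschitz[OF assms(2), of "\<psi> x" "\<psi> y"] lipschitz_onD[OF \<psi>, of x y]
      by (simp add: dist_real_def)
  qed (rule lipschitz_on_nonneg[OF \<psi>])
  have c: "continuous_on UNIV \<psi>" by (rule lipschitz_on_continuous_on[OF \<psi>])
  have shift: "L-lipschitz_on UNIV (\<lambda>x. \<psi> x + d)" "AE x in lebesgue. grad (\<lambda>x. \<psi> x + d) x = grad \<psi> x" for d
  proof -
    show "L-lipschitz_on UNIV (\<lambda>x. \<psi> x + d)"
      using \<psi> by (auto simp: lipschitz_on_def dist_real_def)
    have "AE x in lebesgue. grad (\<lambda>x::'a. 0 \<bullet> x + d) x = 0" by (rule grad_affine)
    moreover have "AE x in lebesgue. grad (\<lambda>x. \<psi> x + (0 \<bullet> x + d)) x = grad \<psi> x + grad (\<lambda>x. 0 \<bullet> x + d) x"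
      by (rule grad_add[OF \<psi>, of 0]) (auto simp: lipschitz_on_def)
    ultimately show "AE x in lebesgue. grad (\<lambda>x. \<psi> x + d) x = grad \<psi> x"
      by eventually_elim simp
  qed
  have "AE x in lebesgue. x \<in> {x. \<epsilon> < \<psi> x} \<longrightarrow> grad (\<lambda>x. soft_threshold \<epsilon> (\<psi> x)) x = grad (\<lambda>x. \<psi> x + (- \<epsilon>)) x"
    by (rule grad_local[OF lip shift(1)])
      (auto simp: soft_threshold_def intro!: open_Collect_less continuous_intros c)
  moreover have "AE x in lebesgue. x \<in> {x. \<psi> x < - \<epsilon>} \<longrightarrow> grad (\<lambda>x. soft_threshold \<epsilon> (\<psi> x)) x = grad (\<lambda>x. \<psi> x + \<epsilon>) x"
    by (rule grad_local[OF lip shift(1)])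
      (use assms(2) in \<open>auto simp: soft_threshold_def intro!: open_Collect_less continuous_intros c\<close>)
  moreover have "AE x in lebesgue. soft_threshold \<epsilon> (\<psi> x) = 0 \<longrightarrow> grad (\<lambda>x. soft_threshold \<epsilon> (\<psi> x)) x = 0"
    by (rule grad_zero_on_zero_set[OF lip])
  ultimately show "AE x in lebesgue. grad (\<lambda>x. soft_threshold \<epsilon> (\<psi> x)) x = (if \<epsilon> < \<bar>\<psi> x\<bar> then grad \<psi> x else 0)"
    using shift(2)[of "- \<epsilon>"] shift(2)[of \<epsilon>]
  proof eventually_elim
    case (elim x)
    then show ?case using assms(2) by (cases "\<epsilon> < \<psi> x"; cases "\<psi> x < - \<epsilon>") (auto simp: soft_threshold_def)
  qed
qed

lemma test_function_approximation_compact_support: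
  fixes \<psi> :: "'a::euclidean_space \<Rightarrow> real"
  assumes \<Omega>: "open \<Omega>" "bounded \<Omega>" and \<psi>: "L-lipschitz_on UNIV \<psi>"
    and K: "compact K" "K \<subseteq> \<Omega>" "\<And>x. x \<notin> K \<Longrightarrow> \<psi> x = 0" and n: "1 \<le> n" and e: "0 < e"
  shows "\<exists>\<phi>. test_function \<Omega> \<phi> \<and> (LINT x|lebesgue_on \<Omega>. \<bar>\<psi> x - \<phi> x\<bar> ^ n) \<le> e \<and>
    (LINT x|lebesgue_on \<Omega>. norm (grad \<psi> x - gradient \<phi> x) ^ n) \<le> e"
proof (cases "K = {}")
  case True
  then have \<psi>0: "\<psi> = (\<lambda>_. 0)" using K(3) by auto
  have g0: "gradient (\<lambda>x::'a. 0::real) = (\<lambda>_. 0)" by (auto intro: gradient_eq GDERIV_const)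
  have "AE x in lebesgue. grad \<psi> x = 0" using grad_zero_on_zero_set[OF \<psi>] unfolding \<psi>0 by simp
  then have "AE x in lebesgue_on \<Omega>. norm (grad \<psi> x - 0) ^ n = 0"
    by (intro AE_lebesgue_on[OF \<Omega>(1)]) (use n in \<open>auto simp: power_0_left\<close>)
  then have "(LINT x|lebesgue_on \<Omega>. norm (grad \<psi> x - 0) ^ n) = 0" by (rule integral_eq_zero_AE)
  then show ?thesis
    using e n by (intro exI[of _ "\<lambda>_. 0"])
      (auto simp: \<psi>0 g0 power_0_left intro!: test_functionI[of _ "{}"] smooth_const)
next
  case False
  let ?M = "lebesgue_on \<Omega>"
  interpret finite_measure ?M by (rule finite_measure_lebesgue_on_bounded_open[OF \<Omega>])
  have L: "0 \<le> L" using lipschitz_on_nonneg[OF \<psi>] .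
  obtain \<delta> where \<delta>: "0 < \<delta>" "{x. infdist x K \<le> \<delta>} \<subseteq> \<Omega>"
    using compact_in_open_separated[OF False K(1) \<Omega>(1) K(2)] by blast
  obtain r where r: "\<And>n. r n \<in> mollifiers (1 / (real n + 1))"
    and lim: "AE x in lebesgue. (\<lambda>n. gradient (conv \<psi> (r n)) x) \<longlonglongrightarrow> grad \<psi> x"
    and gm: "grad \<psi> \<in> borel_measurable lebesgue" and gb: "AE x in lebesgue. norm (grad \<psi> x) \<le> L"
    by (rule lipschitz_smooth_approximation_grad[OF \<psi>]) (rule that)
  define s where "s k = conv \<psi> (r k)" for k
  have sm: "smooth (s k)" for k unfolding s_def by (rule smooth_mollify[OF \<psi> r])
  have l0: "(\<lambda>k. 1 / (real k + 1)) \<longlonglongrightarrow> 0"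
    using LIMSEQ_inverse_real_of_nat by (simp add: inverse_eq_divide add.commute)
  have close: "\<bar>s k x - \<psi> x\<bar> \<le> L * (1 / (real k + 1))" for k x
    unfolding s_def by (rule mollify_close[OF \<psi> r])
  have gsb: "norm (gradient (s k) x) \<le> L" for k x unfolding s_def by (rule mollify_gradient_bound[OF \<psi> r])
  have tst: "test_function \<Omega> (s k)" if k: "1 / (real k + 1) \<le> \<delta>" for k
  proof (rule test_functionI[OF sm compact_infdist_le[OF False K(1) \<delta>(1)] \<delta>(2)])
    fix x assume x: "x \<notin> {x. infdist x K \<le> \<delta>}"
    show "s k x = 0" unfolding s_def
    proof (rule mollify_zero[OF \<psi> r])
      fix y assume "dist x y \<le> 1 / (real k + 1)"
      then have "y \<notin> K" using x k infdist_le[of y K x] by auto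
      then show "\<psi> y = 0" by (rule K(3))
    qed
  qed
  have 1: "(\<lambda>k. LINT x|?M. \<bar>\<psi> x - s k x\<bar> ^ n) \<longlonglongrightarrow> (LINT x|?M. 0)"
  proof (rule integral_dominated_convergence[where w="\<lambda>_. L ^ n"])
    show "(\<lambda>x. \<bar>\<psi> x - s k x\<bar> ^ n) \<in> borel_measurable ?M" for k
      by (intro borel_measurable_lebesgue_on_continuous continuous_intros smooth_continuous sm
          lipschitz_on_continuous_on[OF \<psi>])
    show "AE x in ?M. (\<lambda>k. \<bar>\<psi> x - s k x\<bar> ^ n) \<longlonglongrightarrow> 0"
    proof (rule AE_I2)
      fix x
      have "(\<lambda>k. \<psi> x - s k x) \<longlonglongrightarrow> 0"
      proof (rule Lim_null_comparison)
        show "\<forall>\<^sub>F k in sequentially. norm (\<psi> x - s k x) \<le> L * (1 / (real k + 1))"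
          using close by (simp add: abs_minus_commute)
        show "(\<lambda>k. L * (1 / (real k + 1))) \<longlonglongrightarrow> 0" by (rule tendsto_mult_right_zero[OF l0])
      qed
      then have "(\<lambda>k. \<bar>\<psi> x - s k x\<bar> ^ n) \<longlonglongrightarrow> \<bar>0\<bar> ^ n" by (intro tendsto_intros)
      then show "(\<lambda>k. \<bar>\<psi> x - s k x\<bar> ^ n) \<longlonglongrightarrow> 0" using n by (simp add: power_0_left)
    qed
    show "AE x in ?M. norm (\<bar>\<psi> x - s k x\<bar> ^ n) \<le> L ^ n" for k
    proof (rule AE_I2)
      fix x
      have "L * (1 / (real k + 1)) \<le> L * 1" by (rule mult_left_mono[OF _ L]) simp
      then have "\<bar>\<psi> x - s k x\<bar> \<le> L" using close[of k x] by linarith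
      then show "norm (\<bar>\<psi> x - s k x\<bar> ^ n) \<le> L ^ n" by (simp add: power_mono)
    qed
  qed auto
  have 2: "(\<lambda>k. LINT x|?M. norm (grad \<psi> x - gradient (s k) x) ^ n) \<longlonglongrightarrow> (LINT x|?M. 0)"
  proof (rule integral_dominated_convergence[where w="\<lambda>_. (2 * L) ^ n"])
    have [measurable]: "grad \<psi> \<in> borel_measurable ?M" by (intro measurable_restrict_space1 gm)
    have [measurable]: "gradient (s k) \<in> borel_measurable ?M" for k
      by (intro borel_measurable_lebesgue_on_continuous smooth_continuous_gradient sm)
    show "(\<lambda>x. norm (grad \<psi> x - gradient (s k) x) ^ n) \<in> borel_measurable ?M" for k by measurable
    show "AE x in ?M. (\<lambda>k. norm (grad \<psi> x - gradient (s k) x) ^ n) \<longlonglongrightarrow> 0"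
    proof (rule AE_lebesgue_on[OF \<Omega>(1)])
      show "AE x in lebesgue. x \<in> \<Omega> \<longrightarrow> (\<lambda>k. norm (grad \<psi> x - gradient (s k) x) ^ n) \<longlonglongrightarrow> 0"
        using lim
      proof eventually_elim
        case (elim x)
        then have "(\<lambda>k. norm (grad \<psi> x - gradient (s k) x) ^ n) \<longlonglongrightarrow> norm (grad \<psi> x - grad \<psi> x) ^ n"
          unfolding s_def by (intro tendsto_intros)
        then show ?case using n by (simp add: power_0_left)
      qed
    qed
    show "AE x in ?M. norm (norm (grad \<psi> x - gradient (s k) x) ^ n) \<le> (2 * L) ^ n" for k
    proof (rule AE_lebesgue_on[OF \<Omega>(1)])
      show "AE x in lebesgue. x \<in> \<Omega> \<longrightarrow> norm (norm (grad \<psi> x - gradient (s k) x) ^ n) \<le> (2 * L) ^ n"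
        using gb
      proof eventually_elim
        case (elim x)
        then have "norm (grad \<psi> x - gradient (s k) x) \<le> 2 * L"
          using norm_triangle_ineq4[of "grad \<psi> x" "gradient (s k) x"] gsb[of k x] by linarith
        then have "norm (grad \<psi> x - gradient (s k) x) ^ n \<le> (2 * L) ^ n" by (rule power_mono) simp
        then show ?case by simp
      qed
    qed
  qed auto
  have "\<forall>\<^sub>F k in sequentially. (LINT x|?M. \<bar>\<psi> x - s k x\<bar> ^ n) < e" using order_tendstoD(2)[OF 1] e by simp
  moreover have "\<forall>\<^sub>F k in sequentially. (LINT x|?M. norm (grad \<psi> x - gradient (s k) x) ^ n) < e"
    using order_tendstoD(2)[OF 2] e by simp
  moreover have "\<forall>\<^sub>F k in sequentially. 1 / (real k + 1) < \<delta>" using order_tendstoD(2)[OF l0 \<delta>(1)] .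
  ultimately have "\<forall>\<^sub>F k in sequentially. test_function \<Omega> (s k) \<and> (LINT x|?M. \<bar>\<psi> x - s k x\<bar> ^ n) \<le> e \<and>
    (LINT x|?M. norm (grad \<psi> x - gradient (s k) x) ^ n) \<le> e"
    by eventually_elim (auto intro: tst)
  then show ?thesis using eventually_happens' sequentially_bot by blast
qed

text \<open>The thresholded functions \<open>s k\<close> have compact support in \<open>\<Omega>\<close> and can be mollified.  Their gradients
  converge to that of \<open>\<psi>\<close> because the latter vanishes almost everywhere on the zero set of \<open>\<psi>\<close>.\<close>

lemma test_function_approximation:
  fixes \<psi> :: "'a::euclidean_space \<Rightarrow> real"
  assumes \<Omega>: "open \<Omega>" "bounded \<Omega>" and \<psi>: "L-lipschitz_on UNIV \<psi>" and off: "\<And>x. x \<notin> \<Omega> \<Longrightarrow> \<psi> x = 0"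
    and n: "1 \<le> n" and e: "0 < e"
  shows "\<exists>\<phi>. test_function \<Omega> \<phi> \<and> (LINT x|lebesgue_on \<Omega>. \<bar>\<psi> x - \<phi> x\<bar> ^ n) \<le> e \<and>
    (LINT x|lebesgue_on \<Omega>. norm (grad \<psi> x - gradient \<phi> x) ^ n) \<le> e"
proof -
  let ?M = "lebesgue_on \<Omega>"
  interpret finite_measure ?M by (rule finite_measure_lebesgue_on_bounded_open[OF \<Omega>])
  have c: "continuous_on UNIV \<psi>" by (rule lipschitz_on_continuous_on[OF \<psi>])
  define \<epsilon> where "\<epsilon> k = 1 / (real k + 1)" for k
  have \<epsilon>: "0 < \<epsilon> k" "0 \<le> \<epsilon> k" "\<epsilon> k \<le> 1" for k by (auto simp: \<epsilon>_def)
  have l0: "\<epsilon> \<longlonglongrightarrow> 0"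
    using LIMSEQ_inverse_real_of_nat by (simp add: \<epsilon>_def[abs_def] inverse_eq_divide add.commute)
  define s where "s k x = soft_threshold (\<epsilon> k) (\<psi> x)" for k x
  have s_lip: "L-lipschitz_on UNIV (s k)" for k
    unfolding s_def[abs_def] by (rule lipschitz_soft_threshold(1)[OF \<psi> \<epsilon>(2)])
  have s_grad: "AE x in lebesgue. grad (s k) x = (if \<epsilon> k < \<bar>\<psi> x\<bar> then grad \<psi> x else 0)" for k
    unfolding s_def[abs_def] by (rule lipschitz_soft_threshold(2)[OF \<psi> \<epsilon>(2)])
  have s_supp: "\<exists>K. compact K \<and> K \<subseteq> \<Omega> \<and> (\<forall>x. x \<notin> K \<longrightarrow> s k x = 0)" for k
  proof (intro exI conjI)
    have sub: "{x. \<epsilon> k \<le> \<bar>\<psi> x\<bar>} \<subseteq> \<Omega>" using off \<epsilon>(1)[of k] by force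
    show "{x. \<epsilon> k \<le> \<bar>\<psi> x\<bar>} \<subseteq> \<Omega>" by (rule sub)
    have "closed {x. \<epsilon> k \<le> \<bar>\<psi> x\<bar>}" by (intro closed_Collect_le continuous_intros c)
    then show "compact {x. \<epsilon> k \<le> \<bar>\<psi> x\<bar>}"
      using bounded_subset[OF \<Omega>(2) sub] by (simp add: compact_eq_bounded_closed)
    show "\<forall>x. x \<notin> {x. \<epsilon> k \<le> \<bar>\<psi> x\<bar>} \<longrightarrow> s k x = 0" by (auto simp: s_def soft_threshold_def)
  qed
  have sc: "continuous_on UNIV (s k)" for k by (rule lipschitz_on_continuous_on[OF s_lip])
  have [measurable]: "grad \<psi> \<in> borel_measurable ?M" "\<And>k. grad (s k) \<in> borel_measurable ?M"
    by (intro measurable_restrict_space1 grad_measurable[OF \<psi>] grad_measurable[OF s_lip])+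
  have 1: "(\<lambda>k. LINT x|?M. \<bar>\<psi> x - s k x\<bar> ^ n) \<longlonglongrightarrow> (LINT x|?M. 0)"
  proof (rule integral_dominated_convergence[where w="\<lambda>_. 1"])
    have cl: "\<bar>\<psi> x - s k x\<bar> \<le> \<epsilon> k" for k x
      using soft_threshold_close[OF \<epsilon>(2), of k "\<psi> x"] by (simp add: s_def abs_minus_commute)
    show "(\<lambda>x. \<bar>\<psi> x - s k x\<bar> ^ n) \<in> borel_measurable ?M" for k
      by (intro borel_measurable_lebesgue_on_continuous continuous_intros sc c)
    show "AE x in ?M. (\<lambda>k. \<bar>\<psi> x - s k x\<bar> ^ n) \<longlonglongrightarrow> 0"
    proof (rule AE_I2)
      fix x
      have "(\<lambda>k. \<psi> x - s k x) \<longlonglongrightarrow> 0"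
        by (rule Lim_null_comparison[OF _ l0]) (use cl in simp)
      then have "(\<lambda>k. \<bar>\<psi> x - s k x\<bar> ^ n) \<longlonglongrightarrow> \<bar>0\<bar> ^ n" by (intro tendsto_intros)
      then show "(\<lambda>k. \<bar>\<psi> x - s k x\<bar> ^ n) \<longlonglongrightarrow> 0" using n by (simp add: power_0_left)
    qed
    show "AE x in ?M. norm (\<bar>\<psi> x - s k x\<bar> ^ n) \<le> 1" for k
      using order_trans[OF cl \<epsilon>(3)] by (intro AE_I2) (simp add: power_le_one)
  qed auto
  have 2: "(\<lambda>k. LINT x|?M. norm (grad \<psi> x - grad (s k) x) ^ n) \<longlonglongrightarrow> (LINT x|?M. 0)"
  proof (rule integral_dominated_convergence[where w="\<lambda>_. L ^ n"])
    show "(\<lambda>x. norm (grad \<psi> x - grad (s k) x) ^ n) \<in> borel_measurable ?M" for k by measurable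
    have all: "AE x in lebesgue. \<forall>k. grad (s k) x = (if \<epsilon> k < \<bar>\<psi> x\<bar> then grad \<psi> x else 0)"
      by (intro AE_all_countable[THEN iffD2] allI s_grad)
    show "AE x in ?M. (\<lambda>k. norm (grad \<psi> x - grad (s k) x) ^ n) \<longlonglongrightarrow> 0"
    proof (rule AE_lebesgue_on[OF \<Omega>(1)])
      show "AE x in lebesgue. x \<in> \<Omega> \<longrightarrow> (\<lambda>k. norm (grad \<psi> x - grad (s k) x) ^ n) \<longlonglongrightarrow> 0"
        using all grad_zero_on_zero_set[OF \<psi>]
      proof eventually_elim
        case (elim x)
        show ?case
        proof (cases "\<psi> x = 0")
          case True
          then have "norm (grad \<psi> x - grad (s k) x) ^ n = 0" for k using elim n by (auto simp: power_0_left)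
          then show ?thesis by simp
        next
          case False
          then have "\<forall>\<^sub>F k in sequentially. \<epsilon> k < \<bar>\<psi> x\<bar>" by (intro order_tendstoD(2)[OF l0]) simp
          then have "\<forall>\<^sub>F k in sequentially. norm (grad \<psi> x - grad (s k) x) ^ n = 0"
            by eventually_elim (use elim n in \<open>simp add: power_0_left\<close>)
          then show ?thesis by (simp add: tendsto_eventually)
        qed
      qed
    qed
    show "AE x in ?M. norm (norm (grad \<psi> x - grad (s k) x) ^ n) \<le> L ^ n" for k
    proof (rule AE_lebesgue_on[OF \<Omega>(1)])
      show "AE x in lebesgue. x \<in> \<Omega> \<longrightarrow> norm (norm (grad \<psi> x - grad (s k) x) ^ n) \<le> L ^ n"
        using all grad_bound[OF \<psi>]
      proof eventually_elim
        case (elim x)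
        then have "norm (grad \<psi> x - grad (s k) x) \<le> L"
          using lipschitz_on_nonneg[OF \<psi>] by simp
        then show ?case by (simp add: power_mono)
      qed
    qed
  qed auto
  define e' where "e' = e / (2 * 2 ^ n)"
  have e': "0 < e'" using e by (simp add: e'_def)
  have "\<forall>\<^sub>F k in sequentially. (LINT x|?M. \<bar>\<psi> x - s k x\<bar> ^ n) < e'" using order_tendstoD(2)[OF 1] e' by simp
  moreover have "\<forall>\<^sub>F k in sequentially. (LINT x|?M. norm (grad \<psi> x - grad (s k) x) ^ n) < e'"
    using order_tendstoD(2)[OF 2] e' by simp
  ultimately have "\<forall>\<^sub>F k in sequentially. (LINT x|?M. \<bar>\<psi> x - s k x\<bar> ^ n) < e' \<and> (LINT x|?M. norm (grad \<psi> x - grad (s k) x) ^ n) < e'"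
    by (rule eventually_conj)
  then obtain k where k: "(LINT x|?M. \<bar>\<psi> x - s k x\<bar> ^ n) < e'" "(LINT x|?M. norm (grad \<psi> x - grad (s k) x) ^ n) < e'"
    using eventually_happens' sequentially_bot by blast
  obtain K where K: "compact K" "K \<subseteq> \<Omega>" "\<And>x. x \<notin> K \<Longrightarrow> s k x = 0" using s_supp[of k] by blast
  obtain \<phi> where \<phi>: "test_function \<Omega> \<phi>" "(LINT x|?M. \<bar>s k x - \<phi> x\<bar> ^ n) \<le> e'"
    "(LINT x|?M. norm (grad (s k) x - gradient \<phi> x) ^ n) \<le> e'"
    using test_function_approximation_compact_support[OF \<Omega> s_lip K n e'] by blast
  have Lp_val: "v \<in> Lp_space n \<Omega>" if "M-lipschitz_on UNIV v" for v :: "'a \<Rightarrow> real" and M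
    using lipschitz_in_W1p[OF \<Omega> that] by (simp add: W1p_def)
  have Lp_grad: "grad v \<in> Lp_space n \<Omega>" if "M-lipschitz_on UNIV v" for v :: "'a \<Rightarrow> real" and M
  proof (rule Lp_space_bounded[OF \<Omega>])
    show "grad v \<in> borel_measurable ?M" by (intro measurable_restrict_space1 grad_measurable[OF that])
    show "AE x in ?M. norm (grad v x) \<le> M"
      by (rule AE_lebesgue_on[OF \<Omega>(1)]) (use grad_bound[OF that] in eventually_elim, simp)
  qed
  have "(LINT x|?M. \<bar>\<psi> x - \<phi> x\<bar> ^ n) \<le> (LINT x|?M. 2 ^ n * (\<bar>\<psi> x - s k x\<bar> ^ n + \<bar>s k x - \<phi> x\<bar> ^ n))"
    using Lp_space_diff_integrable[OF Lp_val[OF \<psi>] test_function_Lp(1)[OF \<Omega> \<phi>(1)]]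
      Lp_space_diff_integrable[OF Lp_val[OF \<psi>] Lp_val[OF s_lip]]
      Lp_space_diff_integrable[OF Lp_val[OF s_lip] test_function_Lp(1)[OF \<Omega> \<phi>(1)]]
      norm_diff_power_le[of "\<psi> x" "\<phi> x" n "s k x" for x]
    by (intro integral_mono) auto
  also have "\<dots> = 2 ^ n * ((LINT x|?M. \<bar>\<psi> x - s k x\<bar> ^ n) + (LINT x|?M. \<bar>s k x - \<phi> x\<bar> ^ n))"
    using Lp_space_diff_integrable[OF Lp_val[OF \<psi>] Lp_val[OF s_lip]]
      Lp_space_diff_integrable[OF Lp_val[OF s_lip] test_function_Lp(1)[OF \<Omega> \<phi>(1)]] by simp
  also have "\<dots> \<le> 2 ^ n * (e' + e')" using k \<phi> by (intro mult_left_mono add_mono) auto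
  also have "\<dots> = e" by (simp add: e'_def)
  finally have A: "(LINT x|?M. \<bar>\<psi> x - \<phi> x\<bar> ^ n) \<le> e" .
  have "(LINT x|?M. norm (grad \<psi> x - gradient \<phi> x) ^ n) \<le>
    (LINT x|?M. 2 ^ n * (norm (grad \<psi> x - grad (s k) x) ^ n + norm (grad (s k) x - gradient \<phi> x) ^ n))"
    using Lp_space_diff_integrable[OF Lp_grad[OF \<psi>] test_function_Lp(2)[OF \<Omega> \<phi>(1)]]
      Lp_space_diff_integrable[OF Lp_grad[OF \<psi>] Lp_grad[OF s_lip]]
      Lp_space_diff_integrable[OF Lp_grad[OF s_lip] test_function_Lp(2)[OF \<Omega> \<phi>(1)]]
    by (intro integral_mono norm_diff_power_le) auto
  also have "\<dots> = 2 ^ n * ((LINT x|?M. norm (grad \<psi> x - grad (s k) x) ^ n) + (LINT x|?M. norm (grad (s k) x - gradient \<phi> x) ^ n))"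
    using Lp_space_diff_integrable[OF Lp_grad[OF \<psi>] Lp_grad[OF s_lip]]
      Lp_space_diff_integrable[OF Lp_grad[OF s_lip] test_function_Lp(2)[OF \<Omega> \<phi>(1)]] by simp
  also have "\<dots> \<le> 2 ^ n * (e' + e')" using k \<phi> by (intro mult_left_mono add_mono) auto
  also have "\<dots> = e" by (simp add: e'_def)
  finally show ?thesis using A \<phi>(1) by blast
qed

theorem lipschitz_zero_boundary_in_W1p_0:
  fixes \<psi> :: "'a::euclidean_space \<Rightarrow> real"
  assumes \<Omega>: "open \<Omega>" "bounded \<Omega>" and \<psi>: "L-lipschitz_on UNIV \<psi>" and off: "\<And>x. x \<notin> \<Omega> \<Longrightarrow> \<psi> x = 0"
    and n: "1 \<le> n"
  shows "\<psi> \<in> W1p_0 n \<Omega>"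
proof -
  let ?M = "lebesgue_on \<Omega>"
  have "\<exists>\<phi>. test_function \<Omega> \<phi> \<and> (LINT x|?M. \<bar>\<psi> x - \<phi> x\<bar> ^ n) \<le> 1 / (real k + 1) \<and>
    (LINT x|?M. norm (grad \<psi> x - gradient \<phi> x) ^ n) \<le> 1 / (real k + 1)" for k
    by (rule test_function_approximation[OF \<Omega> \<psi> off n]) auto
  then have "\<exists>\<phi>. \<forall>k. test_function \<Omega> (\<phi> k) \<and> (LINT x|?M. \<bar>\<psi> x - \<phi> k x\<bar> ^ n) \<le> 1 / (real k + 1) \<and>
    (LINT x|?M. norm (grad \<psi> x - gradient (\<phi> k) x) ^ n) \<le> 1 / (real k + 1)"
    by (intro choice allI)
  then obtain \<phi> where \<phi>: "\<And>k. test_function \<Omega> (\<phi> k)" "\<And>k. (LINT x|?M. \<bar>\<psi> x - \<phi> k x\<bar> ^ n) \<le> 1 / (real k + 1)"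
    "\<And>k. (LINT x|?M. norm (grad \<psi> x - gradient (\<phi> k) x) ^ n) \<le> 1 / (real k + 1)"
    by blast
  have l0: "(\<lambda>k. 1 / (real k + 1)) \<longlonglongrightarrow> 0"
    using LIMSEQ_inverse_real_of_nat by (simp add: inverse_eq_divide add.commute)
  have "(\<lambda>k. LINT x|?M. \<bar>\<psi> x - \<phi> k x\<bar> ^ n) \<longlonglongrightarrow> 0"
  proof (rule tendsto_sandwich[OF _ _ tendsto_const l0])
    show "\<forall>\<^sub>F k in sequentially. 0 \<le> (LINT x|?M. \<bar>\<psi> x - \<phi> k x\<bar> ^ n)"
      by (intro always_eventually allI integral_nonneg_AE AE_I2) simp
    show "\<forall>\<^sub>F k in sequentially. (LINT x|?M. \<bar>\<psi> x - \<phi> k x\<bar> ^ n) \<le> 1 / (real k + 1)"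
      by (intro always_eventually allI \<phi>(2))
  qed
  moreover have "(\<lambda>k. LINT x|?M. norm (weak_gradient \<Omega> \<psi> x - gradient (\<phi> k) x) ^ n) \<longlonglongrightarrow> 0"
  proof -
    have "(LINT x|?M. norm (weak_gradient \<Omega> \<psi> x - gradient (\<phi> k) x) ^ n) = (LINT x|?M. norm (grad \<psi> x - gradient (\<phi> k) x) ^ n)" for k
    proof (rule integral_cong_AE)
      have [measurable]: "weak_gradient \<Omega> \<psi> \<in> borel_measurable ?M" by (rule weak_gradient_AE_grad(3)[OF \<Omega>(1) \<psi>])
      have [measurable]: "grad \<psi> \<in> borel_measurable ?M" by (intro measurable_restrict_space1 grad_measurable[OF \<psi>])
      have [measurable]: "gradient (\<phi> k) \<in> borel_measurable ?M"
        by (intro borel_measurable_lebesgue_on_continuous test_functionD(3)[OF \<phi>(1)])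
      show "(\<lambda>x. norm (weak_gradient \<Omega> \<psi> x - gradient (\<phi> k) x) ^ n) \<in> borel_measurable ?M"
        "(\<lambda>x. norm (grad \<psi> x - gradient (\<phi> k) x) ^ n) \<in> borel_measurable ?M" by measurable
      show "AE x in ?M. norm (weak_gradient \<Omega> \<psi> x - gradient (\<phi> k) x) ^ n = norm (grad \<psi> x - gradient (\<phi> k) x) ^ n"
        using weak_gradient_AE_grad(1)[OF \<Omega>(1) \<psi>] by eventually_elim simp
    qed
    moreover have "(\<lambda>k. LINT x|?M. norm (grad \<psi> x - gradient (\<phi> k) x) ^ n) \<longlonglongrightarrow> 0"
    proof (rule tendsto_sandwich[OF _ _ tendsto_const l0])
    show "\<forall>\<^sub>F k in sequentially. 0 \<le> (LINT x|?M. norm (grad \<psi> x - gradient (\<phi> k) x) ^ n)"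
      by (intro always_eventually allI integral_nonneg_AE AE_I2) simp
    show "\<forall>\<^sub>F k in sequentially. (LINT x|?M. norm (grad \<psi> x - gradient (\<phi> k) x) ^ n) \<le> 1 / (real k + 1)"
      by (intro always_eventually allI \<phi>(3))
  qed
    ultimately show ?thesis by simp
  qed
  moreover have "\<forall>k. test_function \<Omega> (\<phi> k) \<and> (\<forall>x. GDERIV (\<phi> k) x :> gradient (\<phi> k) x)"
    using \<phi>(1) GDERIV_gradient[OF test_functionD(1)[OF \<phi>(1)]] by blast
  ultimately show ?thesis
    unfolding W1p_0_def using lipschitz_in_W1p[OF \<Omega> \<psi>]
    by (intro CollectI conjI exI[of _ \<phi>] exI[of _ "\<lambda>k. gradient (\<phi> k)"])
qed

section \<open>Energy densities\<close>

text \<open>The density of the energies is \<open>dens c (norm \<xi>)\<close> with \<open>c j = a (j + 2)\<close>, and \<open>flux c\<close> is its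
  gradient with respect to \<open>\<xi>\<close>.\<close>

definition dens :: "(nat \<Rightarrow> real) \<Rightarrow> real \<Rightarrow> real" where
  "dens c t = (\<Sum>j. c j / real (j + 2) * t ^ (j + 2))"

definition flux :: "(nat \<Rightarrow> real) \<Rightarrow> 'a::euclidean_space \<Rightarrow> 'a" where
  "flux c \<xi> = (\<Sum>j. c j * norm \<xi> ^ j) *\<^sub>R \<xi>"

lemma power_tangent_le:
  fixes r s :: real
  assumes "0 \<le> r" "0 \<le> s"
  shows "r ^ Suc p + real (Suc p) * r ^ p * (s - r) \<le> s ^ Suc p"
proof (induction p)
  case (Suc p)
  have "0 \<le> real (Suc p) * r ^ p * (s - r)\<^sup>2" using assms by simp
  moreover have "s * (r ^ Suc p + real (Suc p) * r ^ p * (s - r)) \<le> s * s ^ Suc p"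
    using Suc assms by (intro mult_left_mono) auto
  moreover have "r ^ Suc (Suc p) + real (Suc (Suc p)) * r ^ Suc p * (s - r) + real (Suc p) * r ^ p * (s - r)\<^sup>2
      = s * (r ^ Suc p + real (Suc p) * r ^ p * (s - r))"
    by (simp add: power2_eq_square algebra_simps)
  ultimately show ?case by (simp only: power_Suc[of s "Suc p"])
qed simp

lemma power_norm_convex:
  fixes \<xi> \<eta> :: "'a::euclidean_space"
  shows "norm \<xi> ^ (j + 2) / real (j + 2) + norm \<xi> ^ j * (\<xi> \<bullet> (\<eta> - \<xi>)) \<le> norm \<eta> ^ (j + 2) / real (j + 2)"
proof -
  have "\<xi> \<bullet> (\<eta> - \<xi>) \<le> norm \<xi> * (norm \<eta> - norm \<xi>)"
    using norm_cauchy_schwarz[of \<xi> \<eta>] by (simp add: inner_diff_right right_diff_distrib power2_norm_eq_inner[symmetric] power2_eq_square)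
  then have "norm \<xi> ^ j * (\<xi> \<bullet> (\<eta> - \<xi>)) \<le> norm \<xi> ^ j * (norm \<xi> * (norm \<eta> - norm \<xi>))"
    by (intro mult_left_mono) auto
  moreover have "norm \<xi> ^ (j + 2) + real (j + 2) * norm \<xi> ^ (j + 1) * (norm \<eta> - norm \<xi>) \<le> norm \<eta> ^ (j + 2)"
    using power_tangent_le[of "norm \<xi>" "norm \<eta>" "j + 1"] by simp
  then have "(norm \<xi> ^ (j + 2) + real (j + 2) * norm \<xi> ^ (j + 1) * (norm \<eta> - norm \<xi>)) / real (j + 2) \<le> norm \<eta> ^ (j + 2) / real (j + 2)"
    by (rule divide_right_mono) simp
  then have "norm \<xi> ^ (j + 2) / real (j + 2) + norm \<xi> ^ j * (norm \<xi> * (norm \<eta> - norm \<xi>)) \<le> norm \<eta> ^ (j + 2) / real (j + 2)"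
    by (simp add: add_divide_distrib mult_ac)
  ultimately show ?thesis by linarith
qed

lemma power_norm_convex_0:
  fixes \<xi> \<eta> :: "'a::euclidean_space"
  shows "norm \<xi> ^ 2 / 2 + \<xi> \<bullet> (\<eta> - \<xi>) + (norm (\<eta> - \<xi>))\<^sup>2 / 2 = norm \<eta> ^ 2 / 2"
  by (simp add: power2_norm_eq_inner inner_diff_left inner_diff_right inner_commute field_simps)

text \<open>The terms with \<open>j > 0\<close> are convex, and the one with \<open>j = 0\<close> is quadratic, so its second order
  remainder is exact.  Only the convergence of the series at the two vectors is assumed, since
  this is also applied at gradients that may reach the boundary of the disk of convergence.\<close>

lemma dens_convex:
  fixes \<xi> \<eta> :: "'a::euclidean_space"
  assumes c: "\<And>j. 0 \<le> c j"
    and \<xi>: "summable (\<lambda>j. c j / real (j + 2) * norm \<xi> ^ (j + 2))" "summable (\<lambda>j. c j * norm \<xi> ^ j)"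
    and \<eta>: "summable (\<lambda>j. c j / real (j + 2) * norm \<eta> ^ (j + 2))"
  shows "dens c (norm \<xi>) + flux c \<xi> \<bullet> (\<eta> - \<xi>) + c 0 / 2 * (norm (\<eta> - \<xi>))\<^sup>2 \<le> dens c (norm \<eta>)"
proof -
  let ?d = "\<lambda>j. if j = 0 then c 0 / 2 * (norm (\<eta> - \<xi>))\<^sup>2 else 0"
  have d: "?d sums (c 0 / 2 * (norm (\<eta> - \<xi>))\<^sup>2)" using sums_single[of 0 "\<lambda>_. c 0 / 2 * (norm (\<eta> - \<xi>))\<^sup>2"] by simp
  have f: "(\<lambda>j. c j * norm \<xi> ^ j * (\<xi> \<bullet> (\<eta> - \<xi>))) sums (flux c \<xi> \<bullet> (\<eta> - \<xi>))"
    using sums_mult2[OF summable_sums[OF \<xi>(2)], of "\<xi> \<bullet> (\<eta> - \<xi>)"] by (simp add: flux_def)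
  have "(\<lambda>j. c j / real (j + 2) * norm \<xi> ^ (j + 2) + c j * norm \<xi> ^ j * (\<xi> \<bullet> (\<eta> - \<xi>)) + ?d j) sums
      (dens c (norm \<xi>) + flux c \<xi> \<bullet> (\<eta> - \<xi>) + c 0 / 2 * (norm (\<eta> - \<xi>))\<^sup>2)"
    unfolding dens_def by (intro sums_add summable_sums[OF \<xi>(1)] f d)
  moreover have "(\<lambda>j. c j / real (j + 2) * norm \<eta> ^ (j + 2)) sums dens c (norm \<eta>)"
    unfolding dens_def by (rule summable_sums[OF \<eta>])
  moreover have "c j / real (j + 2) * norm \<xi> ^ (j + 2) + c j * norm \<xi> ^ j * (\<xi> \<bullet> (\<eta> - \<xi>)) + ?d j
      \<le> c j / real (j + 2) * norm \<eta> ^ (j + 2)" for j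
  proof (cases "j = 0")
    case True
    have "c 0 * (norm \<xi> ^ 2 / 2 + \<xi> \<bullet> (\<eta> - \<xi>) + (norm (\<eta> - \<xi>))\<^sup>2 / 2) = c 0 * (norm \<eta> ^ 2 / 2)"
      by (simp only: power_norm_convex_0)
    then show ?thesis using True by (simp add: algebra_simps power2_eq_square)
  next
    case False
    have "c j * (norm \<xi> ^ (j + 2) / real (j + 2) + norm \<xi> ^ j * (\<xi> \<bullet> (\<eta> - \<xi>))) \<le> c j * (norm \<eta> ^ (j + 2) / real (j + 2))"
      by (rule mult_left_mono[OF power_norm_convex c])
    then show ?thesis using False by (simp add: distrib_left mult.assoc)
  qed
  ultimately show ?thesis by (rule sums_le[rotated])
qed

lemma dens_summable:
  assumes c: "\<And>j. 0 \<le> c j" and R: "summable (\<lambda>j. c j * R ^ j)" and t: "0 \<le> t" "t \<le> R"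
  shows "summable (\<lambda>j. c j * t ^ j)" "summable (\<lambda>j. c j / real (j + 2) * t ^ (j + 2))"
proof -
  have 1: "c j * t ^ j \<le> c j * R ^ j" for j using c t by (intro mult_left_mono power_mono) auto
  show s: "summable (\<lambda>j. c j * t ^ j)"
    by (rule summable_comparison_test'[OF R, of 0]) (use 1 c t in \<open>simp add: abs_mult\<close>)
  show "summable (\<lambda>j. c j / real (j + 2) * t ^ (j + 2))"
  proof (rule summable_comparison_test'[of "\<lambda>j. t\<^sup>2 * (c j * t ^ j)" 0])
    show "summable (\<lambda>j. t\<^sup>2 * (c j * t ^ j))" by (rule summable_mult[OF s])
    fix j
    have "c j / real (j + 2) \<le> c j / 1" using c by (intro divide_left_mono) auto
    then have "c j / real (j + 2) * t ^ (j + 2) \<le> c j * t ^ (j + 2)" using t by (intro mult_right_mono) auto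
    then show "norm (c j / real (j + 2) * t ^ (j + 2)) \<le> t\<^sup>2 * (c j * t ^ j)"
      using c[of j] t by (simp add: abs_of_nonneg power2_eq_square mult_ac)
  qed
qed

lemma dens_mono:
  assumes c: "\<And>j. 0 \<le> c j" and R: "summable (\<lambda>j. c j * R ^ j)" and t: "0 \<le> s" "s \<le> t" "t \<le> R"
  shows "0 \<le> dens c s" "dens c s \<le> dens c t"
proof -
  note S = dens_summable(2)[OF c R]
  show "0 \<le> dens c s" unfolding dens_def using c t by (intro suminf_nonneg S) auto
  show "dens c s \<le> dens c t"
    unfolding dens_def using c t by (intro suminf_le S mult_left_mono power_mono) auto
qed

lemma flux_bound:
  fixes \<xi> :: "'a::euclidean_space"
  assumes c: "\<And>j. 0 \<le> c j" and R: "summable (\<lambda>j. c j * R ^ j)" and t: "norm \<xi> \<le> R"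
  shows "norm (flux c \<xi>) \<le> (\<Sum>j. c j * R ^ j) * R"
proof -
  have R0: "0 \<le> R" using t norm_ge_zero order_trans by blast
  have s: "0 \<le> (\<Sum>j. c j * norm \<xi> ^ j)"
    using c t by (intro suminf_nonneg dens_summable(1)[OF c R]) auto
  have "(\<Sum>j. c j * norm \<xi> ^ j) \<le> (\<Sum>j. c j * R ^ j)"
    using c t by (intro suminf_le dens_summable(1)[OF c R] R mult_left_mono power_mono) auto
  then show ?thesis
    unfolding flux_def norm_scaleR using s t R0 by (intro mult_mono) auto
qed

lemma isCont_dens:
  assumes R: "summable (\<lambda>j. c j * R ^ j)" and c: "\<And>j. 0 \<le> c j" and t: "\<bar>t\<bar> < R"
  shows "isCont (dens c) t"
proof -
  have s: "summable (\<lambda>j. c j / real (j + 2) * x ^ j)" if "\<bar>x\<bar> \<le> R" for x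
  proof (rule summable_comparison_test'[OF R, of 0])
    fix j
    have "\<bar>c j / real (j + 2)\<bar> * \<bar>x\<bar> ^ j \<le> c j * R ^ j"
    proof (rule mult_mono)
      have "c j / real (j + 2) \<le> c j / 1" using c by (intro divide_left_mono) auto
      then show "\<bar>c j / real (j + 2)\<bar> \<le> c j" using c[of j] by simp
      show "\<bar>x\<bar> ^ j \<le> R ^ j" using that by (intro power_mono) auto
    qed (use c in auto)
    then show "norm (c j / real (j + 2) * x ^ j) \<le> c j * R ^ j" by (simp add: abs_mult power_abs)
  qed
  have R0: "0 < R" using t by linarith
  have "isCont (\<lambda>x. \<Sum>j. c j / real (j + 2) * x ^ j) t"
    by (rule isCont_powser[of _ R]) (use s[of R] R0 t in auto)
  then have "isCont (\<lambda>x. x\<^sup>2 * (\<Sum>j. c j / real (j + 2) * x ^ j)) t" by (intro continuous_intros)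
  moreover have "\<forall>\<^sub>F x in nhds t. dens c x = x\<^sup>2 * (\<Sum>j. c j / real (j + 2) * x ^ j)"
  proof -
    have "\<forall>\<^sub>F x in nhds t. \<bar>x\<bar> < R"
      using t by (intro eventually_nhds_in_open[of "{x. \<bar>x\<bar> < R}" t, simplified])
        (auto intro!: open_Collect_less continuous_intros)
    then show ?thesis
    proof eventually_elim
      case (elim x)
      have "x\<^sup>2 * (\<Sum>j. c j / real (j + 2) * x ^ j) = (\<Sum>j. x\<^sup>2 * (c j / real (j + 2) * x ^ j))"
        by (rule suminf_mult[symmetric]) (use s[of x] elim in auto)
      also have "\<dots> = dens c x" unfolding dens_def
        by (intro suminf_cong) (simp add: power_add power2_eq_square)
      finally show ?case by simp
    qed
  qed
  ultimately show ?thesis by (simp only: isCont_cong)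
qed

lemma isCont_flux:
  fixes \<xi> :: "'a::euclidean_space"
  assumes R: "summable (\<lambda>j. c j * R ^ j)" and t: "norm \<xi> < R"
  shows "isCont (flux c) \<xi>"
proof -
  have R0: "0 < R" using t norm_ge_zero[of \<xi>] by linarith
  have "isCont (\<lambda>x. \<Sum>j. c j * x ^ j) (norm \<xi>)"
    by (rule isCont_powser[OF R]) (use R0 t in auto)
  then have "isCont (\<lambda>x. \<Sum>j. c j * norm x ^ j) \<xi>"
    by (rule isCont_o2[rotated]) (intro continuous_intros)
  then show ?thesis unfolding flux_def by (intro continuous_intros)
qed

lemma dens_measurable [measurable]: "dens c \<in> borel_measurable borel"
  unfolding dens_def by measurable

lemma flux_measurable [measurable]: "flux c \<in> borel_measurable borel"
  unfolding flux_def by measurable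

text \<open>Add the inequalities of \<open>dens_convex\<close> from the midpoint to both ends.\<close>

lemma dens_midpoint:
  fixes \<xi> \<eta> :: "'a::euclidean_space"
  assumes c: "\<And>j. 0 \<le> c j" and R: "summable (\<lambda>j. c j * R ^ j)" and le: "norm \<xi> \<le> R" "norm \<eta> \<le> R"
  shows "dens c (norm ((1/2) *\<^sub>R (\<xi> + \<eta>))) + c 0 / 8 * (norm (\<xi> - \<eta>))\<^sup>2 \<le> (dens c (norm \<xi>) + dens c (norm \<eta>)) / 2"
proof -
  let ?m = "(1/2) *\<^sub>R (\<xi> + \<eta>)"
  have m: "norm ?m \<le> R" using norm_triangle_ineq[of \<xi> \<eta>] le by simp
  note S = dens_summable[OF c R norm_ge_zero]
  have d1: "\<xi> - ?m = (1/2) *\<^sub>R (\<xi> - \<eta>)" by (simp add: algebra_simps scaleR_2[symmetric] flip: scaleR_add_left)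
  have d2: "\<eta> - ?m = - ((1/2) *\<^sub>R (\<xi> - \<eta>))" by (simp add: algebra_simps scaleR_2[symmetric] flip: scaleR_add_left)
  have n1: "(norm (\<xi> - ?m))\<^sup>2 = (norm (\<xi> - \<eta>))\<^sup>2 / 4" unfolding d1 by (simp add: power2_eq_square)
  have n2: "(norm (\<eta> - ?m))\<^sup>2 = (norm (\<xi> - \<eta>))\<^sup>2 / 4" unfolding d2 by (simp add: power2_eq_square)
  have i: "flux c ?m \<bullet> (\<xi> - ?m) + flux c ?m \<bullet> (\<eta> - ?m) = 0" unfolding d1 d2 by simp
  have "dens c (norm ?m) + flux c ?m \<bullet> (\<xi> - ?m) + c 0 / 2 * (norm (\<xi> - ?m))\<^sup>2 \<le> dens c (norm \<xi>)"
    by (rule dens_convex[OF c]) (use S m le in blast)+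
  moreover have "dens c (norm ?m) + flux c ?m \<bullet> (\<eta> - ?m) + c 0 / 2 * (norm (\<eta> - ?m))\<^sup>2 \<le> dens c (norm \<eta>)"
    by (rule dens_convex[OF c]) (use S m le in blast)+
  ultimately show ?thesis using i unfolding n1 n2 by (simp add: field_simps)
qed

section \<open>Existence of minimizers among Lipschitz functions\<close>

text \<open>Both \<open>\<psi>\<close> and \<open>0\<close> lie in \<open>W1p_0\<close>, where the gradient determines the function; continuity
  removes the exceptional null set.\<close>

lemma lipschitz_zero_gradient:
  fixes \<psi> :: "'a::euclidean_space \<Rightarrow> real"
  assumes \<Omega>: "open \<Omega>" "bounded \<Omega>" and \<psi>: "L-lipschitz_on UNIV \<psi>" and off: "\<And>x. x \<notin> \<Omega> \<Longrightarrow> \<psi> x = 0"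
    and zero: "AE x in lebesgue_on \<Omega>. grad \<psi> x = 0"
  shows "\<psi> x = 0"
proof -
  have 0: "0-lipschitz_on UNIV (\<lambda>_::'a. 0::real)" by (auto simp: lipschitz_on_def)
  have "AE x in lebesgue. grad (\<lambda>_::'a. 0::real) x = 0"
    using grad_zero_on_zero_set[OF 0] by simp
  then have g0: "AE x in lebesgue_on \<Omega>. grad (\<lambda>_::'a. 0::real) x = 0"
    by (intro AE_lebesgue_on[OF \<Omega>(1)]) auto
  have "AE x in lebesgue_on \<Omega>. \<psi> x = 0"
  proof (rule W1p_0_eqI[OF \<Omega>, of 2])
    show "\<psi> \<in> W1p_0 2 \<Omega>" "(\<lambda>_. 0) \<in> W1p_0 2 \<Omega>"
      by (rule lipschitz_zero_boundary_in_W1p_0[OF \<Omega>]; use \<psi> 0 off in auto)+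
    show "AE x in lebesgue_on \<Omega>. weak_gradient \<Omega> \<psi> x = weak_gradient \<Omega> (\<lambda>_. 0) x"
      using weak_gradient_AE_grad(1)[OF \<Omega>(1) \<psi>] weak_gradient_AE_grad(1)[OF \<Omega>(1) 0] zero g0
      by eventually_elim simp
  qed simp
  then have "AE x in lebesgue. x \<in> \<Omega> \<longrightarrow> \<psi> x = 0" by (rule AE_lebesgue_onD[OF \<Omega>(1)])
  then have ae: "AE x in lebesgue. x \<notin> {x. \<psi> x \<noteq> 0}"
    by eventually_elim (use off in blast)
  have op: "open {x. \<psi> x \<noteq> 0}"
    by (intro open_Collect_neq continuous_intros lipschitz_on_continuous_on[OF \<psi>])
  have "{x. \<psi> x \<noteq> 0} \<in> null_sets lebesgue"
    using ae op by (subst AE_iff_null_sets) auto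
  then have "{x. \<psi> x \<noteq> 0} = {}" using open_not_negligible[OF op] by (auto simp: negligible_iff_null_sets)
  then show ?thesis by blast
qed

text \<open>Inherited from the smooth approximations, whose supports stay in a fixed ball.\<close>

lemma integral_grad_zero:
  fixes p :: "'a::euclidean_space \<Rightarrow> real"
  assumes p: "L-lipschitz_on UNIV p" and S: "bounded S" "\<And>x. x \<notin> S \<Longrightarrow> p x = 0"
  shows "(LINT x|lebesgue. grad p x) = 0"
proof -
  obtain R where R: "S \<subseteq> cball 0 R" using S(1) by (metis ball_subset_cball bounded_subset_ballD order_trans)
  have L: "0 \<le> L" using lipschitz_on_nonneg[OF p] .
  obtain r where r: "\<And>n. r n \<in> mollifiers (1 / (real n + 1))"
    and lim: "AE x in lebesgue. (\<lambda>n. gradient (conv p (r n)) x) \<longlonglongrightarrow> grad p x"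
    by (rule lipschitz_smooth_approximation_grad[OF p]) (rule that)
  define s where "s n = conv p (r n)" for n
  have sm: "smooth (s n)" for n unfolding s_def by (rule smooth_mollify[OF p r])
  have s0: "s n x = 0" if "x \<notin> cball 0 (R + 1)" for n x
    unfolding s_def
  proof (rule mollify_zero[OF p r])
    fix y assume y: "dist x y \<le> 1 / (real n + 1)"
    have "1 / (real n + 1) \<le> 1" by simp
    then have "norm (x - y) \<le> 1" using y unfolding dist_norm by linarith
    moreover have "R + 1 < norm x" using that by simp
    moreover have "norm x \<le> norm (x - y) + norm y" using norm_triangle_ineq[of "x - y" y] by simp
    ultimately have "R < norm y" by linarith
    then show "p y = 0" using R by (intro S(2)) auto
  qed
  have g0: "gradient (s n) x = 0" if "x \<notin> cball 0 (R + 1)" for n x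
    by (rule GDERIV_zero_off_support[OF GDERIV_gradient[OF sm], of "- cball 0 (R + 1)"])
      (use that s0 in auto)
  have z: "(LINT x|lebesgue. gradient (s n) x) = 0" for n
    by (rule integral_gradient_zero[OF GDERIV_gradient[OF sm] smooth_continuous_gradient[OF sm] bounded_cball s0])
  have "(\<lambda>n. LINT x|lebesgue. gradient (s n) x) \<longlonglongrightarrow> (LINT x|lebesgue. grad p x)"
  proof (rule integral_dominated_convergence[where w="\<lambda>x. L * indicator (cball 0 (R + 1)) x"])
    show "integrable lebesgue (\<lambda>x::'a. L * indicator (cball 0 (R + 1)) x)"
    proof (rule integrable_bounded_support[of _ "cball 0 (R + 1)" L])
      show "(\<lambda>x::'a. L * indicator (cball 0 (R + 1)) x) \<in> borel_measurable lebesgue"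
        by (intro borel_measurable_times borel_measurable_indicator) auto
    qed (use L in \<open>auto simp: indicator_def\<close>)
    show "AE x in lebesgue. norm (gradient (s n) x) \<le> L * indicator (cball 0 (R + 1)) x" for n
    proof (rule AE_I2)
      fix x
      show "norm (gradient (s n) x) \<le> L * indicator (cball 0 (R + 1)) x"
        using mollify_gradient_bound[OF p r, of n x] g0[of x n]
        by (cases "x \<in> cball 0 (R + 1)") (auto simp: s_def)
    qed
    show "AE x in lebesgue. (\<lambda>n. gradient (s n) x) \<longlonglongrightarrow> grad p x" unfolding s_def by (rule lim)
    show "gradient (s n) \<in> borel_measurable lebesgue" for n
      by (rule continuous_borel_measurable_lebesgue[OF smooth_continuous_gradient[OF sm]])
  qed (rule grad_measurable[OF p])
  then show ?thesis using z by (simp add: LIMSEQ_const_iff)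
qed

lemma frontier_point_between:
  fixes x y :: "'a::euclidean_space"
  assumes "x \<in> \<Omega>" "y \<notin> \<Omega>"
  obtains z where "z \<in> frontier \<Omega>" "dist x z + dist z y = dist x y"
proof -
  have "closed_segment x y \<inter> frontier \<Omega> \<noteq> {}"
    using assms by (intro connected_Int_frontier) auto
  then obtain z where "z \<in> closed_segment x y" "z \<in> frontier \<Omega>" by blast
  then show ?thesis using that[of z] between[of x y z] by (simp add: between_mem_segment)
qed

text \<open>A segment leaving \<open>\<Omega>\<close> crosses the frontier, where both functions agree.\<close>

lemma lipschitz_glue:
  fixes v h :: "'a::euclidean_space \<Rightarrow> real"
  assumes v: "M-lipschitz_on (closure \<Omega>) v" and h: "M-lipschitz_on UNIV h"
    and eq: "\<And>z. z \<in> frontier \<Omega> \<Longrightarrow> v z = h z"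
  shows "M-lipschitz_on UNIV (\<lambda>x. if x \<in> \<Omega> then v x else h x)"
proof (rule lipschitz_onI)
  have M: "0 \<le> M" using lipschitz_on_nonneg[OF h] .
  then show "0 \<le> M" .
  have sub: "x \<in> closure \<Omega>" if "x \<in> \<Omega>" for x using that closure_subset by blast
  have mixed: "dist (v x) (h y) \<le> M * dist x y" if xy: "x \<in> \<Omega>" "y \<notin> \<Omega>" for x y
  proof -
    obtain z where z: "z \<in> frontier \<Omega>" "dist x z + dist z y = dist x y" using frontier_point_between[OF xy] .
    have "dist (v x) (v z) \<le> M * dist x z"
      using z(1) xy(1) sub by (intro lipschitz_onD[OF v]) (auto simp: frontier_def)
    moreover have "dist (h z) (h y) \<le> M * dist z y" by (intro lipschitz_onD[OF h]) auto
    ultimately have "dist (v x) (h y) \<le> M * dist x z + M * dist z y"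
      using dist_triangle[of "v x" "h y" "h z"] unfolding eq[OF z(1)] by linarith
    then show ?thesis using z(2) by (simp add: distrib_left[symmetric])
  qed
  fix x y
  show "dist (if x \<in> \<Omega> then v x else h x) (if y \<in> \<Omega> then v y else h y) \<le> M * dist x y"
    using mixed[of x y] mixed[of y x] lipschitz_onD[OF v sub sub, of x y] lipschitz_onD[OF h UNIV_I UNIV_I, of x y]
    by (cases "x \<in> \<Omega>"; cases "y \<in> \<Omega>") (auto simp: dist_commute)
qed

lemma lipschitz_min_max:
  fixes v w :: "'a::metric_space \<Rightarrow> real"
  assumes "M-lipschitz_on S v" "M-lipschitz_on S w"
  shows "M-lipschitz_on S (\<lambda>x. min (v x) (w x))" "M-lipschitz_on S (\<lambda>x. max (v x) (w x))"
proof -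
  have *: "\<bar>v x - v y\<bar> \<le> M * dist x y" "\<bar>w x - w y\<bar> \<le> M * dist x y" if "x \<in> S" "y \<in> S" for x y
    using assms that by (auto simp: lipschitz_on_def dist_real_def)
  show "M-lipschitz_on S (\<lambda>x. min (v x) (w x))" "M-lipschitz_on S (\<lambda>x. max (v x) (w x))"
    using lipschitz_on_nonneg[OF assms(1)]
    by (auto intro!: lipschitz_onI simp: dist_real_def min_def max_def) (use * in fastforce)+
qed

lemma affine_lipschitz:
  fixes b :: "'a::euclidean_space"
  assumes "norm b \<le> K"
  shows "K-lipschitz_on S (\<lambda>x. b \<bullet> x + d)"
proof (rule lipschitz_onI)
  fix x y
  have "\<bar>b \<bullet> (x - y)\<bar> \<le> norm b * norm (x - y)" by (rule Cauchy_Schwarz_ineq2)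
  also have "\<dots> \<le> K * norm (x - y)" using assms by (intro mult_right_mono) auto
  finally show "dist (b \<bullet> x + d) (b \<bullet> y + d) \<le> K * dist x y" by (simp add: dist_norm inner_diff_right)
qed (use assms norm_ge_zero[of b] in linarith)

text \<open>Here \<open>h\<close> is the extended boundary datum and \<open>K'\<close> the constraint imposed on slopes.  It is kept
  strictly between \<open>K\<close> and \<open>R\<close>: the gap above \<open>K\<close> leaves room for variations of the minimizer, the gap
  below \<open>R\<close> makes the density continuous up to \<open>K'\<close>.  Admissible functions are defined on the whole
  space so that they can be translated.\<close>

locale dirichlet_problem =
  fixes \<Omega> :: "'a::euclidean_space set" and c :: "nat \<Rightarrow> real" and K K' R :: real and h :: "'a \<Rightarrow> real"
  assumes \<Omega>: "open \<Omega>" "bounded \<Omega>"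
    and c: "\<And>j. 0 \<le> c j" "0 < c 0"
    and K: "0 \<le> K" "K < K'" "K' < R"
    and R: "summable (\<lambda>j. c j * R ^ j)"
    and h: "K-lipschitz_on UNIV h"
    and bsc: "bounded_slope \<Omega> h K"
begin

abbreviation "M \<equiv> lebesgue_on \<Omega>"

definition admissible :: "('a \<Rightarrow> real) set" where
  "admissible = {v. K'-lipschitz_on UNIV v \<and> (\<forall>x. x \<notin> \<Omega> \<longrightarrow> v x = h x)}"

definition E :: "('a \<Rightarrow> real) \<Rightarrow> real" where
  "E v = (LINT x|M. dens c (norm (grad v x)))"

sublocale finite_measure M by (rule finite_measure_lebesgue_on_bounded_open[OF \<Omega>])

lemma admissibleD:
  assumes "v \<in> admissible"
  shows "K'-lipschitz_on UNIV v" "x \<notin> \<Omega> \<Longrightarrow> v x = h x"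
  using assms by (auto simp: admissible_def)

lemma AE_M: "AE x in lebesgue. P x \<Longrightarrow> AE x in M. P x"
  by (rule AE_lebesgue_on[OF \<Omega>(1)]) auto

lemma grad_measurable_M:
  "L-lipschitz_on UNIV v \<Longrightarrow> grad v \<in> borel_measurable M"
  by (intro measurable_restrict_space1 grad_measurable)

lemma summable_K': "summable (\<lambda>j. c j * K' ^ j)"
  by (rule dens_summable(1)[OF c(1) R]) (use K in auto)

lemma integrable_dens:
  assumes V: "V \<in> borel_measurable M" "AE x in M. norm (V x) \<le> K'"
  shows "integrable M (\<lambda>x. dens c (norm (V x)))"
proof (rule integrable_const_bound)
  show "AE x in M. norm (dens c (norm (V x))) \<le> dens c K'"
    using V(2)
  proof eventually_elim
    case (elim x)
    then show ?case using dens_mono[OF c(1) summable_K' norm_ge_zero elim] by simp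
  qed
  show "(\<lambda>x. dens c (norm (V x))) \<in> borel_measurable M" using V(1) by measurable
qed

lemma integrable_dens_admissible:
  assumes "v \<in> admissible"
  shows "integrable M (\<lambda>x. dens c (norm (grad v x)))"
  using admissibleD(1)[OF assms] by (intro integrable_dens grad_measurable_M AE_M grad_bound)

lemma E_nonneg: "0 \<le> E v" if "v \<in> admissible"
  unfolding E_def
proof (rule integral_nonneg_AE)
  have "AE x in M. norm (grad v x) \<le> K'" by (intro AE_M grad_bound admissibleD(1)[OF that])
  then show "AE x in M. 0 \<le> dens c (norm (grad v x))"
  proof eventually_elim
    case (elim x)
    then show ?case using dens_mono(1)[OF c(1) summable_K' norm_ge_zero elim] by simp
  qed
qed

lemma integrable_norm_sq:
  fixes V :: "'a \<Rightarrow> 'a"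
  assumes "V \<in> borel_measurable M" "AE x in M. norm (V x) \<le> B"
  shows "integrable M (\<lambda>x. (norm (V x))\<^sup>2)"
proof (rule integrable_const_bound[of _ "B\<^sup>2"])
  show "AE x in M. norm ((norm (V x))\<^sup>2) \<le> B\<^sup>2"
    using assms(2) by eventually_elim (simp add: power_mono)
qed (use assms(1) in measurable)

text \<open>Uniform convexity of the energy, inherited from \<open>dens_midpoint\<close>.\<close>

lemma admissible_midpoint:
  assumes v: "v \<in> admissible" and w: "w \<in> admissible"
  shows "(\<lambda>x. (1/2) * (v x + w x)) \<in> admissible"
    and "E (\<lambda>x. (1/2) * (v x + w x)) + c 0 / 8 * (LINT x|M. (norm (grad v x - grad w x))\<^sup>2) \<le> (E v + E w) / 2"
proof -
  let ?m = "\<lambda>x. (1/2) * (v x + w x)"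
  note vl = admissibleD(1)[OF v] and wl = admissibleD(1)[OF w]
  have "\<bar>?m x - ?m y\<bar> \<le> K' * dist x y" for x y
    using lipschitz_onD[OF vl, of x y] lipschitz_onD[OF wl, of x y] by (simp add: dist_real_def abs_le_iff field_simps)
  then have "K'-lipschitz_on UNIV ?m"
    using lipschitz_on_nonneg[OF vl] by (intro lipschitz_onI) (auto simp: dist_real_def)
  then show adm: "?m \<in> admissible" using admissibleD(2)[OF v] admissibleD(2)[OF w] by (auto simp: admissible_def)
  have s: "(K' + K')-lipschitz_on UNIV (\<lambda>x. v x + w x)" by (rule lipschitz_on_add[OF vl wl])
  have g: "AE x in M. grad ?m x = (1/2) *\<^sub>R (grad v x + grad w x)"
  proof (rule AE_M)
    show "AE x in lebesgue. grad ?m x = (1/2) *\<^sub>R (grad v x + grad w x)"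
      using grad_cmult[OF s, of "1/2"] grad_add[OF vl wl] by eventually_elim simp
  qed
  have bv: "AE x in M. norm (grad v x) \<le> K'" and bw: "AE x in M. norm (grad w x) \<le> K'"
    by (intro AE_M grad_bound vl wl)+
  have [measurable]: "grad v \<in> borel_measurable M" "grad w \<in> borel_measurable M"
    by (rule grad_measurable_M[OF vl] grad_measurable_M[OF wl])+
  have bd: "AE x in M. norm (grad v x - grad w x) \<le> K' + K'"
    using bv bw by eventually_elim (metis add_mono norm_triangle_ineq4 order_trans)
  have sq: "integrable M (\<lambda>x. (norm (grad v x - grad w x))\<^sup>2)"
    by (rule integrable_norm_sq[OF _ bd]) measurable
  note i = integrable_dens_admissible[OF v] integrable_dens_admissible[OF w] integrable_dens_admissible[OF adm]
  have "(LINT x|M. dens c (norm (grad ?m x)) + c 0 / 8 * (norm (grad v x - grad w x))\<^sup>2) \<le>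
      (LINT x|M. (dens c (norm (grad v x)) + dens c (norm (grad w x))) / 2)"
  proof (rule integral_mono_AE)
    show "AE x in M. dens c (norm (grad ?m x)) + c 0 / 8 * (norm (grad v x - grad w x))\<^sup>2
        \<le> (dens c (norm (grad v x)) + dens c (norm (grad w x))) / 2"
      using g bv bw
    proof eventually_elim
      case (elim x)
      show ?case unfolding elim(1) by (rule dens_midpoint[OF c(1) summable_K' elim(2,3)])
    qed
  qed (use i sq in auto)
  then show "E ?m + c 0 / 8 * (LINT x|M. (norm (grad v x - grad w x))\<^sup>2) \<le> (E v + E w) / 2"
    using i sq by (simp add: E_def)
qed

lemma h_admissible: "h \<in> admissible"
  using h K by (auto simp: admissible_def intro: lipschitz_on_le)

lemma admissible_close:
  assumes "v \<in> admissible"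
  obtains B where "0 \<le> B" "\<And>x v. v \<in> admissible \<Longrightarrow> \<bar>v x\<bar> \<le> \<bar>h x\<bar> + B"
proof (cases "\<Omega> = {}")
  case True
  then show ?thesis using that[of 0] admissibleD(2) by auto
next
  case False
  obtain R0 where R0: "0 < R0" "\<Omega> \<subseteq> ball 0 R0" using \<Omega>(2) bounded_subset_ballD by blast
  obtain e :: 'a where e: "e \<in> Basis" using nonempty_Basis by blast
  let ?q = "R0 *\<^sub>R e"
  have q: "?q \<notin> \<Omega>" "norm ?q = R0" using R0 e by auto
  have "\<bar>v x\<bar> \<le> \<bar>h x\<bar> + 4 * K' * R0" if v: "v \<in> admissible" for v x
  proof (cases "x \<in> \<Omega>")
    case True
    have d: "dist x ?q \<le> 2 * R0"
    proof -
      have "norm x < R0" using True R0(2) by auto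
      then show ?thesis using q(2) norm_triangle_ineq4[of x ?q] by (simp add: dist_norm)
    qed
    then have dK: "K' * dist x ?q \<le> 2 * K' * R0" using K by (simp add: mult.assoc mult_left_mono mult.left_commute[of 2])
    have "\<bar>v x - v ?q\<bar> \<le> K' * dist x ?q" using lipschitz_onD[OF admissibleD(1)[OF v], of x ?q] by (simp add: dist_real_def)
    moreover have "\<bar>h x - h ?q\<bar> \<le> K' * dist x ?q" using lipschitz_onD[OF admissibleD(1)[OF h_admissible], of x ?q] by (simp add: dist_real_def)
    moreover have "v ?q = h ?q" by (rule admissibleD(2)[OF v q(1)])
    ultimately show ?thesis using dK by linarith
  next
    case False
    then show ?thesis using admissibleD(2)[OF v] K R0(1) by simp
  qed
  then show ?thesis using that[of "4 * K' * R0"] K R0(1) by simp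
qed

text \<open>By compactness a subsequence of a minimizing sequence converges uniformly, and by uniform convexity the
  gradients are Cauchy in \<open>L\<^sup>2\<close>, so along a further subsequence they converge almost everywhere.  The
  energies then converge by dominated convergence.\<close>

theorem minimizer_exists:
  obtains w where "w \<in> admissible" "\<And>v. v \<in> admissible \<Longrightarrow> E w \<le> E v"
proof -
  define m where "m = Inf (E ` admissible)"
  have bdd: "bdd_below (E ` admissible)" using E_nonneg by (auto intro!: bdd_belowI[of _ 0])
  have m_le: "m \<le> E v" if "v \<in> admissible" for v unfolding m_def using that bdd by (intro cInf_lower) auto
  have "\<exists>v. v \<in> admissible \<and> E v \<le> m + 1 / (real k + 1)" for k
  proof -
    have "Inf (E ` admissible) < m + 1 / (real k + 1)" by (simp add: m_def)
    then show ?thesis using cInf_lessD[of "E ` admissible"] h_admissible by fastforce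
  qed
  then have "\<exists>u. \<forall>k. u k \<in> admissible \<and> E (u k) \<le> m + 1 / (real k + 1)" by (intro choice allI)
  then obtain u where u: "\<And>k. u k \<in> admissible" "\<And>k. E (u k) \<le> m + 1 / (real k + 1)" by blast
  note ul = admissibleD(1)[OF u(1)]
  obtain B where B: "0 \<le> B" "\<And>x v. v \<in> admissible \<Longrightarrow> \<bar>v x\<bar> \<le> \<bar>h x\<bar> + B"
    using admissible_close[OF h_admissible] by blast
  obtain w0 k where k: "strict_mono (k::nat \<Rightarrow> nat)"
    and lim0: "\<And>x. x \<in> closure \<Omega> \<Longrightarrow> (\<lambda>n. u (k n) x) \<longlonglongrightarrow> w0 x"
  proof -
    have cpt: "compact (closure \<Omega>)" using \<Omega>(2) by simp
    obtain B0 where B0: "\<And>x. x \<in> closure \<Omega> \<Longrightarrow> \<bar>h x\<bar> \<le> B0"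
      by (rule lipschitz_bounded_on_bounded[OF h bounded_closure[OF \<Omega>(2)]]) (rule that)
    obtain w0 k where "continuous_on (closure \<Omega>) w0" "strict_mono (k::nat \<Rightarrow> nat)"
      "\<And>e. 0 < e \<Longrightarrow> \<exists>N. \<forall>n x. n \<ge> N \<and> x \<in> closure \<Omega> \<longrightarrow> norm (u (k n) x - w0 x) < e"
    proof (rule Arzela_Ascoli[OF cpt, of u "B0 + B"])
      show "norm (u n x) \<le> B0 + B" if "x \<in> closure \<Omega>" for n x
        using B(2)[OF u(1), of n x] B0[OF that] by simp
      show "\<exists>d>0. \<forall>n y. y \<in> closure \<Omega> \<and> norm (x - y) < d \<longrightarrow> norm (u n x - u n y) < e"
        if "x \<in> closure \<Omega>" "0 < e" for x e
      proof (intro exI[of _ "e / K'"] conjI allI impI)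
        show "0 < e / K'" using that K by simp
        fix n y assume "y \<in> closure \<Omega> \<and> norm (x - y) < e / K'"
        then have "K' * dist x y < e" using K by (simp add: dist_norm field_simps)
        then show "norm (u n x - u n y) < e" using lipschitz_onD[OF ul, of x y n] by (simp add: dist_norm)
      qed
    qed auto
    then show ?thesis using that[of k w0] by (metis LIMSEQ_I)
  qed
  define w where "w x = (if x \<in> \<Omega> then w0 x else h x)" for x
  have limw: "(\<lambda>n. u (k n) x) \<longlonglongrightarrow> w x" for x
    using lim0[of x] admissibleD(2)[OF u(1)] closure_subset[of \<Omega>] by (cases "x \<in> \<Omega>") (auto simp: w_def)
  have wl: "K'-lipschitz_on UNIV w"
  proof (rule lipschitz_onI)
    fix x y
    have "(\<lambda>n. dist (u (k n) x) (u (k n) y)) \<longlonglongrightarrow> dist (w x) (w y)" by (intro tendsto_dist limw)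
    then show "dist (w x) (w y) \<le> K' * dist x y"
      by (rule Lim_bounded[of _ _ 0]) (intro allI impI lipschitz_onD[OF ul]; simp)
  qed (use K in linarith)
  have w_adm: "w \<in> admissible" using wl by (auto simp: admissible_def w_def)
  let ?g = "\<lambda>n. grad (u (k n))"
  have gm: "?g n \<in> borel_measurable M" for n by (rule grad_measurable_M[OF ul])
  have gb: "AE x in M. norm (?g n x) \<le> K'" for n by (intro AE_M grad_bound[OF ul])
  have Cauchy: "\<exists>N. \<forall>i\<ge>N. \<forall>j\<ge>N. (\<integral>\<^sup>+x. ennreal ((norm (?g i x - ?g j x))\<^sup>2) \<partial>M) \<le> ennreal e" if e: "0 < e" for e
  proof -
    obtain N where N: "8 / (c 0 * e) < real N" using reals_Archimedean2 by blast
    have "(\<integral>\<^sup>+x. ennreal ((norm (?g i x - ?g j x))\<^sup>2) \<partial>M) \<le> ennreal e" if ij: "N \<le> i" "N \<le> j" for i j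
    proof -
      have small: "1 / (real (k i) + 1) \<le> c 0 * e / 8" if "N \<le> i" for i
      proof -
        have "8 / (c 0 * e) \<le> real (k i) + 1" using N that seq_suble[OF k, of i] by linarith
        then show ?thesis using c(2) e by (simp add: field_simps)
      qed
      note mid = admissible_midpoint[OF u(1) u(1), of "k i" "k j"]
      have "m + c 0 / 8 * (LINT x|M. (norm (?g i x - ?g j x))\<^sup>2) \<le> (E (u (k i)) + E (u (k j))) / 2"
        using mid(2) m_le[OF mid(1)] by linarith
      also have "\<dots> \<le> m + c 0 * e / 8"
        using u(2)[of "k i"] u(2)[of "k j"] small[OF ij(1)] small[OF ij(2)] by argo
      finally have "c 0 / 8 * (LINT x|M. (norm (?g i x - ?g j x))\<^sup>2) \<le> c 0 / 8 * e" by simp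
      then have le: "(LINT x|M. (norm (?g i x - ?g j x))\<^sup>2) \<le> e" using c(2) by simp
      have bd: "AE x in M. norm (?g i x - ?g j x) \<le> K' + K'"
        using gb[of i] gb[of j] by eventually_elim (metis add_mono norm_triangle_ineq4 order_trans)
      have "integrable M (\<lambda>x. (norm (?g i x - ?g j x))\<^sup>2)"
        by (rule integrable_norm_sq[OF borel_measurable_diff[OF gm gm] bd])
      then have "(\<integral>\<^sup>+x. ennreal ((norm (?g i x - ?g j x))\<^sup>2) \<partial>M) = ennreal (LINT x|M. (norm (?g i x - ?g j x))\<^sup>2)"
        by (intro nn_integral_eq_integral) auto
      then show ?thesis using le by (simp add: ennreal_leI)
    qed
    then show ?thesis by blast
  qed
  obtain r where r: "strict_mono r" "AE x in M. convergent (\<lambda>n. ?g (r n) x)"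
    by (rule L2_Cauchy_imp_AE_convergent_subseq[OF gm Cauchy])
  have lim_g: "AE x in M. (\<lambda>n. ?g (r n) x) \<longlonglongrightarrow> grad w x"
  proof -
    \<comment> \<open>the limit of the gradients is needed on the whole space, to be recognized as a weak gradient\<close>
    have off: "AE x in lebesgue. x \<notin> \<Omega> \<longrightarrow> (\<forall>n. ?g (r n) x = grad h x)"
    proof -
      have "AE x in lebesgue. x \<notin> \<Omega> \<longrightarrow> ?g (r n) x = grad h x" for n
        using grad_zero_on_zero_set[OF lipschitz_on_diff[OF ul[of "k (r n)"] h]] grad_diff[OF ul[of "k (r n)"] h]
        by eventually_elim (use admissibleD(2)[OF u(1)] in auto)
      then have "AE x in lebesgue. \<forall>n. x \<notin> \<Omega> \<longrightarrow> ?g (r n) x = grad h x"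
        by (intro AE_all_countable[THEN iffD2] allI)
      then show ?thesis by eventually_elim blast
    qed
    have conv: "AE x in lebesgue. convergent (\<lambda>n. ?g (r n) x)"
      using off AE_lebesgue_onD[OF \<Omega>(1) r(2)]
    proof eventually_elim
      case (elim x)
      then show ?case by (cases "x \<in> \<Omega>") (auto simp: convergent_const)
    qed
    define V where "V x = lim (\<lambda>n. ?g (r n) x)" for x
    have Vlim: "AE x in lebesgue. (\<lambda>n. ?g (r n) x) \<longlonglongrightarrow> V x"
      using conv by eventually_elim (simp add: V_def convergent_LIMSEQ_iff)
    have "has_weak_gradient UNIV w V"
    proof (rule has_weak_gradient_limit(1)[where v = "\<lambda>n. u (k (r n))" and V = "\<lambda>n. ?g (r n)" and B = "\<lambda>x. \<bar>h x\<bar> + B" and M = K'])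
      show "has_weak_gradient UNIV (u (k (r n))) (?g (r n))" for n by (rule has_weak_gradient_grad[OF ul])
      show "continuous_on UNIV (\<lambda>x. \<bar>h x\<bar> + B)" by (intro continuous_intros lipschitz_on_continuous_on[OF h])
      show "\<bar>u (k (r n)) x\<bar> \<le> \<bar>h x\<bar> + B" for n x by (rule B(2)[OF u(1)])
      show "continuous_on UNIV w" by (rule lipschitz_on_continuous_on[OF wl])
      show "(\<lambda>n. u (k (r n)) x) \<longlonglongrightarrow> w x" for x
        using LIMSEQ_subseq_LIMSEQ[OF limw r(1), of x] by (simp add: o_def)
      show "AE x in lebesgue. norm (?g (r n) x) \<le> K'" for n by (rule grad_bound[OF ul])
      show "V \<in> borel_measurable lebesgue"
        unfolding V_def[abs_def] by (rule borel_measurable_lim_metric[OF grad_measurable[OF ul]])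
    qed (rule Vlim)
    from grad_AE_eq[OF this] Vlim have "AE x in lebesgue. (\<lambda>n. ?g (r n) x) \<longlonglongrightarrow> grad w x"
      by eventually_elim simp
    then show ?thesis by (rule AE_M)
  qed
  have "(\<lambda>n. E (u (k (r n)))) \<longlonglongrightarrow> E w"
    unfolding E_def
  proof (rule integral_dominated_convergence[where w="\<lambda>_. dens c K'"])
    show "(\<lambda>x. dens c (norm (?g (r n) x))) \<in> borel_measurable M" for n using gm by measurable
    show "(\<lambda>x. dens c (norm (grad w x))) \<in> borel_measurable M" using grad_measurable_M[OF wl] by measurable
    have bw: "AE x in M. norm (grad w x) \<le> K'" by (intro AE_M grad_bound[OF wl])
    show "AE x in M. (\<lambda>n. dens c (norm (?g (r n) x))) \<longlonglongrightarrow> dens c (norm (grad w x))"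
      using lim_g bw
    proof eventually_elim
      case (elim x)
      have "isCont (dens c) (norm (grad w x))"
        by (rule isCont_dens[OF R c(1)]) (use elim K in simp)
      then show ?case by (rule isCont_tendsto_compose) (intro tendsto_norm elim(1))
    qed
    show "AE x in M. norm (dens c (norm (?g (r n) x))) \<le> dens c K'" for n
      using gb[of "r n"]
    proof eventually_elim
      case (elim x)
      then show ?case using dens_mono[OF c(1) summable_K' norm_ge_zero elim] by simp
    qed
  qed simp
  moreover have "(\<lambda>n. m + 1 / (real n + 1)) \<longlonglongrightarrow> m + 0"
    using LIMSEQ_inverse_real_of_nat by (intro tendsto_add tendsto_const) (simp add: inverse_eq_divide add.commute)
  moreover have "E (u (k (r n))) \<le> m + 1 / (real n + 1)" for n
  proof -
    have "n \<le> k (r n)" using seq_suble[OF k, of "r n"] seq_suble[OF r(1), of n] by linarith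
    then have "1 / (real (k (r n)) + 1) \<le> 1 / (real n + 1)" by (intro divide_left_mono) auto
    then show ?thesis using u(2)[of "k (r n)"] by linarith
  qed
  ultimately have "E w \<le> m + 0" by (intro LIMSEQ_le[of _ _ "\<lambda>n. m + 1 / (real n + 1)"]) auto
  then show ?thesis using that[OF w_adm] m_le by fastforce
qed

end

section \<open>The slope of the minimizer and its Euler-Lagrange equation\<close>

context dirichlet_problem
begin

lemma admissible_eqI:
  assumes v: "v \<in> admissible" and w: "w \<in> admissible" and eq: "AE x in M. grad v x = grad w x"
  shows "v = w"
proof
  fix x
  note vl = admissibleD(1)[OF v] and wl = admissibleD(1)[OF w]
  have "v x - w x = 0"
  proof (rule lipschitz_zero_gradient[OF \<Omega> lipschitz_on_diff[OF vl wl]])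
    show "v x - w x = 0" if "x \<notin> \<Omega>" for x using admissibleD(2)[OF v that] admissibleD(2)[OF w that] by simp
    show "AE x in M. grad (\<lambda>x. v x - w x) x = 0"
      using AE_M[OF grad_diff[OF vl wl]] eq by eventually_elim simp
  qed
  then show "v x = w x" by simp
qed

lemma minimizer_unique:
  assumes w: "w \<in> admissible" "\<And>v. v \<in> admissible \<Longrightarrow> E w \<le> E v" and v: "v \<in> admissible" "E v \<le> E w"
  shows "v = w"
proof (rule admissible_eqI[OF v(1) w(1)])
  note vl = admissibleD(1)[OF v(1)] and wl = admissibleD(1)[OF w(1)]
  have [measurable]: "grad v \<in> borel_measurable M" "grad w \<in> borel_measurable M"
    by (rule grad_measurable_M[OF vl] grad_measurable_M[OF wl])+
  have bd: "AE x in M. norm (grad v x - grad w x) \<le> K' + K'"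
    using AE_M[OF grad_bound[OF vl]] AE_M[OF grad_bound[OF wl]]
    by eventually_elim (metis add_mono norm_triangle_ineq4 order_trans)
  have sq: "integrable M (\<lambda>x. (norm (grad v x - grad w x))\<^sup>2)"
    by (rule integrable_norm_sq[OF _ bd]) measurable
  have "c 0 / 8 * (LINT x|M. (norm (grad v x - grad w x))\<^sup>2) \<le> 0"
    using admissible_midpoint(2)[OF v(1) w(1)] w(2)[OF admissible_midpoint(1)[OF v(1) w(1)]] v(2) by argo
  then have "(LINT x|M. (norm (grad v x - grad w x))\<^sup>2) \<le> 0" using c(2) by (simp add: mult_le_0_iff)
  moreover have "0 \<le> (LINT x|M. (norm (grad v x - grad w x))\<^sup>2)" by (intro integral_nonneg_AE) auto
  ultimately have "AE x in M. (norm (grad v x - grad w x))\<^sup>2 = 0"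
    using integral_nonneg_eq_0_iff_AE[OF sq] by simp
  then show "AE x in M. grad v x = grad w x" by eventually_elim simp
qed

text \<open>By convexity at the slope \<open>b\<close>, passing from \<open>w\<close> to \<open>v\<close> lowers the energy by at least a multiple of
  the integral of the squared gradient of \<open>w - v\<close>: the first order term is the constant \<open>flux c b\<close>
  against the gradient of a compactly supported function, which integrates to zero.\<close>

lemma affine_comparison:
  assumes w: "w \<in> admissible" "\<And>v. v \<in> admissible \<Longrightarrow> E w \<le> E v"
    and A: "open A" "A \<subseteq> \<Omega>" and b: "norm b \<le> K"
    and v: "v \<in> admissible" "\<And>x. x \<in> A \<Longrightarrow> v x = b \<bullet> x + d" "\<And>x. x \<notin> A \<Longrightarrow> v x = w x"
  shows "v = w"
proof (rule admissible_eqI[OF v(1) w(1)])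
  note vl = admissibleD(1)[OF v(1)] and wl = admissibleD(1)[OF w(1)]
  note dl = lipschitz_on_diff[OF wl vl]
  let ?p = "\<lambda>x. w x - v x"
  have p0: "?p x = 0" if "x \<notin> A" for x using v(3)[OF that] by simp
  have "AE x in lebesgue. x \<in> A \<longrightarrow> grad v x = grad (\<lambda>x. b \<bullet> x + d) x"
    by (rule grad_local[OF vl affine_lipschitz[OF order_refl] A(1)]) (rule v(2))
  with grad_affine[of b d] have "AE x in lebesgue. x \<in> A \<longrightarrow> grad v x = b" by eventually_elim simp
  then have gA: "AE x in M. x \<in> A \<longrightarrow> grad v x = b" by (rule AE_M)
  have gp: "AE x in M. grad ?p x = grad w x - grad v x" by (rule AE_M[OF grad_diff[OF wl vl]])
  have gz: "AE x in M. x \<notin> A \<longrightarrow> grad ?p x = 0"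
    using AE_M[OF grad_zero_on_zero_set[OF dl]] by eventually_elim (use p0 in blast)
  have bw: "AE x in M. norm (grad w x) \<le> K'" by (intro AE_M grad_bound wl)
  have bK: "norm b \<le> K'" using b K by linarith
  have [measurable]: "grad ?p \<in> borel_measurable M" by (rule grad_measurable_M[OF dl])
  have bp: "AE x in M. norm (grad ?p x) \<le> K' + K'" by (intro AE_M grad_bound dl)
  have ip: "integrable M (grad ?p)"
    by (rule integrable_const_bound[OF bp]) measurable
  have sq: "integrable M (\<lambda>x. (norm (grad ?p x))\<^sup>2)" by (rule integrable_norm_sq[OF _ bp]) measurable
  have z: "(LINT x|M. grad ?p x) = 0"
  proof -
    have "(LINT x|M. grad ?p x) = (LINT x|lebesgue. indicator \<Omega> x *\<^sub>R grad ?p x)"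
      using \<Omega>(1) by (intro integral_restrict_space) auto
    also have "\<dots> = (LINT x|lebesgue. grad ?p x)"
    proof (rule integral_cong_AE)
      show "AE x in lebesgue. indicator \<Omega> x *\<^sub>R grad ?p x = grad ?p x"
        using grad_zero_on_zero_set[OF dl]
      proof eventually_elim
        case (elim x)
        then show ?case using p0[of x] A(2) by (cases "x \<in> \<Omega>") auto
      qed
      show "(\<lambda>x. indicator \<Omega> x *\<^sub>R grad ?p x) \<in> borel_measurable lebesgue"
        using \<Omega>(1) grad_measurable[OF dl] by (intro borel_measurable_scaleR borel_measurable_indicator) auto
    qed (rule grad_measurable[OF dl])
    also have "\<dots> = 0" by (rule integral_grad_zero[OF dl bounded_subset[OF \<Omega>(2) A(2)] p0])
    finally show ?thesis .
  qed
  have "(LINT x|M. dens c (norm (grad v x)) + flux c b \<bullet> grad ?p x + c 0 / 2 * (norm (grad ?p x))\<^sup>2)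
      \<le> (LINT x|M. dens c (norm (grad w x)))"
  proof (rule integral_mono_AE)
    show "AE x in M. dens c (norm (grad v x)) + flux c b \<bullet> grad ?p x + c 0 / 2 * (norm (grad ?p x))\<^sup>2
        \<le> dens c (norm (grad w x))"
      using gA gp gz bw
    proof eventually_elim
      case (elim x)
      show ?case
      proof (cases "x \<in> A")
        case True
        then have g: "grad v x = b" "grad ?p x = grad w x - b" using elim by auto
        show ?thesis unfolding g
          by (rule dens_convex[OF c(1)]) (use dens_summable[OF c(1) summable_K' norm_ge_zero] bK elim(4) in blast)+
      next
        case False
        then show ?thesis using elim by simp
      qed
    qed
  qed (use integrable_dens_admissible[OF v(1)] integrable_dens_admissible[OF w(1)] ip sq in auto)
  then have "E v + flux c b \<bullet> (LINT x|M. grad ?p x) + c 0 / 2 * (LINT x|M. (norm (grad ?p x))\<^sup>2) \<le> E w"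
    using integrable_dens_admissible[OF v(1)] ip sq by (simp add: E_def)
  then have "c 0 / 2 * (LINT x|M. (norm (grad ?p x))\<^sup>2) \<le> 0" using w(2)[OF v(1)] z by simp
  then have "(LINT x|M. (norm (grad ?p x))\<^sup>2) \<le> 0" using c(2) by (simp add: mult_le_0_iff)
  moreover have "0 \<le> (LINT x|M. (norm (grad ?p x))\<^sup>2)" by (intro integral_nonneg_AE) auto
  ultimately have "AE x in M. (norm (grad ?p x))\<^sup>2 = 0"
    using integral_nonneg_eq_0_iff_AE[OF sq] by simp
  then show "AE x in M. grad v x = grad w x" using gp by eventually_elim simp
qed

lemma minimizer_le_barrier:
  assumes w: "w \<in> admissible" "\<And>v. v \<in> admissible \<Longrightarrow> E w \<le> E v"
    and b: "norm b \<le> K" and le: "\<And>x. x \<in> frontier \<Omega> \<Longrightarrow> h x \<le> b \<bullet> x + d" and x: "x \<in> \<Omega>"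
  shows "w x \<le> b \<bullet> x + d"
proof (rule ccontr)
  assume nle: "\<not> w x \<le> b \<bullet> x + d"
  note wl = admissibleD(1)[OF w(1)]
  have wh: "w z = h z" if "z \<in> frontier \<Omega>" for z
    using that \<Omega>(1) admissibleD(2)[OF w(1)] by (auto simp: frontier_def interior_open)
  let ?v = "\<lambda>x. if x \<in> \<Omega> then min (w x) (b \<bullet> x + d) else h x"
  have "K'-lipschitz_on UNIV ?v"
  proof (rule lipschitz_glue)
    show "K'-lipschitz_on (closure \<Omega>) (\<lambda>x. min (w x) (b \<bullet> x + d))"
      by (rule lipschitz_min_max(1)) (use b K wl in \<open>auto intro: affine_lipschitz lipschitz_on_subset\<close>)
    show "K'-lipschitz_on UNIV h" using h K by (auto intro: lipschitz_on_le)
    show "min (w z) (b \<bullet> z + d) = h z" if "z \<in> frontier \<Omega>" for z using le[OF that] wh[OF that] by simp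
  qed
  then have v: "?v \<in> admissible" by (auto simp: admissible_def)
  let ?A = "{x \<in> \<Omega>. b \<bullet> x + d < w x}"
  have "?v = w"
  proof (rule affine_comparison[OF w _ _ b v])
    have "open {x. b \<bullet> x + d < w x}"
      by (intro open_Collect_less continuous_intros lipschitz_on_continuous_on[OF wl])
    then show "open ?A" using \<Omega>(1) by (simp add: Collect_conj_eq open_Int)
    show "?v y = w y" if "y \<notin> ?A" for y using that admissibleD(2)[OF w(1), of y] by auto
  qed auto
  then have "?v x = w x" by (rule fun_cong)
  then show False using x nle by (simp add: min_def split: if_splits)
qed

lemma minimizer_ge_barrier:
  assumes w: "w \<in> admissible" "\<And>v. v \<in> admissible \<Longrightarrow> E w \<le> E v"
    and b: "norm b \<le> K" and le: "\<And>x. x \<in> frontier \<Omega> \<Longrightarrow> b \<bullet> x + d \<le> h x" and x: "x \<in> \<Omega>"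
  shows "b \<bullet> x + d \<le> w x"
proof (rule ccontr)
  assume nle: "\<not> b \<bullet> x + d \<le> w x"
  note wl = admissibleD(1)[OF w(1)]
  have wh: "w z = h z" if "z \<in> frontier \<Omega>" for z
    using that \<Omega>(1) admissibleD(2)[OF w(1)] by (auto simp: frontier_def interior_open)
  let ?v = "\<lambda>x. if x \<in> \<Omega> then max (w x) (b \<bullet> x + d) else h x"
  have "K'-lipschitz_on UNIV ?v"
  proof (rule lipschitz_glue)
    show "K'-lipschitz_on (closure \<Omega>) (\<lambda>x. max (w x) (b \<bullet> x + d))"
      by (rule lipschitz_min_max(2)) (use b K wl in \<open>auto intro: affine_lipschitz lipschitz_on_subset\<close>)
    show "K'-lipschitz_on UNIV h" using h K by (auto intro: lipschitz_on_le)
    show "max (w z) (b \<bullet> z + d) = h z" if "z \<in> frontier \<Omega>" for z using le[OF that] wh[OF that] by simp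
  qed
  then have v: "?v \<in> admissible" by (auto simp: admissible_def)
  let ?A = "{x \<in> \<Omega>. w x < b \<bullet> x + d}"
  have "?v = w"
  proof (rule affine_comparison[OF w _ _ b v])
    have "open {x. w x < b \<bullet> x + d}"
      by (intro open_Collect_less continuous_intros lipschitz_on_continuous_on[OF wl])
    then show "open ?A" using \<Omega>(1) by (simp add: Collect_conj_eq open_Int)
    show "?v y = w y" if "y \<notin> ?A" for y using that admissibleD(2)[OF w(1), of y] by auto
  qed auto
  then have "?v x = w x" by (rule fun_cong)
  then show False using x nle by (simp add: max_def split: if_splits)
qed

text \<open>The barriers at a boundary point \<open>z\<close> between \<open>x\<close> and \<open>y\<close> bound the slope from \<open>x\<close> to \<open>z\<close>, and
  the datum bounds it from \<open>z\<close> to \<open>y\<close>.\<close>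

lemma minimizer_boundary_slope:
  assumes w: "w \<in> admissible" "\<And>v. v \<in> admissible \<Longrightarrow> E w \<le> E v" and y: "y \<notin> \<Omega>"
  shows "\<bar>w x - w y\<bar> \<le> K * dist x y"
proof (cases "x \<in> \<Omega>")
  case False
  then show ?thesis using y admissibleD(2)[OF w(1)] lipschitz_onD[OF h, of x y] by (simp add: dist_real_def)
next
  case True
  obtain z where z: "z \<in> frontier \<Omega>" "dist x z + dist z y = dist x y"
    using frontier_point_between[OF True y] .
  obtain bm cm bp cp where b: "bm \<bullet> z + cm = h z" "bp \<bullet> z + cp = h z"
    "\<And>x. x \<in> frontier \<Omega> \<Longrightarrow> bm \<bullet> x + cm \<le> h x" "\<And>x. x \<in> frontier \<Omega> \<Longrightarrow> h x \<le> bp \<bullet> x + cp"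
    "norm bm \<le> K" "norm bp \<le> K"
  proof -
    from bsc z(1) obtain bm cm bp cp where "bm \<bullet> z + cm = h z \<and> bp \<bullet> z + cp = h z \<and>
        (\<forall>x\<in>frontier \<Omega>. bm \<bullet> x + cm \<le> h x \<and> h x \<le> bp \<bullet> x + cp) \<and> norm bm \<le> K \<and> norm bp \<le> K"
      unfolding bounded_slope_def by blast
    then show ?thesis using that[of bm cm bp cp] by blast
  qed
  have "bm \<bullet> x + cm \<le> w x" by (rule minimizer_ge_barrier[OF w b(5,3) True])
  moreover have "w x \<le> bp \<bullet> x + cp" by (rule minimizer_le_barrier[OF w b(6,4) True])
  moreover have "\<bar>bm \<bullet> x + cm - (bm \<bullet> z + cm)\<bar> \<le> K * dist x z" "\<bar>bp \<bullet> x + cp - (bp \<bullet> z + cp)\<bar> \<le> K * dist x z"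
    using lipschitz_onD[OF affine_lipschitz[OF b(5)] UNIV_I UNIV_I, of x cm z]
      lipschitz_onD[OF affine_lipschitz[OF b(6)] UNIV_I UNIV_I, of x cp z] by (auto simp: dist_real_def)
  ultimately have "\<bar>w x - h z\<bar> \<le> K * dist x z" using b(1,2) by linarith
  moreover have "\<bar>h z - h y\<bar> \<le> K * dist z y" using lipschitz_onD[OF h, of z y] by (simp add: dist_real_def)
  moreover have "K * dist x z + K * dist z y = K * dist x y" using z(2) by (simp add: distrib_left[symmetric])
  ultimately show ?thesis using admissibleD(2)[OF w(1) y] by linarith
qed

text \<open>By the boundary estimate, \<open>w (x + \<tau>) - K * norm \<tau>\<close> does not exceed \<open>w x\<close> unless both \<open>x\<close> and
  \<open>x + \<tau>\<close> lie in \<open>\<Omega>\<close>.  Exchanging \<open>w\<close> with its translate on the set where the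
  latter is larger yields two competitors whose energies differ from that of \<open>w\<close> by opposite amounts, so
  both are minimizers, and by uniqueness the set is empty.\<close>

theorem minimizer_lipschitz:
  assumes w: "w \<in> admissible" "\<And>v. v \<in> admissible \<Longrightarrow> E w \<le> E v"
  shows "K-lipschitz_on UNIV w"
proof -
  note wl = admissibleD(1)[OF w(1)]
  have wc: "continuous_on UNIV w" by (rule lipschitz_on_continuous_on[OF wl])
  have key: "w (x + \<tau>) - w x \<le> K * norm \<tau>" for x \<tau>
  proof -
    let ?w\<tau> = "\<lambda>x. w (x + \<tau>)"
    have wtl: "K'-lipschitz_on UNIV (\<lambda>x. w (x + a))" for a
    proof (rule lipschitz_onI)
      show "dist (w (x + a)) (w (y + a)) \<le> K' * dist x y" for x y
        using lipschitz_onD[OF wl, of "x + a" "y + a"] by (simp add: dist_norm)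
    qed (rule lipschitz_on_nonneg[OF wl])
    have wtc: "continuous_on UNIV (\<lambda>x. w (x + a))" for a by (rule lipschitz_on_continuous_on[OF wtl])
    have shl: "K'-lipschitz_on UNIV (\<lambda>x. w (x + a) + e)" for a e
      using wtl[of a] by (auto simp: lipschitz_on_def dist_real_def)
    define A where "A = {x. w x + K * norm \<tau> < w (x + \<tau>)}"
    have Aop: "open A" unfolding A_def by (intro open_Collect_less continuous_intros wc wtc)
    have A\<Omega>: "x \<in> \<Omega>" "x + \<tau> \<in> \<Omega>" if "x \<in> A" for x
    proof -
      have lt: "w x + K * norm \<tau> < w (x + \<tau>)" using that by (simp add: A_def)
      show "x \<in> \<Omega>"
      proof (rule ccontr)
        assume "x \<notin> \<Omega>"
        from minimizer_boundary_slope[OF w this, of "x + \<tau>"] lt show False by (simp add: dist_norm)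
      qed
      show "x + \<tau> \<in> \<Omega>"
      proof (rule ccontr)
        assume "x + \<tau> \<notin> \<Omega>"
        from minimizer_boundary_slope[OF w this, of x] lt show False by (simp add: dist_norm)
      qed
    qed
    define v1 where "v1 x = max (w x) (w (x + \<tau>) + (- K * norm \<tau>))" for x
    define v2 where "v2 x = min (w x) (w (x + - \<tau>) + K * norm \<tau>)" for x
    have v1l: "K'-lipschitz_on UNIV v1" and v2l: "K'-lipschitz_on UNIV v2"
      unfolding v1_def[abs_def] v2_def[abs_def] by (intro lipschitz_min_max wl shl)+
    have v1w: "v1 x = w x" if "x \<notin> A" for x using that by (auto simp: v1_def A_def)
    have v1A: "v1 x = w (x + \<tau>) + (- K * norm \<tau>)" if "x \<in> A" for x using that by (auto simp: v1_def A_def)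
    have v2w: "v2 x = w x" if "x + - \<tau> \<notin> A" for x using that by (auto simp: v2_def A_def)
    have v2A: "v2 x = w (x + - \<tau>) + K * norm \<tau>" if "x + - \<tau> \<in> A" for x using that by (auto simp: v2_def A_def)
    have v1: "v1 \<in> admissible"
      using v1l v1w A\<Omega>(1) admissibleD(2)[OF w(1)] by (fastforce simp: admissible_def)
    have v2: "v2 \<in> admissible"
    proof -
      have "v2 x = h x" if "x \<notin> \<Omega>" for x
      proof -
        have "x + - \<tau> \<notin> A" using A\<Omega>(2)[of "x + - \<tau>"] that by auto
        then show ?thesis using v2w admissibleD(2)[OF w(1) that] by simp
      qed
      then show ?thesis using v2l by (simp add: admissible_def)
    qed
    have gshift: "AE x in lebesgue. grad (\<lambda>x. w (x + a) + e) x = grad w (x + a)" for a e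
    proof -
      have "0-lipschitz_on UNIV (\<lambda>x::'a. 0 \<bullet> x + e)" by (auto simp: lipschitz_on_def)
      from grad_add[OF wtl[of a] this] grad_affine[of 0 e] grad_shift[OF wl, of a]
      show ?thesis by eventually_elim simp
    qed
    have g1: "AE x in lebesgue. grad v1 x = (if x \<in> A then grad w (x + \<tau>) else grad w x)"
    proof -
      have "AE x in lebesgue. x \<in> A \<longrightarrow> grad v1 x = grad (\<lambda>x. w (x + \<tau>) + (- K * norm \<tau>)) x"
        by (rule grad_local[OF v1l shl Aop]) (rule v1A)
      with gshift[of \<tau> "- K * norm \<tau>"] grad_zero_on_zero_set[OF lipschitz_on_diff[OF v1l wl]] grad_diff[OF v1l wl]
      show ?thesis
      proof eventually_elim
        case (elim x)
        then show ?case using v1w[of x] by (cases "x \<in> A") auto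
      qed
    qed
    have g2: "AE x in lebesgue. grad v2 x = (if x + - \<tau> \<in> A then grad w (x + - \<tau>) else grad w x)"
    proof -
      have "open ((\<lambda>x. x + - \<tau>) -` A)" by (intro open_vimage Aop continuous_intros)
      then have "AE x in lebesgue. x \<in> (\<lambda>x. x + - \<tau>) -` A \<longrightarrow> grad v2 x = grad (\<lambda>x. w (x + - \<tau>) + K * norm \<tau>) x"
        by (rule grad_local[OF v2l shl]) (use v2A in auto)
      with gshift[of "- \<tau>" "K * norm \<tau>"] grad_zero_on_zero_set[OF lipschitz_on_diff[OF v2l wl]] grad_diff[OF v2l wl]
      show ?thesis
      proof eventually_elim
        case (elim x)
        then show ?case using v2w[of x] by (cases "x + - \<tau> \<in> A") auto
      qed
    qed
    define e where "e x = dens c (norm (grad w x))" for x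
    define i :: "'a \<Rightarrow> real" where "i = indicator A"
    define f where "f x = i x * (e (x + \<tau>) - e x)" for x
    have gw: "grad w \<in> borel_measurable lebesgue" by (rule grad_measurable[OF wl])
    have em: "e \<in> borel_measurable lebesgue"
      unfolding e_def[abs_def] using gw by measurable
    have im: "i \<in> borel_measurable lebesgue" unfolding i_def using Aop by (intro borel_measurable_indicator) auto
    have fm: "f \<in> borel_measurable lebesgue"
      unfolding f_def[abs_def]
      by (intro borel_measurable_times borel_measurable_diff im em measurable_compose[OF lebesgue_shift(1) em])
    have f0: "f x = 0" if "x \<notin> \<Omega>" for x using A\<Omega>(1)[of x] that by (auto simp: f_def i_def indicator_def)
    have f0': "f (x + - \<tau>) = 0" if "x \<notin> \<Omega>" for x using A\<Omega>(2)[of "x + - \<tau>"] that by (auto simp: f_def i_def indicator_def)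
    have E1: "E v1 = E w + (LINT x|lebesgue. f x)"
    proof -
      have "AE x in M. dens c (norm (grad v1 x)) - dens c (norm (grad w x)) = f x"
        using AE_M[OF g1] by eventually_elim (auto simp: f_def e_def i_def indicator_def)
      then have "(LINT x|M. dens c (norm (grad v1 x)) - dens c (norm (grad w x))) = (LINT x|M. f x)"
        using integrable_dens_admissible[OF v1] integrable_dens_admissible[OF w(1)]
        by (intro integral_cong_AE) (auto intro: measurable_restrict_space1[OF fm])
      also have "\<dots> = (LINT x|lebesgue. f x)" by (rule integral_lebesgue_on_open[OF \<Omega>(1) f0])
      finally show ?thesis
        using integrable_dens_admissible[OF v1] integrable_dens_admissible[OF w(1)] by (simp add: E_def)
    qed
    have E2: "E v2 = E w - (LINT x|lebesgue. f x)"
    proof -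
      have "AE x in M. dens c (norm (grad v2 x)) - dens c (norm (grad w x)) = - f (x + - \<tau>)"
        using AE_M[OF g2] by eventually_elim (auto simp: f_def e_def i_def indicator_def)
      then have "(LINT x|M. dens c (norm (grad v2 x)) - dens c (norm (grad w x))) = (LINT x|M. - f (x + - \<tau>))"
        using integrable_dens_admissible[OF v2] integrable_dens_admissible[OF w(1)]
          measurable_compose[OF lebesgue_shift(1) fm, of "- \<tau>"]
        by (intro integral_cong_AE) (auto intro!: measurable_restrict_space1)
      also have "\<dots> = (LINT x|lebesgue. - f (x + - \<tau>))"
        by (rule integral_lebesgue_on_open[OF \<Omega>(1)]) (use f0' in simp)
      also have "\<dots> = - (LINT x|lebesgue. f x)" using integral_lebesgue_shift[OF fm, of "- \<tau>"] by simp
      finally show ?thesis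
        using integrable_dens_admissible[OF v2] integrable_dens_admissible[OF w(1)] by (simp add: E_def)
    qed
    have "E v1 \<le> E w" using w(2)[OF v2] E1 E2 by linarith
    from minimizer_unique[OF w(1) _ v1 this] w(2) have "v1 = w" by blast
    moreover have "w (x + \<tau>) + (- K * norm \<tau>) \<le> v1 x" by (simp add: v1_def)
    ultimately show ?thesis by simp
  qed
  show ?thesis
  proof (rule lipschitz_onI[OF _ K(1)])
    fix x y
    show "dist (w x) (w y) \<le> K * dist x y"
      using key[of x "y - x"] key[of y "x - y"] by (simp add: dist_real_def dist_norm norm_minus_commute abs_le_iff)
  qed
qed

text \<open>For small \<open>t > 0\<close> the function \<open>w + t * \<psi>\<close> is admissible, because \<open>w\<close> has slope at most \<open>K < K'\<close>.
  Convexity at its gradient bounds the increase of the energy by \<open>t\<close> times the flux there tested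
  with \<open>\<psi>\<close>, which is therefore nonnegative; let \<open>t\<close> tend to \<open>0\<close> and exchange \<open>\<psi>\<close> with its negative.\<close>

theorem minimizer_Euler_Lagrange:
  assumes w: "w \<in> admissible" "\<And>v. v \<in> admissible \<Longrightarrow> E w \<le> E v"
    and \<psi>: "L-lipschitz_on UNIV \<psi>" and off: "\<And>x. x \<notin> \<Omega> \<Longrightarrow> \<psi> x = 0"
  shows "(LINT x|M. flux c (grad w x) \<bullet> grad \<psi> x) = 0"
proof -
  have wl: "K-lipschitz_on UNIV w" by (rule minimizer_lipschitz[OF w])
  have gw: "grad w \<in> borel_measurable M" by (rule grad_measurable_M[OF wl])
  have bw: "AE x in M. norm (grad w x) \<le> K" by (intro AE_M grad_bound wl)
  have one_sided: "0 \<le> (LINT x|M. flux c (grad w x) \<bullet> grad \<psi> x)"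
    if \<psi>: "L-lipschitz_on UNIV \<psi>" and off: "\<And>x. x \<notin> \<Omega> \<Longrightarrow> \<psi> x = 0" for \<psi> :: "'a \<Rightarrow> real"
  proof -
    have L: "0 \<le> L" by (rule lipschitz_on_nonneg[OF \<psi>])
    \<comment> \<open>the admissible step is \<open>(K' - K) / L\<close>; the summand \<open>1\<close> avoids division by zero\<close>
    define t where "t n = (K' - K) / ((L + 1) * (real n + 1))" for n
    have t: "0 < t n" for n using K L by (simp add: t_def)
    have tL: "K + t n * L \<le> K'" for n
    proof -
      have "t n * L \<le> t n * ((L + 1) * (real n + 1))"
      proof (rule mult_left_mono)
        have "L * 1 \<le> (L + 1) * (real n + 1)" using L by (intro mult_mono) auto
        then show "L \<le> (L + 1) * (real n + 1)" by simp
      qed (use t[of n] in simp)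
      also have "\<dots> = K' - K" using L by (simp add: t_def)
      finally show ?thesis by linarith
    qed
    have t0: "t \<longlonglongrightarrow> 0"
    proof -
      have "(\<lambda>n. ((K' - K) / (L + 1)) * (1 / (real n + 1))) \<longlonglongrightarrow> 0"
        using tendsto_mult_right_zero[OF LIMSEQ_inverse_real_of_nat, of "(K' - K) / (L + 1)"]
        by (simp add: inverse_eq_divide add.commute)
      then show ?thesis by (simp add: t_def[abs_def])
    qed
    have g\<psi>: "grad \<psi> \<in> borel_measurable M" by (rule grad_measurable_M[OF \<psi>])
    have b\<psi>: "AE x in M. norm (grad \<psi> x) \<le> L" by (intro AE_M grad_bound \<psi>)
    define u where "u n x = w x + t n * \<psi> x" for n x
    have ul: "(K + \<bar>t n\<bar> * L)-lipschitz_on UNIV (u n)" for n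
      unfolding u_def[abs_def] by (intro lipschitz_on_add wl lipschitz_on_cmult_real \<psi>)
    have u_adm: "u n \<in> admissible" for n
    proof -
      have "K'-lipschitz_on UNIV (u n)"
        using ul[of n] tL[of n] t[of n] by (auto intro: lipschitz_on_le)
      then show ?thesis using admissibleD(2)[OF w(1)] off by (auto simp: admissible_def u_def)
    qed
    define W where "W n x = grad w x + t n *\<^sub>R grad \<psi> x" for n x
    have gu: "AE x in M. grad (u n) x = W n x" for n
    proof -
      have l: "(\<bar>t n\<bar> * L)-lipschitz_on UNIV (\<lambda>x. t n * \<psi> x)" by (intro lipschitz_on_cmult_real \<psi>)
      have "AE x in lebesgue. grad (u n) x = W n x"
        unfolding u_def[abs_def] W_def using grad_add[OF wl l] grad_cmult[OF \<psi>, of "t n"] by eventually_elim simp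
      then show ?thesis by (rule AE_M)
    qed
    have Wm: "W n \<in> borel_measurable M" for n unfolding W_def[abs_def] using gw g\<psi> by measurable
    have bW: "AE x in M. norm (W n x) \<le> K'" for n
      using bw b\<psi>
    proof eventually_elim
      case (elim x)
      have "norm (t n *\<^sub>R grad \<psi> x) \<le> t n * L" using elim(2) t[of n] by (simp add: mult_left_mono)
      then show ?case unfolding W_def using elim(1) tL[of n] norm_triangle_ineq[of "grad w x" "t n *\<^sub>R grad \<psi> x"] by linarith
    qed
    define F where "F = (\<Sum>j. c j * K' ^ j) * K'"
    have fm: "(\<lambda>x. flux c (W n x) \<bullet> grad \<psi> x) \<in> borel_measurable M" for n using Wm g\<psi> by measurable
    have fb: "AE x in M. norm (flux c (W n x) \<bullet> grad \<psi> x) \<le> F * L" for n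
      using bW[of n] b\<psi>
    proof eventually_elim
      case (elim x)
      have f: "norm (flux c (W n x)) \<le> F" unfolding F_def by (rule flux_bound[OF c(1) summable_K' elim(1)])
      have "norm (flux c (W n x) \<bullet> grad \<psi> x) \<le> norm (flux c (W n x)) * norm (grad \<psi> x)"
        by (simp add: Cauchy_Schwarz_ineq2)
      also have "\<dots> \<le> F * L" using f elim(2) order_trans[OF norm_ge_zero f] by (intro mult_mono) auto
      finally show ?case .
    qed
    have fi: "integrable M (\<lambda>x. flux c (W n x) \<bullet> grad \<psi> x)" for n by (rule integrable_const_bound[OF fb fm])
    have ge: "0 \<le> (LINT x|M. flux c (W n x) \<bullet> grad \<psi> x)" for n
    proof -
      have "(LINT x|M. dens c (norm (grad (u n) x)) - t n * (flux c (W n x) \<bullet> grad \<psi> x)) \<le> (LINT x|M. dens c (norm (grad w x)))"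
      proof (rule integral_mono_AE)
        show "AE x in M. dens c (norm (grad (u n) x)) - t n * (flux c (W n x) \<bullet> grad \<psi> x) \<le> dens c (norm (grad w x))"
          using gu[of n] bW[of n] bw
        proof eventually_elim
          case (elim x)
          have wK: "norm (grad w x) \<le> K'" using elim(3) K by linarith
          have "dens c (norm (W n x)) + flux c (W n x) \<bullet> (grad w x - W n x) + c 0 / 2 * (norm (grad w x - W n x))\<^sup>2 \<le> dens c (norm (grad w x))"
            by (rule dens_convex[OF c(1)]) (use dens_summable[OF c(1) summable_K' norm_ge_zero] wK elim(2) in blast)+
          moreover have "0 \<le> c 0 / 2 * (norm (grad w x - W n x))\<^sup>2" using c(2) by simp
          moreover have "flux c (W n x) \<bullet> (grad w x - W n x) = - t n * (flux c (W n x) \<bullet> grad \<psi> x)" by (simp add: W_def)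
          ultimately show ?case using elim(1) by simp
        qed
      qed (use integrable_dens_admissible[OF u_adm] integrable_dens_admissible[OF w(1)] fi in auto)
      then have "E (u n) - t n * (LINT x|M. flux c (W n x) \<bullet> grad \<psi> x) \<le> E w"
        using integrable_dens_admissible[OF u_adm] fi by (simp add: E_def)
      then have "0 \<le> t n * (LINT x|M. flux c (W n x) \<bullet> grad \<psi> x)" using w(2)[OF u_adm, of n] by linarith
      then show ?thesis using t[of n] by (simp add: zero_le_mult_iff)
    qed
    have "(\<lambda>n. LINT x|M. flux c (W n x) \<bullet> grad \<psi> x) \<longlonglongrightarrow> (LINT x|M. flux c (grad w x) \<bullet> grad \<psi> x)"
    proof (rule integral_dominated_convergence[where w="\<lambda>_. F * L"])
      show "(\<lambda>x. flux c (grad w x) \<bullet> grad \<psi> x) \<in> borel_measurable M" using gw g\<psi> by measurable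
      show "AE x in M. (\<lambda>n. flux c (W n x) \<bullet> grad \<psi> x) \<longlonglongrightarrow> flux c (grad w x) \<bullet> grad \<psi> x"
        using bw
      proof eventually_elim
        case (elim x)
        have "isCont (flux c) (grad w x)" by (rule isCont_flux[OF R]) (use elim K in linarith)
        moreover have "(\<lambda>n. W n x) \<longlonglongrightarrow> grad w x + 0 *\<^sub>R grad \<psi> x" unfolding W_def by (intro tendsto_intros t0)
        then have "(\<lambda>n. W n x) \<longlonglongrightarrow> grad w x" by simp
        ultimately have "(\<lambda>n. flux c (W n x)) \<longlonglongrightarrow> flux c (grad w x)" by (rule isCont_tendsto_compose)
        then show ?case by (intro tendsto_intros)
      qed
    qed (use fm fb in auto)
    then show ?thesis by (rule LIMSEQ_le_const) (use ge in blast)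
  qed
  have neg: "AE x in M. flux c (grad w x) \<bullet> grad (\<lambda>x. - 1 * \<psi> x) x = - (flux c (grad w x) \<bullet> grad \<psi> x)"
    using AE_M[OF grad_cmult[OF \<psi>, of "-1"]] by eventually_elim simp
  have l: "L-lipschitz_on UNIV (\<lambda>x. - 1 * \<psi> x)" using \<psi> by simp
  have "0 \<le> (LINT x|M. flux c (grad w x) \<bullet> grad (\<lambda>x. - 1 * \<psi> x) x)"
    by (rule one_sided[OF l]) (use off in simp)
  also have "\<dots> = (LINT x|M. - (flux c (grad w x) \<bullet> grad \<psi> x))"
    by (rule integral_cong_AE[OF _ _ neg])
      (use gw grad_measurable_M[OF \<psi>] grad_measurable_M[OF l] in measurable)
  finally have "(LINT x|M. flux c (grad w x) \<bullet> grad \<psi> x) \<le> 0" by simp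
  then show ?thesis using one_sided[OF \<psi> off] by simp
qed

end

section \<open>The boundary datum and the coefficients\<close>

text \<open>The extension of McShane: the largest one with the given Lipschitz constant.\<close>

lemma lipschitz_extension:
  fixes g :: "'a::metric_space \<Rightarrow> real"
  assumes g: "K-lipschitz_on S g"
  obtains h where "K-lipschitz_on UNIV h" "\<And>x. x \<in> S \<Longrightarrow> h x = g x"
proof (cases "S = {}")
  case True
  have "K-lipschitz_on UNIV (\<lambda>_::'a. 0::real)" using lipschitz_on_nonneg[OF g] by (auto simp: lipschitz_on_def)
  then show ?thesis using that[of "\<lambda>_. 0"] True by blast
next
  case False
  have K: "0 \<le> K" by (rule lipschitz_on_nonneg[OF g])
  obtain s where s: "s \<in> S" using False by blast
  define h where "h x = (INF y\<in>S. g y + K * dist x y)" for x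
  have gd: "\<bar>g y - g z\<bar> \<le> K * dist y z" if "y \<in> S" "z \<in> S" for y z
    using lipschitz_onD[OF g that] by (simp add: dist_real_def)
  have lower: "g z - K * dist x z \<le> g y + K * dist x y" if "y \<in> S" "z \<in> S" for x y z
  proof -
    have "K * dist y z \<le> K * (dist x y + dist x z)"
      using dist_triangle3[of y z x] K by (intro mult_left_mono) auto
    then show ?thesis using gd[OF that] by (simp add: distrib_left)
  qed
  have bdd: "bdd_below ((\<lambda>y. g y + K * dist x y) ` S)" for x
    using lower s by (intro bdd_belowI2[of _ "g s - K * dist x s"]) auto
  have le: "h x \<le> h y + K * dist x y" for x y
  proof -
    have "h x - K * dist x y \<le> g z + K * dist y z" if "z \<in> S" for z
    proof -
      have "h x \<le> g z + K * dist x z" unfolding h_def using bdd that by (rule cINF_lower)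
      also have "K * dist x z \<le> K * (dist x y + dist y z)" using K by (intro mult_left_mono dist_triangle)
      finally show ?thesis by (simp add: distrib_left)
    qed
    then have "h x - K * dist x y \<le> h y" unfolding h_def[of y] using False by (intro cINF_greatest)
    then show ?thesis by simp
  qed
  have "K-lipschitz_on UNIV h"
  proof (rule lipschitz_onI[OF _ K])
    fix x y
    show "dist (h x) (h y) \<le> K * dist x y"
      using le[of x y] le[of y x] by (simp add: dist_real_def dist_commute abs_le_iff)
  qed
  moreover have "h x = g x" if "x \<in> S" for x
  proof (rule antisym)
    have "h x \<le> g x + K * dist x x" unfolding h_def using bdd that by (rule cINF_lower)
    then show "h x \<le> g x" by simp
    show "g x \<le> h x" unfolding h_def
      using False lower[OF _ that, of _ x] by (intro cINF_greatest) auto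
  qed
  ultimately show ?thesis using that by blast
qed

lemma bounded_slope_lipschitz:
  assumes "bounded_slope \<Omega> g K"
  shows "K-lipschitz_on (frontier \<Omega>) g"
proof (rule lipschitz_onI)
  show "0 \<le> K" using assms by (simp add: bounded_slope_def)
  have le: "g x - g y \<le> K * dist x y" if xy: "x \<in> frontier \<Omega>" "y \<in> frontier \<Omega>" for x y
  proof -
    obtain bp cp where b: "bp \<bullet> y + cp = g y" "g x \<le> bp \<bullet> x + cp" "norm bp \<le> K"
      using assms xy unfolding bounded_slope_def by blast
    have "g x - g y \<le> bp \<bullet> (x - y)" using b(1,2) by (simp add: inner_diff_right)
    also have "\<dots> \<le> norm bp * norm (x - y)" by (rule norm_cauchy_schwarz)
    also have "\<dots> \<le> K * norm (x - y)" using b(3) by (intro mult_right_mono) auto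
    finally show ?thesis by (simp add: dist_norm)
  qed
  fix x y assume "x \<in> frontier \<Omega>" "y \<in> frontier \<Omega>"
  then show "dist (g x) (g y) \<le> K * dist x y"
    using le[of x y] le[of y x] by (simp add: dist_real_def dist_commute abs_le_iff)
qed

text \<open>The root test, with a radius strictly between \<open>R\<close> and \<open>\<sigma>\<close>.\<close>

lemma summable_below_radius:
  fixes a :: "nat \<Rightarrow> real"
  assumes a: "\<And>p. 2 \<le> p \<Longrightarrow> 0 \<le> a p" and sigma: "limsup (\<lambda>p. ereal (a p powr (1 / real p))) = ereal (1 / \<sigma>)"
    and R: "0 < R" "R < \<sigma>"
  shows "summable (\<lambda>j. a (j + 2) * R ^ j)"
proof -
  define r where "r = (R + \<sigma>) / 2"
  have r: "0 < r" "R < r" "r < \<sigma>" using R by (auto simp: r_def)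
  have "1 / \<sigma> < 1 / r" using r by (simp add: frac_less2)
  then have "\<forall>\<^sub>F p in sequentially. ereal (a p powr (1 / real p)) < ereal (1 / r)"
    using sigma by (intro Limsup_lessD) simp
  then obtain N where N: "\<And>p. N \<le> p \<Longrightarrow> a p powr (1 / real p) < 1 / r"
    by (auto simp: eventually_sequentially)
  have le: "a p \<le> (1 / r) ^ p" if "N \<le> p" "2 \<le> p" for p
  proof (cases "a p = 0")
    case False
    then have pos: "0 < a p" using a[OF that(2)] by simp
    then have "a p = (a p powr (1 / real p)) powr real p" using that by (simp add: powr_powr)
    also have "\<dots> = (a p powr (1 / real p)) ^ p" using pos by (simp add: powr_realpow)
    also have "\<dots> \<le> (1 / r) ^ p" using N[OF that(1)] by (intro power_mono) auto
    finally show ?thesis .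
  qed (use r in simp)
  show ?thesis
  proof (rule summable_comparison_test'[of "\<lambda>j. (1 / r)\<^sup>2 * (R / r) ^ j" N])
    show "summable (\<lambda>j. (1 / r)\<^sup>2 * (R / r) ^ j)" using r R by (intro summable_mult summable_geometric) simp
    fix j assume j: "N \<le> j"
    have "a (j + 2) * R ^ j \<le> (1 / r) ^ (j + 2) * R ^ j" using j R by (intro mult_right_mono le) auto
    also have "\<dots> = (1 / r)\<^sup>2 * (R / r) ^ j" using r by (simp add: power_add power_divide power2_eq_square)
    finally show "norm (a (j + 2) * R ^ j) \<le> (1 / r)\<^sup>2 * (R / r) ^ j" using a[of "j + 2"] R by simp
  qed
qed

text \<open>The Euler-Lagrange equation of the energy with density \<open>dens c\<close>, tested with Lipschitz functions.\<close>

definition stationary :: "'a::euclidean_space set \<Rightarrow> (nat \<Rightarrow> real) \<Rightarrow> ('a \<Rightarrow> real) \<Rightarrow> bool" where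
  "stationary \<Omega> c w \<longleftrightarrow> (\<forall>L \<psi>. L-lipschitz_on UNIV \<psi> \<longrightarrow> (\<forall>x. x \<notin> \<Omega> \<longrightarrow> \<psi> x = 0) \<longrightarrow>
     (LINT x|lebesgue_on \<Omega>. flux c (grad w x) \<bullet> grad \<psi> x) = 0)"

theorem dirichlet_solution_exists:
  fixes \<Omega> :: "'a::euclidean_space set"
  assumes "open \<Omega>" "bounded \<Omega>" and c: "\<And>j. 0 \<le> c j" "0 < c 0"
    and "K < R" and R: "summable (\<lambda>j. c j * R ^ j)" and bsc: "bounded_slope \<Omega> g K"
  obtains w where "K-lipschitz_on UNIV w" "\<And>x. x \<in> frontier \<Omega> \<Longrightarrow> w x = g x"
    "stationary \<Omega> c w"
proof -
  obtain h where hg: "K-lipschitz_on UNIV h" "\<And>x. x \<in> frontier \<Omega> \<Longrightarrow> h x = g x"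
    using lipschitz_extension[OF bounded_slope_lipschitz[OF bsc]] by blast
  have K: "0 < K" using bsc by (simp add: bounded_slope_def)
  have "bounded_slope \<Omega> h K" using bsc hg(2) by (simp add: bounded_slope_def)
  then interpret dirichlet_problem \<Omega> c K "(K + R) / 2" R h
    using assms hg(1) K by unfold_locales auto
  obtain w where w: "w \<in> admissible" "\<And>v. v \<in> admissible \<Longrightarrow> E w \<le> E v"
    by (rule minimizer_exists) (rule that)
  show ?thesis
  proof (rule that)
    show "K-lipschitz_on UNIV w" by (rule minimizer_lipschitz[OF w])
    show "w x = g x" if "x \<in> frontier \<Omega>" for x
      using that admissibleD(2)[OF w(1)] hg(2) assms(1) by (auto simp: frontier_def interior_open)
    show "stationary \<Omega> c w"
      unfolding stationary_def by (intro allI impI minimizer_Euler_Lagrange[OF w]) auto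
  qed
qed

section \<open>Comparison of energies and the weak formulation\<close>

text \<open>In \<open>dens_convex\<close> from \<open>W\<close> to \<open>U\<close> the first order term integrates to zero, so the integral of the
  quadratic remainder is at most the difference of the energies.\<close>

lemma gradient_eq_if_energy_le:
  fixes U W :: "'b \<Rightarrow> 'a::euclidean_space"
  assumes "finite_measure M" and [measurable]: "U \<in> borel_measurable M" "W \<in> borel_measurable M"
    and W: "AE x in M. norm (W x) \<le> K"
    and c: "\<And>j. 0 \<le> c j" "0 < c 0" and K: "summable (\<lambda>j. c j * K ^ j)"
    and U: "AE x in M. summable (\<lambda>j. c j / real (j + 2) * norm (U x) ^ (j + 2))"
    and Ui: "integrable M (\<lambda>x. dens c (norm (U x)))"
    and le: "(LINT x|M. dens c (norm (U x))) \<le> (LINT x|M. dens c (norm (W x)))"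
    and EL: "integrable M (\<lambda>x. flux c (W x) \<bullet> (U x - W x))" "(LINT x|M. flux c (W x) \<bullet> (U x - W x)) = 0"
  shows "AE x in M. U x = W x"
proof -
  interpret finite_measure M by fact
  have Wi: "integrable M (\<lambda>x. dens c (norm (W x)))"
  proof (rule integrable_const_bound[of _ "dens c K"])
    show "AE x in M. norm (dens c (norm (W x))) \<le> dens c K"
      using W
    proof eventually_elim
      case (elim x)
      then show ?case using dens_mono[OF c(1) K norm_ge_zero elim] by simp
    qed
  qed measurable
  have pw: "AE x in M. c 0 / 2 * (norm (U x - W x))\<^sup>2 \<le> dens c (norm (U x)) - dens c (norm (W x)) - flux c (W x) \<bullet> (U x - W x)"
    using W U
  proof eventually_elim
    case (elim x)
    have "dens c (norm (W x)) + flux c (W x) \<bullet> (U x - W x) + c 0 / 2 * (norm (U x - W x))\<^sup>2 \<le> dens c (norm (U x))"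
      by (rule dens_convex[OF c(1)]) (use dens_summable[OF c(1) K norm_ge_zero elim(1)] elim(2) in blast)+
    then show ?case by simp
  qed
  have ri: "integrable M (\<lambda>x. dens c (norm (U x)) - dens c (norm (W x)) - flux c (W x) \<bullet> (U x - W x))"
    using Ui Wi EL(1) by simp
  have sq: "integrable M (\<lambda>x. c 0 / 2 * (norm (U x - W x))\<^sup>2)"
  proof (rule Bochner_Integration.integrable_bound[OF ri])
    show "AE x in M. norm (c 0 / 2 * (norm (U x - W x))\<^sup>2) \<le> norm (dens c (norm (U x)) - dens c (norm (W x)) - flux c (W x) \<bullet> (U x - W x))"
      using pw
    proof eventually_elim
      case (elim x)
      have "0 \<le> c 0 / 2 * (norm (U x - W x))\<^sup>2" using c(2) by simp
      then show ?case using elim by (simp only: real_norm_def abs_of_nonneg order_trans)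
    qed
  qed measurable
  have "(LINT x|M. c 0 / 2 * (norm (U x - W x))\<^sup>2) \<le> (LINT x|M. dens c (norm (U x)) - dens c (norm (W x)) - flux c (W x) \<bullet> (U x - W x))"
    by (rule integral_mono_AE[OF sq ri pw])
  also have "\<dots> \<le> 0" using Ui Wi EL le by simp
  finally have "(LINT x|M. c 0 / 2 * (norm (U x - W x))\<^sup>2) \<le> 0" .
  moreover have nn: "0 \<le> c 0 / 2 * (norm (U x - W x))\<^sup>2" for x using c(2) by simp
  then have "0 \<le> (LINT x|M. c 0 / 2 * (norm (U x - W x))\<^sup>2)" by (intro integral_nonneg_AE AE_I2)
  ultimately have "AE x in M. c 0 / 2 * (norm (U x - W x))\<^sup>2 = 0"
    using integral_nonneg_eq_0_iff_AE[OF sq] nn by simp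
  then show ?thesis by eventually_elim (use c(2) in simp)
qed

text \<open>The terms are dominated by \<open>c j * K ^ j * (K * L)\<close>, which is summable.\<close>

lemma flux_integral_sums:
  fixes W P :: "'b \<Rightarrow> 'a::euclidean_space"
  assumes "finite_measure M" and [measurable]: "W \<in> borel_measurable M" "P \<in> borel_measurable M"
    and W: "AE x in M. norm (W x) \<le> K" and P: "AE x in M. norm (P x) \<le> L"
    and c: "\<And>j. 0 \<le> c j" and K: "summable (\<lambda>j. c j * K ^ j)"
  shows "(\<lambda>j. c j * (LINT x|M. norm (W x) ^ j * (W x \<bullet> P x))) sums (LINT x|M. flux c (W x) \<bullet> P x)"
proof -
  interpret finite_measure M by fact
  let ?f = "\<lambda>j x. c j * (norm (W x) ^ j * (W x \<bullet> P x))"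
  have b: "AE x in M. \<forall>j. norm (?f j x) \<le> c j * K ^ j * (K * L)"
    using W P
  proof eventually_elim
    case (elim x)
    have "\<bar>W x \<bullet> P x\<bar> \<le> norm (W x) * norm (P x)" by (rule Cauchy_Schwarz_ineq2)
    also have "\<dots> \<le> K * L" using elim order_trans[OF norm_ge_zero elim(1)] by (intro mult_mono) auto
    finally have i: "\<bar>W x \<bullet> P x\<bar> \<le> K * L" .
    show ?case
    proof
      fix j
      have "c j * norm (W x) ^ j \<le> c j * K ^ j" using elim c by (intro mult_left_mono power_mono) auto
      then have "(c j * norm (W x) ^ j) * \<bar>W x \<bullet> P x\<bar> \<le> (c j * K ^ j) * (K * L)"
        using i c[of j] order_trans[OF norm_ge_zero elim(1)]
        by (intro mult_mono[OF _ i] mult_nonneg_nonneg zero_le_power abs_ge_zero) auto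
      then show "norm (?f j x) \<le> c j * K ^ j * (K * L)" using c[of j] by (simp add: abs_mult mult.assoc)
    qed
  qed
  have bj: "AE x in M. norm (?f j x) \<le> c j * K ^ j * (K * L)" for j
    using b by eventually_elim blast
  have i: "integrable M (?f j)" for j
    by (rule integrable_const_bound[OF bj]) measurable
  have S: "summable (\<lambda>j. c j * K ^ j * (K * L))" by (rule summable_mult2[OF K])
  have "(\<lambda>j. LINT x|M. ?f j x) sums (LINT x|M. (\<Sum>j. ?f j x))"
  proof (rule sums_integral[OF i])
    show "AE x in M. summable (\<lambda>j. norm (?f j x))"
      using b by eventually_elim (intro summable_comparison_test'[OF S, of 0], simp)
    show "summable (\<lambda>j. LINT x|M. norm (?f j x))"
    proof (rule summable_comparison_test'[of _ 0])
      show "summable (\<lambda>j. c j * K ^ j * (K * L) * measure M (space M))" by (rule summable_mult2[OF S])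
      fix j
      have "(LINT x|M. norm (?f j x)) \<le> (LINT x|M. c j * K ^ j * (K * L))"
        by (rule integral_mono_AE[OF integrable_norm[OF i] _ bj]) simp
      then show "norm (LINT x|M. norm (?f j x)) \<le> c j * K ^ j * (K * L) * measure M (space M)"
        by (simp add: mult_ac)
    qed
  qed
  moreover have "(LINT x|M. (\<Sum>j. ?f j x)) = (LINT x|M. flux c (W x) \<bullet> P x)"
  proof (rule integral_cong_AE)
    show "AE x in M. (\<Sum>j. ?f j x) = flux c (W x) \<bullet> P x"
      using W
    proof eventually_elim
      case (elim x)
      have "(\<Sum>j. c j * norm (W x) ^ j * (W x \<bullet> P x)) = (\<Sum>j. c j * norm (W x) ^ j) * (W x \<bullet> P x)"
        by (rule suminf_mult2[symmetric]) (rule dens_summable(1)[OF c K norm_ge_zero elim])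
      then show ?case by (simp add: flux_def mult.assoc)
    qed
  qed measurable
  moreover have "(LINT x|M. ?f j x) = c j * (LINT x|M. norm (W x) ^ j * (W x \<bullet> P x))" for j
    by (rule integral_mult_right_zero)
  ultimately show ?thesis by simp
qed

lemma integrable_flux_inner:
  fixes W V :: "'b \<Rightarrow> 'a::euclidean_space"
  assumes [measurable]: "W \<in> borel_measurable M" and W: "AE x in M. norm (W x) \<le> K"
    and c: "\<And>j. 0 \<le> c j" and K: "summable (\<lambda>j. c j * K ^ j)" and V: "integrable M V"
  shows "integrable M (\<lambda>x. flux c (W x) \<bullet> V x)"
    and "\<bar>LINT x|M. flux c (W x) \<bullet> V x\<bar> \<le> (\<Sum>j. c j * K ^ j) * \<bar>K\<bar> * (LINT x|M. norm (V x))"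
proof -
  have [measurable]: "V \<in> borel_measurable M" using V by simp
  let ?F = "(\<Sum>j. c j * K ^ j) * \<bar>K\<bar>"
  have b: "AE x in M. norm (flux c (W x) \<bullet> V x) \<le> ?F * norm (V x)"
    using W
  proof eventually_elim
    case (elim x)
    have "norm (flux c (W x)) \<le> ?F"
      using flux_bound[OF c K elim] order_trans[OF norm_ge_zero elim] by simp
    then have "norm (flux c (W x)) * norm (V x) \<le> ?F * norm (V x)" by (rule mult_right_mono) simp
    then show ?case using Cauchy_Schwarz_ineq2[of "flux c (W x)" "V x"] by simp
  qed
  have Fi: "integrable M (\<lambda>x. ?F * norm (V x))" using V by simp
  show i: "integrable M (\<lambda>x. flux c (W x) \<bullet> V x)"
  proof (rule Bochner_Integration.integrable_bound[OF Fi])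
    show "AE x in M. norm (flux c (W x) \<bullet> V x) \<le> norm (?F * norm (V x))"
      using b by eventually_elim simp
  qed measurable
  have "\<bar>LINT x|M. flux c (W x) \<bullet> V x\<bar> \<le> (LINT x|M. norm (flux c (W x) \<bullet> V x))"
    using integral_norm_bound[of M "\<lambda>x. flux c (W x) \<bullet> V x"] by simp
  also have "\<dots> \<le> (LINT x|M. ?F * norm (V x))" by (rule integral_mono_AE[OF integrable_norm[OF i] Fi b])
  finally show "\<bar>LINT x|M. flux c (W x) \<bullet> V x\<bar> \<le> ?F * (LINT x|M. norm (V x))" by simp
qed

lemma C01_closure_extension:
  fixes v :: "'a::euclidean_space \<Rightarrow> real"
  assumes "C01 (closure \<Omega>) v"
  obtains v' L where "L-lipschitz_on UNIV v'" "\<And>x. x \<in> closure \<Omega> \<Longrightarrow> v' x = v x" "weak_gradient \<Omega> v = weak_gradient \<Omega> v'"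
proof -
  obtain L where "L-lipschitz_on (closure \<Omega>) v" using assms by (auto simp: C01_def)
  then obtain v' where v': "L-lipschitz_on UNIV v'" "\<And>x. x \<in> closure \<Omega> \<Longrightarrow> v' x = v x"
    using lipschitz_extension by blast
  moreover have "weak_gradient \<Omega> v = weak_gradient \<Omega> v'"
    by (rule weak_gradient_cong) (use v'(2) closure_subset in force)
  ultimately show ?thesis using that by blast
qed

lemma C01_zero_boundary_extension:
  fixes v :: "'a::euclidean_space \<Rightarrow> real"
  assumes "C01 (closure \<Omega>) v" "\<And>x. x \<in> frontier \<Omega> \<Longrightarrow> v x = 0"
  obtains L where "L-lipschitz_on UNIV (\<lambda>x. if x \<in> \<Omega> then v x else 0)"
    "weak_gradient \<Omega> v = weak_gradient \<Omega> (\<lambda>x. if x \<in> \<Omega> then v x else 0)"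
proof -
  obtain L where L: "L-lipschitz_on (closure \<Omega>) v" using assms by (auto simp: C01_def)
  have "L-lipschitz_on UNIV (\<lambda>x. if x \<in> \<Omega> then v x else 0)"
    by (rule lipschitz_glue[OF L]) (use lipschitz_on_nonneg[OF L] assms(2) in \<open>auto simp: lipschitz_on_def\<close>)
  moreover have "weak_gradient \<Omega> v = weak_gradient \<Omega> (\<lambda>x. if x \<in> \<Omega> then v x else 0)"
    by (rule weak_gradient_cong) simp
  ultimately show ?thesis using that by blast
qed

lemma Linf_norm_le:
  assumes "V \<in> borel_measurable (lebesgue_on \<Omega>)" "AE x in lebesgue_on \<Omega>. norm (V x) \<le> K"
  shows "Linf_norm \<Omega> V \<le> ereal K"
  unfolding Linf_norm_def using assms by (intro esssup_I) auto

lemma C01_diff: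
  assumes "C01 S v" "C01 S w" shows "C01 S (\<lambda>x. v x - w x)"
  using assms lipschitz_on_diff unfolding C01_def by blast

lemma lipschitz_C01: "L-lipschitz_on UNIV v \<Longrightarrow> C01 S v"
  unfolding C01_def using lipschitz_on_subset by blast

lemma weak_gradient_diff_AE:
  assumes "open \<Omega>" "has_weak_gradient \<Omega> v V" "has_weak_gradient \<Omega> w W"
  shows "AE x in lebesgue_on \<Omega>. weak_gradient \<Omega> (\<lambda>x. v x - w x) x = V x - W x"
proof -
  have h: "has_weak_gradient \<Omega> (\<lambda>x. v x - w x) (\<lambda>x. V x - W x)" by (rule has_weak_gradient_diff[OF assms])
  show ?thesis
    by (rule AE_lebesgue_on[OF assms(1) has_weak_gradient_unique[OF assms(1) has_weak_gradient_weak_gradient[OF h] h]])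
qed

lemma C01_weak_gradient:
  fixes v :: "'a::euclidean_space \<Rightarrow> real"
  assumes "open \<Omega>" "C01 (closure \<Omega>) v"
  obtains L where "has_weak_gradient \<Omega> v (weak_gradient \<Omega> v)" "weak_gradient \<Omega> v \<in> borel_measurable (lebesgue_on \<Omega>)"
    "AE x in lebesgue_on \<Omega>. norm (weak_gradient \<Omega> v x) \<le> L"
proof -
  obtain v' L where v': "L-lipschitz_on UNIV v'" "\<And>x. x \<in> closure \<Omega> \<Longrightarrow> v' x = v x" "weak_gradient \<Omega> v = weak_gradient \<Omega> v'"
    by (rule C01_closure_extension[OF assms(2)]) (rule that)
  have "has_weak_gradient \<Omega> v (weak_gradient \<Omega> v) \<longleftrightarrow> has_weak_gradient \<Omega> v' (weak_gradient \<Omega> v)"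
    by (rule has_weak_gradient_cong) (use v'(2) closure_subset in force)
  then show ?thesis using that weak_gradient_AE_grad(2,3,4)[OF assms(1) v'(1)] v'(3) by metis
qed

lemma W1p_0_cong:
  assumes "\<And>x. x \<in> \<Omega> \<Longrightarrow> v x = v' x"
  shows "v \<in> W1p_0 n \<Omega> \<longleftrightarrow> v' \<in> W1p_0 n \<Omega>"
proof -
  have "v \<in> W1p_0 n \<Omega>" if eq: "\<And>x. x \<in> \<Omega> \<Longrightarrow> v x = v' x" and v': "v' \<in> W1p_0 n \<Omega>" for v v' :: "'a \<Rightarrow> real"
  proof -
    have g: "weak_gradient \<Omega> v = weak_gradient \<Omega> v'" by (rule weak_gradient_cong[OF eq])
    have "v \<in> borel_measurable (lebesgue_on \<Omega>) \<longleftrightarrow> v' \<in> borel_measurable (lebesgue_on \<Omega>)"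
      by (rule measurable_cong) (use eq in simp)
    moreover have "integrable (lebesgue_on \<Omega>) (\<lambda>x. norm (v x) ^ n) \<longleftrightarrow> integrable (lebesgue_on \<Omega>) (\<lambda>x. norm (v' x) ^ n)"
      by (rule Bochner_Integration.integrable_cong) (use eq in auto)
    moreover have "has_weak_gradient \<Omega> v = has_weak_gradient \<Omega> v'" by (rule ext) (rule has_weak_gradient_cong[OF eq])
    moreover have "(LINT x|lebesgue_on \<Omega>. \<bar>v x - \<phi> x\<bar> ^ n) = (LINT x|lebesgue_on \<Omega>. \<bar>v' x - \<phi> x\<bar> ^ n)" for \<phi>
      by (rule Bochner_Integration.integral_cong) (use eq in auto)
    ultimately show ?thesis using v' by (simp add: W1p_0_def W1p_def Lp_space_def g)
  qed
  then show ?thesis using assms by metis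
qed

lemma C01_diff_in_W1p_0:
  fixes v w :: "'a::euclidean_space \<Rightarrow> real"
  assumes \<Omega>: "open \<Omega>" "bounded \<Omega>" and "C01 (closure \<Omega>) v" "C01 (closure \<Omega>) w"
    and "\<And>x. x \<in> frontier \<Omega> \<Longrightarrow> v x = w x" and n: "1 \<le> n"
  shows "(\<lambda>x. v x - w x) \<in> W1p_0 n \<Omega>"
proof -
  obtain L where L: "L-lipschitz_on UNIV (\<lambda>x. if x \<in> \<Omega> then v x - w x else 0)"
    using C01_zero_boundary_extension[OF C01_diff[OF assms(3,4)]] assms(5) by auto
  have "(\<lambda>x. if x \<in> \<Omega> then v x - w x else 0) \<in> W1p_0 n \<Omega>"
    by (rule lipschitz_zero_boundary_in_W1p_0[OF \<Omega> L _ n]) simp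
  then show ?thesis using W1p_0_cong[of \<Omega> "\<lambda>x. v x - w x" "\<lambda>x. if x \<in> \<Omega> then v x - w x else 0" n] by simp
qed

lemma test_function_lipschitz:
  fixes \<phi> :: "'a::euclidean_space \<Rightarrow> real"
  assumes "test_function U \<phi>"
  obtains L where "L-lipschitz_on UNIV \<phi>"
proof -
  note t = test_functionD[OF assms]
  obtain B where B: "0 \<le> B" "\<And>x. norm (gradient \<phi> x) \<le> B"
    using continuous_bounded_support[OF t(3) compact_imp_bounded[OF t(4)] t(7)] by blast
  have "B-lipschitz_on UNIV \<phi>"
  proof (rule lipschitz_onI[OF _ B(1)])
    fix x y :: 'a
    obtain s where s: "\<phi> (y + (x - y)) - \<phi> y = (x - y) \<bullet> gradient \<phi> (y + s *\<^sub>R (x - y))"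
      using GDERIV_mvt[OF GDERIV_gradient[OF t(1)]] by metis
    have "\<bar>(x - y) \<bullet> gradient \<phi> (y + s *\<^sub>R (x - y))\<bar> \<le> norm (x - y) * norm (gradient \<phi> (y + s *\<^sub>R (x - y)))"
      by (rule Cauchy_Schwarz_ineq2)
    also have "\<dots> \<le> norm (x - y) * B" by (intro mult_left_mono B(2)) simp
    finally show "dist (\<phi> x) (\<phi> y) \<le> B * dist x y" using s by (simp add: dist_norm mult.commute)
  qed
  then show ?thesis by (rule that)
qed

text \<open>The flux of \<open>w\<close> is bounded, so testing with the gradient of \<open>v\<close> is continuous in \<open>L\<^sup>1\<close>, and
  test functions approximate \<open>v\<close> in this sense.\<close>

lemma Euler_Lagrange_W1p_0:
  fixes w v :: "'a::euclidean_space \<Rightarrow> real"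
  assumes \<Omega>: "open \<Omega>" "bounded \<Omega>" and c: "\<And>j. 0 \<le> c j" and K: "summable (\<lambda>j. c j * K ^ j)"
    and w: "K-lipschitz_on UNIV w"
    and EL: "stationary \<Omega> c w"
    and n: "1 \<le> n" and v: "v \<in> W1p_0 n \<Omega>"
  shows "integrable (lebesgue_on \<Omega>) (\<lambda>x. flux c (weak_gradient \<Omega> w x) \<bullet> weak_gradient \<Omega> v x)"
    and "(LINT x|lebesgue_on \<Omega>. flux c (weak_gradient \<Omega> w x) \<bullet> weak_gradient \<Omega> v x) = 0"
proof -
  let ?M = "lebesgue_on \<Omega>"
  let ?W = "weak_gradient \<Omega> w" and ?V = "weak_gradient \<Omega> v"
  interpret finite_measure ?M by (rule finite_measure_lebesgue_on_bounded_open[OF \<Omega>])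
  note W = weak_gradient_AE_grad[OF \<Omega>(1) w]
  note fi = integrable_flux_inner[OF W(3,4) c K]
  obtain \<phi> D where \<phi>: "\<And>k. test_function \<Omega> (\<phi> k)" "\<And>k x. GDERIV (\<phi> k) x :> D k x"
    "(\<lambda>k::nat. LINT x|?M. norm (?V x - D k x) ^ n) \<longlonglongrightarrow> 0"
    using v unfolding W1p_0_def by blast
  have D: "D k = gradient (\<phi> k)" for k using gradient_eq[OF \<phi>(2)] by auto
  have Lp: "?V \<in> Lp_space n \<Omega>" "D k \<in> Lp_space n \<Omega>" for k
    using v test_function_Lp[OF \<Omega> \<phi>(1)] by (auto simp: W1p_0_def W1p_def D)
  have meas[measurable]: "?V \<in> borel_measurable ?M" "\<And>k. D k \<in> borel_measurable ?M" using Lp by (auto simp: Lp_space_def)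
  have lower: "integrable ?M (\<lambda>x. norm (?V x - D k x) ^ 1)" "(\<lambda>k. LINT x|?M. norm (?V x - D k x) ^ 1) \<longlonglongrightarrow> 0" for k
    by (rule Lp_null_imp_lower_null[OF finite_measure_axioms order_refl n];
        use Lp_space_diff_integrable[OF Lp] \<phi>(3) in simp)+
  have Di: "integrable ?M (D k)" for k
  proof -
    note t = test_functionD[OF \<phi>(1)[of k]]
    have "integrable lebesgue (D k)"
      unfolding D by (rule integrable_continuous_bounded_support[OF t(3) compact_imp_bounded[OF t(4)] t(7)])
    then show ?thesis using \<Omega>(1) by (intro integrable_mult_indicator[THEN integrable_restrict_space[THEN iffD2, rotated]]) auto
  qed
  have di: "integrable ?M (\<lambda>x. ?V x - D k x)" for k
    using lower(1)[of k] by (subst integrable_norm_iff[symmetric]) auto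
  have Vi: "integrable ?M ?V" using Bochner_Integration.integrable_add[OF di[of 0] Di[of 0]] by simp
  show "integrable ?M (\<lambda>x. flux c (?W x) \<bullet> ?V x)" by (rule fi(1)[OF Vi])
  have zero: "(LINT x|?M. flux c (?W x) \<bullet> D k x) = 0" for k
  proof -
    obtain L where L: "L-lipschitz_on UNIV (\<phi> k)" using test_function_lipschitz[OF \<phi>(1)] by blast
    have "AE x in lebesgue. grad (\<phi> k) x = D k x"
      unfolding D using test_functionD(1,3)[OF \<phi>(1)] by (intro grad_AE_eq has_weak_gradient_C1 GDERIV_gradient)
    then have g: "AE x in ?M. grad (\<phi> k) x = D k x" by (intro AE_lebesgue_on[OF \<Omega>(1)]) auto
    have [measurable]: "grad (\<phi> k) \<in> borel_measurable ?M" "grad w \<in> borel_measurable ?M" "?W \<in> borel_measurable ?M"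
      by (intro measurable_restrict_space1 grad_measurable[OF L] grad_measurable[OF w] W(3))+
    have "(LINT x|?M. flux c (?W x) \<bullet> D k x) = (LINT x|?M. flux c (grad w x) \<bullet> grad (\<phi> k) x)"
    proof (rule integral_cong_AE)
      show "AE x in ?M. flux c (?W x) \<bullet> D k x = flux c (grad w x) \<bullet> grad (\<phi> k) x"
        using g W(1) by eventually_elim simp
    qed measurable
    also have "\<dots> = 0" using EL L test_functionD(8)[OF \<phi>(1)[of k]] unfolding stationary_def by blast
    finally show ?thesis .
  qed
  let ?F = "(\<Sum>j. c j * K ^ j) * \<bar>K\<bar>"
  have "\<bar>LINT x|?M. flux c (?W x) \<bullet> ?V x\<bar> \<le> ?F * (LINT x|?M. norm (?V x - D k x))" for k
  proof -
    have "(LINT x|?M. flux c (?W x) \<bullet> ?V x) = (LINT x|?M. flux c (?W x) \<bullet> (?V x - D k x))"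
      using fi(1)[OF Vi] fi(1)[OF Di[of k]] zero[of k] by (simp add: inner_diff_right)
    then show ?thesis using fi(2)[OF di[of k]] by simp
  qed
  moreover have "(\<lambda>k. ?F * (LINT x|?M. norm (?V x - D k x))) \<longlonglongrightarrow> ?F * 0"
    using lower(2) by (intro tendsto_mult tendsto_const) simp
  ultimately have "\<bar>LINT x|?M. flux c (?W x) \<bullet> ?V x\<bar> \<le> ?F * 0" by (intro LIMSEQ_le_const) auto
  then show "(LINT x|?M. flux c (?W x) \<bullet> ?V x) = 0" by simp
qed

text \<open>The series of the forms may be summed under the integral, where it becomes the flux.\<close>

lemma p_form_sums_zero:
  fixes w u :: "'a::euclidean_space \<Rightarrow> real"
  assumes \<Omega>: "open \<Omega>" "bounded \<Omega>" and c: "\<And>j. 0 \<le> c j" and K: "summable (\<lambda>j. c j * K ^ j)"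
    and w: "K-lipschitz_on UNIV w"
    and EL: "stationary \<Omega> c w"
    and u: "weak_gradient \<Omega> u \<in> borel_measurable (lebesgue_on \<Omega>)"
      "AE x in lebesgue_on \<Omega>. weak_gradient \<Omega> u x = weak_gradient \<Omega> w x"
    and \<psi>: "\<psi> \<in> W1inf_0 \<Omega>"
  shows "(\<lambda>j. c j * p_form \<Omega> (j + 2) u \<psi>) sums 0"
proof -
  let ?M = "lebesgue_on \<Omega>"
  have fm: "finite_measure ?M" by (rule finite_measure_lebesgue_on_bounded_open[OF \<Omega>])
  note W = weak_gradient_AE_grad[OF \<Omega>(1) w]
  have \<psi>': "C01 (closure \<Omega>) \<psi>" "\<And>x. x \<in> frontier \<Omega> \<Longrightarrow> \<psi> x = 0" using \<psi> by (auto simp: W1inf_0_def)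
  obtain L where L: "weak_gradient \<Omega> \<psi> \<in> borel_measurable ?M" "AE x in ?M. norm (weak_gradient \<Omega> \<psi> x) \<le> L"
    by (rule C01_weak_gradient[OF \<Omega>(1) \<psi>'(1)]) (rule that)
  have "AE x in ?M. norm (weak_gradient \<Omega> u x) \<le> K" using u(2) W(4) by eventually_elim simp
  from flux_integral_sums[OF fm u(1) L(1) this L(2) c K]
  have "(\<lambda>j. c j * p_form \<Omega> (j + 2) u \<psi>) sums (LINT x|?M. flux c (weak_gradient \<Omega> u x) \<bullet> weak_gradient \<Omega> \<psi> x)"
    by (simp add: p_form_def)
  moreover have "(LINT x|?M. flux c (weak_gradient \<Omega> u x) \<bullet> weak_gradient \<Omega> \<psi> x) =
      (LINT x|?M. flux c (weak_gradient \<Omega> w x) \<bullet> weak_gradient \<Omega> \<psi> x)"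
  proof (rule integral_cong_AE)
    note [measurable] = u(1) L(1) W(3)
    show "(\<lambda>x. flux c (weak_gradient \<Omega> u x) \<bullet> weak_gradient \<Omega> \<psi> x) \<in> borel_measurable ?M"
      "(\<lambda>x. flux c (weak_gradient \<Omega> w x) \<bullet> weak_gradient \<Omega> \<psi> x) \<in> borel_measurable ?M" by measurable
    show "AE x in ?M. flux c (weak_gradient \<Omega> u x) \<bullet> weak_gradient \<Omega> \<psi> x = flux c (weak_gradient \<Omega> w x) \<bullet> weak_gradient \<Omega> \<psi> x"
      using u(2) by eventually_elim simp
  qed
  moreover have "(\<lambda>x. \<psi> x - 0) \<in> W1p_0 1 \<Omega>"
    by (rule C01_diff_in_W1p_0[OF \<Omega> \<psi>'(1)]) (use \<psi>'(2) in \<open>auto simp: C01_def intro: exI[of _ 0] lipschitz_on_constant\<close>)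
  then have "\<psi> \<in> W1p_0 1 \<Omega>" by simp
  from Euler_Lagrange_W1p_0(2)[OF \<Omega> c K w EL order_refl this]
  have "(LINT x|?M. flux c (weak_gradient \<Omega> w x) \<bullet> weak_gradient \<Omega> \<psi> x) = 0" .
  ultimately show ?thesis by simp
qed

lemma energy_eq:
  assumes "\<And>x. x \<in> \<Omega> \<Longrightarrow> f x = 0"
  shows "energy \<Omega> a \<sigma> f v = enn2ereal (\<integral>\<^sup>+x. G a \<sigma> (weak_gradient \<Omega> v x) \<partial>lebesgue_on \<Omega>)"
    and "truncated_energy \<Omega> a n f v = (\<Sum>p=2..n. a p / real p * (LINT x|lebesgue_on \<Omega>. norm (weak_gradient \<Omega> v x) ^ p))"
proof -
  have "(LINT x|lebesgue_on \<Omega>. f x * v x) = (LINT x|lebesgue_on \<Omega>. 0)"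
    by (rule Bochner_Integration.integral_cong) (use assms in auto)
  then have 0: "(LINT x|lebesgue_on \<Omega>. f x * v x) = 0" by simp
  show "energy \<Omega> a \<sigma> f v = enn2ereal (\<integral>\<^sup>+x. G a \<sigma> (weak_gradient \<Omega> v x) \<partial>lebesgue_on \<Omega>)"
    unfolding energy_def 0 by simp
  show "truncated_energy \<Omega> a n f v = (\<Sum>p=2..n. a p / real p * (LINT x|lebesgue_on \<Omega>. norm (weak_gradient \<Omega> v x) ^ p))"
    unfolding truncated_energy_def 0 by simp
qed

lemma sums_truncated:
  fixes a x :: "nat \<Rightarrow> real"
  assumes "2 \<le> n"
  shows "(\<lambda>j. (if j + 2 \<le> n then a (j + 2) else 0) * x (j + 2)) sums (\<Sum>p=2..n. a p * x p)"
proof -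
  have "(\<lambda>j. (if j + 2 \<le> n then a (j + 2) else 0) * x (j + 2)) sums (\<Sum>j\<in>{..n-2}. (if j + 2 \<le> n then a (j + 2) else 0) * x (j + 2))"
    by (rule sums_finite) (use assms in auto)
  also have "(\<Sum>j\<in>{..n-2}. (if j + 2 \<le> n then a (j + 2) else 0) * x (j + 2)) = (\<Sum>p=2..n. a p * x p)"
    by (rule sum.reindex_bij_witness[of _ "\<lambda>p. p - 2" "\<lambda>j. j + 2"]) (use assms in auto)
  finally show ?thesis .
qed

lemma Phi_dens:
  assumes a: "\<And>p. 2 \<le> p \<Longrightarrow> 0 \<le> a p" and t: "0 \<le> t"
  shows "Phi a t \<noteq> \<infinity> \<Longrightarrow> summable (\<lambda>j. a (j + 2) / real (j + 2) * t ^ (j + 2))"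
    and "summable (\<lambda>j. a (j + 2) / real (j + 2) * t ^ (j + 2)) \<Longrightarrow> Phi a t = ennreal (dens (\<lambda>j. a (j + 2)) t)"
proof -
  have nn: "0 \<le> a (j + 2) / real (j + 2) * t ^ (j + 2)" for j using a[of "j + 2"] t by simp
  show "Phi a t \<noteq> \<infinity> \<Longrightarrow> summable (\<lambda>j. a (j + 2) / real (j + 2) * t ^ (j + 2))"
    unfolding Phi_def by (rule summable_suminf_not_top[OF nn]) simp
  show "summable (\<lambda>j. a (j + 2) / real (j + 2) * t ^ (j + 2)) \<Longrightarrow> Phi a t = ennreal (dens (\<lambda>j. a (j + 2)) t)"
    unfolding Phi_def dens_def by (rule suminf_ennreal2[OF nn])
qed

text \<open>Finite energy of \<open>u\<close> confines its gradient, almost everywhere, to the set where the series of the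
  density converges; there the extended-valued density of the energy coincides with \<open>dens\<close>.\<close>

lemma energy_minimizer_gradient:
  fixes u w :: "'a::euclidean_space \<Rightarrow> real"
  assumes \<Omega>: "open \<Omega>" "bounded \<Omega>" and a: "\<And>p. 2 \<le> p \<Longrightarrow> 0 \<le> a p" "0 < a 2"
    and K: "summable (\<lambda>j. a (j + 2) * K ^ j)" "K \<le> \<sigma>"
    and w: "K-lipschitz_on UNIV w"
    and EL: "stationary \<Omega> (\<lambda>j. a (j + 2)) w"
    and u: "C01 (closure \<Omega>) u" "\<And>x. x \<in> frontier \<Omega> \<Longrightarrow> u x = w x"
    and le: "(\<integral>\<^sup>+x. G a \<sigma> (weak_gradient \<Omega> u x) \<partial>lebesgue_on \<Omega>) \<le> (\<integral>\<^sup>+x. G a \<sigma> (weak_gradient \<Omega> w x) \<partial>lebesgue_on \<Omega>)"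
  shows "AE x in lebesgue_on \<Omega>. weak_gradient \<Omega> u x = weak_gradient \<Omega> w x"
proof -
  let ?M = "lebesgue_on \<Omega>" and ?c = "\<lambda>j. a (j + 2)"
  let ?U = "weak_gradient \<Omega> u" and ?W = "weak_gradient \<Omega> w"
  have fm: "finite_measure ?M" by (rule finite_measure_lebesgue_on_bounded_open[OF \<Omega>])
  interpret finite_measure ?M by (rule fm)
  have c: "0 \<le> ?c j" "0 < ?c 0" for j using a(1)[of "j + 2"] a(2) by (simp_all add: numeral_2_eq_2)
  note W = weak_gradient_AE_grad[OF \<Omega>(1) w]
  obtain Lu where U: "has_weak_gradient \<Omega> u ?U" "?U \<in> borel_measurable ?M"
    by (rule C01_weak_gradient[OF \<Omega>(1) u(1)]) (rule that)
  note [measurable] = U(2) W(3)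
  have Wi: "integrable ?M (\<lambda>x. dens ?c (norm (?W x)))"
  proof (rule integrable_const_bound[of _ "dens ?c K"])
    show "AE x in ?M. norm (dens ?c (norm (?W x))) \<le> dens ?c K"
      using W(4)
    proof eventually_elim
      case (elim x)
      then show ?case using dens_mono[of ?c, OF c(1) K(1) norm_ge_zero elim] by simp
    qed
  qed measurable
  have Wnn: "AE x in ?M. 0 \<le> dens ?c (norm (?W x))"
    using W(4) by eventually_elim (rule dens_mono(1)[of ?c, OF c(1) K(1) norm_ge_zero]; simp)
  have GW: "(\<integral>\<^sup>+x. G a \<sigma> (?W x) \<partial>?M) = ennreal (LINT x|?M. dens ?c (norm (?W x)))"
  proof -
    have "(\<integral>\<^sup>+x. G a \<sigma> (?W x) \<partial>?M) = (\<integral>\<^sup>+x. ennreal (dens ?c (norm (?W x))) \<partial>?M)"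
    proof (rule nn_integral_cong_AE)
      show "AE x in ?M. G a \<sigma> (?W x) = ennreal (dens ?c (norm (?W x)))"
        using W(4)
      proof eventually_elim
        case (elim x)
        have "Phi a (norm (?W x)) = ennreal (dens ?c (norm (?W x)))"
          by (rule Phi_dens(2)[OF a(1) norm_ge_zero dens_summable(2)[of ?c, OF c(1) K(1) norm_ge_zero elim]])
        then show ?case using elim K(2) by (simp add: G_def)
      qed
    qed
    also have "\<dots> = ennreal (LINT x|?M. dens ?c (norm (?W x)))" by (rule nn_integral_eq_integral[OF Wi Wnn])
    finally show ?thesis .
  qed
  have Gm: "(\<lambda>x. G a \<sigma> (?U x)) \<in> borel_measurable ?M"
    unfolding G_def Phi_def by measurable
  have fin: "(\<integral>\<^sup>+x. G a \<sigma> (?U x) \<partial>?M) \<noteq> \<infinity>" using le unfolding GW by (auto simp: top_unique)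
  have AEfin: "AE x in ?M. G a \<sigma> (?U x) \<noteq> \<infinity>" by (rule nn_integral_PInf_AE[OF Gm fin])
  have S: "AE x in ?M. summable (\<lambda>j. ?c j / real (j + 2) * norm (?U x) ^ (j + 2))"
    using AEfin
  proof eventually_elim
    case (elim x)
    then have "Phi a (norm (?U x)) \<noteq> \<infinity>" by (auto simp: G_def split: if_splits)
    from Phi_dens(1)[OF _ norm_ge_zero this] a(1) show ?case by blast
  qed
  have GU: "AE x in ?M. G a \<sigma> (?U x) = ennreal (dens ?c (norm (?U x)))"
    using AEfin S
  proof eventually_elim
    case (elim x)
    then have "G a \<sigma> (?U x) = Phi a (norm (?U x))" by (auto simp: G_def split: if_splits)
    then show ?case using Phi_dens(2)[OF a(1) norm_ge_zero elim(2)] by simp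
  qed
  have Unn: "AE x in ?M. 0 \<le> dens ?c (norm (?U x))"
    using S by eventually_elim (unfold dens_def, rule suminf_nonneg, use c in auto)
  have Ule: "(\<integral>\<^sup>+x. ennreal (dens ?c (norm (?U x))) \<partial>?M) \<le> ennreal (LINT x|?M. dens ?c (norm (?W x)))"
    using le nn_integral_cong_AE[OF GU] unfolding GW by simp
  have Ui: "integrable ?M (\<lambda>x. dens ?c (norm (?U x)))"
    by (rule integrableI_nonneg[OF _ Unn]) (measurable, use Ule in \<open>auto simp: less_top[symmetric] top_unique\<close>)
  have "(LINT x|?M. dens ?c (norm (?U x))) \<le> (LINT x|?M. dens ?c (norm (?W x)))"
    using Ule nn_integral_eq_integral[OF Ui Unn] integral_nonneg_AE[OF Wnn] by (simp add: ennreal_le_iff)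
  note * = gradient_eq_if_energy_le[OF fm U(2) W(3,4), of ?c, OF c K(1) S Ui this]
  have d: "(\<lambda>x. u x - w x) \<in> W1p_0 1 \<Omega>"
    by (rule C01_diff_in_W1p_0[OF \<Omega> u(1) lipschitz_C01[OF w] u(2)]) auto
  have dg: "AE x in ?M. weak_gradient \<Omega> (\<lambda>x. u x - w x) x = ?U x - ?W x"
    by (rule weak_gradient_diff_AE[OF \<Omega>(1) U(1) W(2)])
  note ELd = Euler_Lagrange_W1p_0[of \<Omega> ?c, OF \<Omega> c(1) K(1) w EL order_refl d]
  have dm[measurable]: "weak_gradient \<Omega> (\<lambda>x. u x - w x) \<in> borel_measurable ?M"
    using d by (auto simp: W1p_0_def W1p_def Lp_space_def)
  have eqAE: "AE x in ?M. flux ?c (?W x) \<bullet> weak_gradient \<Omega> (\<lambda>x. u x - w x) x = flux ?c (?W x) \<bullet> (?U x - ?W x)"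
    using dg by eventually_elim simp
  show ?thesis
  proof (rule *)
    show "integrable ?M (\<lambda>x. flux ?c (?W x) \<bullet> (?U x - ?W x))"
      using ELd(1) by (rule integrable_cong_AE_imp) (measurable, use eqAE in \<open>eventually_elim, simp\<close>)
    show "(LINT x|?M. flux ?c (?W x) \<bullet> (?U x - ?W x)) = 0"
      using ELd(2) integral_cong_AE[OF _ _ eqAE] by simp
  qed
qed

lemma truncated_minimizer_gradient:
  fixes v w gbar :: "'a::euclidean_space \<Rightarrow> real"
  assumes \<Omega>: "open \<Omega>" "bounded \<Omega>" and a: "\<And>p. 2 \<le> p \<Longrightarrow> 0 \<le> a p" "0 < a 2" and n: "2 \<le> n"
    and c_def: "c = (\<lambda>j. if j + 2 \<le> n then a (j + 2) else 0)"
    and w: "K-lipschitz_on UNIV w"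
    and EL: "stationary \<Omega> c w"
    and gbar: "C01 (closure \<Omega>) gbar" "\<And>x. x \<in> frontier \<Omega> \<Longrightarrow> gbar x = w x"
    and v: "v \<in> truncated_class \<Omega> n gbar"
    and le: "(\<Sum>p=2..n. a p / real p * (LINT x|lebesgue_on \<Omega>. norm (weak_gradient \<Omega> v x) ^ p))
      \<le> (\<Sum>p=2..n. a p / real p * (LINT x|lebesgue_on \<Omega>. norm (weak_gradient \<Omega> w x) ^ p))"
  shows "AE x in lebesgue_on \<Omega>. weak_gradient \<Omega> v x = weak_gradient \<Omega> w x" "AE x in lebesgue_on \<Omega>. w x = v x"
proof -
  let ?M = "lebesgue_on \<Omega>"
  let ?V = "weak_gradient \<Omega> v" and ?W = "weak_gradient \<Omega> w"
  have fm: "finite_measure ?M" by (rule finite_measure_lebesgue_on_bounded_open[OF \<Omega>])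
  interpret finite_measure ?M by (rule fm)
  have n1: "1 \<le> n" using n by simp
  have c: "0 \<le> c j" "0 < c 0" for j using a(1)[of "j + 2"] a(2) n by (simp_all add: c_def numeral_2_eq_2)
  have K: "summable (\<lambda>j. c j * K ^ j)" by (rule summable_finite[of "{..n}"]) (auto simp: c_def)
  note W = weak_gradient_AE_grad[OF \<Omega>(1) w]
  have wW: "w \<in> W1p n \<Omega>" by (rule lipschitz_in_W1p[OF \<Omega> w])
  have vW: "v \<in> W1p n \<Omega>" and vg: "(\<lambda>x. v x - gbar x) \<in> W1p_0 n \<Omega>" using v by (auto simp: truncated_class_def)
  have wg: "(\<lambda>x. w x - gbar x) \<in> W1p_0 n \<Omega>"
    by (rule C01_diff_in_W1p_0[OF \<Omega> lipschitz_C01[OF w] gbar(1) _ n1]) (use gbar(2) in simp)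
  have V: "has_weak_gradient \<Omega> v ?V" "?V \<in> Lp_space n \<Omega>"
    using vW has_weak_gradient_weak_gradient by (auto simp: W1p_def)
  have WLp: "?W \<in> Lp_space n \<Omega>" using wW by (simp add: W1p_def)
  obtain Lg where Gb: "has_weak_gradient \<Omega> gbar (weak_gradient \<Omega> gbar)"
    by (rule C01_weak_gradient[OF \<Omega>(1) gbar(1)]) (rule that)
  have Vm[measurable]: "?V \<in> borel_measurable ?M" using V(2) by (simp add: Lp_space_def)
  note [measurable] = W(3)
  have dens_c: "dens c t = (\<Sum>p=2..n. a p / real p * t ^ p)" for t
  proof -
    have "(\<lambda>j. (if j + 2 \<le> n then a (j + 2) else 0) * (t ^ (j + 2) / real (j + 2))) sums (\<Sum>p=2..n. a p * (t ^ p / real p))"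
      by (rule sums_truncated[OF n, of a "\<lambda>p. t ^ p / real p"])
    then show ?thesis by (simp add: dens_def c_def sums_iff)
  qed
  have int_p: "integrable ?M (\<lambda>x. norm (Z x) ^ p)" if "Z \<in> Lp_space n \<Omega>" "p \<le> n" for Z :: "'a \<Rightarrow> 'a" and p
  proof (rule Bochner_Integration.integrable_bound)
    have [measurable]: "Z \<in> borel_measurable ?M" using that(1) by (simp add: Lp_space_def)
    show "integrable ?M (\<lambda>x. 1 + norm (Z x) ^ n)" using that(1) by (simp add: Lp_space_def)
    show "(\<lambda>x. norm (Z x) ^ p) \<in> borel_measurable ?M" by measurable
    have "t ^ p \<le> 1 + t ^ n" if "0 \<le> t" for t :: real
    proof (cases "t \<le> 1")
      case True
      then have "t ^ p \<le> 1" using that by (simp add: power_le_one)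
      then show ?thesis using that by (simp add: add_increasing2)
    next
      case False
      then have "t ^ p \<le> t ^ n" using \<open>p \<le> n\<close> by (intro power_increasing) auto
      then show ?thesis by simp
    qed
    then show "AE x in ?M. norm (norm (Z x) ^ p) \<le> norm (1 + norm (Z x) ^ n)" by (intro AE_I2) (simp add: abs_of_nonneg)
  qed
  have dens_int: "integrable ?M (\<lambda>x. dens c (norm (Z x)))"
    "(LINT x|?M. dens c (norm (Z x))) = (\<Sum>p=2..n. a p / real p * (LINT x|?M. norm (Z x) ^ p))"
    if Z: "Z \<in> Lp_space n \<Omega>" for Z :: "'a \<Rightarrow> 'a"
    unfolding dens_c using int_p[OF Z] by (auto intro!: Bochner_Integration.integrable_sum)
  have S: "AE x in ?M. summable (\<lambda>j. c j / real (j + 2) * norm (?V x) ^ (j + 2))"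
    by (intro AE_I2 summable_finite[of "{..n}"]) (auto simp: c_def)
  have le': "(LINT x|?M. dens c (norm (?V x))) \<le> (LINT x|?M. dens c (norm (?W x)))"
    using le dens_int(2)[OF V(2)] dens_int(2)[OF WLp] by simp
  have d1: "AE x in ?M. weak_gradient \<Omega> (\<lambda>x. v x - gbar x) x = ?V x - weak_gradient \<Omega> gbar x"
    by (rule weak_gradient_diff_AE[OF \<Omega>(1) V(1) Gb])
  have d2: "AE x in ?M. weak_gradient \<Omega> (\<lambda>x. w x - gbar x) x = ?W x - weak_gradient \<Omega> gbar x"
    by (rule weak_gradient_diff_AE[OF \<Omega>(1) W(2) Gb])
  note E1 = Euler_Lagrange_W1p_0[OF \<Omega> c(1) K w EL n1 vg] and E2 = Euler_Lagrange_W1p_0[OF \<Omega> c(1) K w EL n1 wg]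
  have [measurable]: "weak_gradient \<Omega> (\<lambda>x. v x - gbar x) \<in> borel_measurable ?M" "weak_gradient \<Omega> (\<lambda>x. w x - gbar x) \<in> borel_measurable ?M"
    using vg wg by (auto simp: W1p_0_def W1p_def Lp_space_def)
  have eqAE: "AE x in ?M. flux c (?W x) \<bullet> weak_gradient \<Omega> (\<lambda>x. v x - gbar x) x - flux c (?W x) \<bullet> weak_gradient \<Omega> (\<lambda>x. w x - gbar x) x
      = flux c (?W x) \<bullet> (?V x - ?W x)"
    using d1 d2 by eventually_elim (simp add: inner_diff_right)
  show grads: "AE x in ?M. ?V x = ?W x"
  proof (rule gradient_eq_if_energy_le[OF fm Vm W(3,4) c K S dens_int(1)[OF V(2)] le'])
    show "integrable ?M (\<lambda>x. flux c (?W x) \<bullet> (?V x - ?W x))"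
      using Bochner_Integration.integrable_diff[OF E1(1) E2(1)]
      by (rule integrable_cong_AE_imp) (measurable, use eqAE in \<open>eventually_elim, simp\<close>)
    have "(LINT x|?M. flux c (?W x) \<bullet> (?V x - ?W x)) =
        (LINT x|?M. flux c (?W x) \<bullet> weak_gradient \<Omega> (\<lambda>x. v x - gbar x) x - flux c (?W x) \<bullet> weak_gradient \<Omega> (\<lambda>x. w x - gbar x) x)"
      by (rule integral_cong_AE[symmetric, OF _ _ eqAE]; measurable)
    also have "\<dots> = 0" using E1 E2 by (simp only: Bochner_Integration.integral_diff diff_self)
    finally show "(LINT x|?M. flux c (?W x) \<bullet> (?V x - ?W x)) = 0" .
  qed
  have "AE x in ?M. v x - gbar x = w x - gbar x"
    by (rule W1p_0_eqI[OF \<Omega> n vg wg]) (use d1 d2 grads in eventually_elim, simp)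
  then show "AE x in ?M. w x = v x" by eventually_elim simp
qed

theorem theorem4p5:
  fixes \<Omega> :: "'a::euclidean_space set"
    and a :: "nat \<Rightarrow> real"
    and \<sigma> K :: real
    and f g gbar u :: "'a \<Rightarrow> real"
  assumes "open \<Omega>" and "bounded \<Omega>" and "connected \<Omega>" and "lipschitz_boundary \<Omega>"
    and a_nonneg: "\<And>p. p \<ge> 2 \<Longrightarrow> a p \<ge> 0"
    and a2: "a 2 > 0"
    and a_inf: "infinite {p. p \<ge> 2 \<and> a p \<noteq> 0}"
    and sigma_pos: "\<sigma> > 0"
    and sigma: "limsup (\<lambda>p. ereal (a p powr (1 / real p))) = ereal (1 / \<sigma>)"
    and f_zero: "\<And>x. x \<in> \<Omega> \<Longrightarrow> f x = 0"
    and g_Lip: "C01 (frontier \<Omega>) g"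
    and bsc: "bounded_slope \<Omega> g K"
    and K_less: "K < \<sigma>"
    and gbar: "gbar \<in> S_class \<Omega> \<sigma> g" "energy \<Omega> a \<sigma> f gbar < \<infinity>"
    and u_min: "is_arg_min (energy \<Omega> a \<sigma> f) (\<lambda>v. v \<in> S_class \<Omega> \<sigma> g) u"
  shows "(Linf_norm \<Omega> (weak_gradient \<Omega> u) \<le> ereal K \<and> K < \<sigma> \<and>
          weak_solution \<Omega> a \<sigma> f g u) \<and>
         (\<forall>n\<ge>2. \<forall>un.
            is_arg_min (truncated_energy \<Omega> a n f) (\<lambda>v. v \<in> truncated_class \<Omega> n gbar) un \<longrightarrow>
              Linf_norm \<Omega> (weak_gradient \<Omega> un) \<le> ereal K \<and> K < \<sigma> \<and>
              (\<exists>w. (AE x in lebesgue_on \<Omega>. w x = un x) \<and>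
                   truncated_weak_solution \<Omega> a \<sigma> n f g w))"
proof (intro conjI allI impI K_less)
  note \<Omega> = assms(1,2)
  have K0: "0 < K" using bsc by (simp add: bounded_slope_def)
  have f0: "(LINT x|lebesgue_on \<Omega>. f x * \<psi> x) = 0" for \<psi> :: "'a \<Rightarrow> real"
  proof -
    have "(LINT x|lebesgue_on \<Omega>. f x * \<psi> x) = (LINT x|lebesgue_on \<Omega>. 0)"
      by (rule Bochner_Integration.integral_cong) (use f_zero in auto)
    then show ?thesis by simp
  qed
  have S_class: "w \<in> S_class \<Omega> \<sigma> g"
    if w: "K-lipschitz_on UNIV w" "\<And>x. x \<in> frontier \<Omega> \<Longrightarrow> w x = g x" for w
  proof -
    have "Linf_norm \<Omega> (weak_gradient \<Omega> w) \<le> ereal K"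
      by (rule Linf_norm_le[OF weak_gradient_AE_grad(3,4)[OF \<Omega>(1) w(1)]])
    then have "Linf_norm \<Omega> (weak_gradient \<Omega> w) \<le> ereal \<sigma>" using K_less by (meson ereal_less_eq(3) less_imp_le order_trans)
    then show ?thesis using lipschitz_C01[OF w(1)] w(2) by (simp add: S_class_def)
  qed
  {
    define R where "R = (K + \<sigma>) / 2"
    have R: "0 < R" "K < R" "R < \<sigma>" using K0 K_less by (auto simp: R_def)
    define c where "c j = a (j + 2)" for j
    have c: "0 \<le> c j" "0 < c 0" for j using a_nonneg[of "j + 2"] a2 by (simp_all add: c_def numeral_2_eq_2)
    have cR: "summable (\<lambda>j. c j * R ^ j)"
      unfolding c_def by (rule summable_below_radius[OF a_nonneg sigma R(1,3)])
    have cK: "summable (\<lambda>j. c j * K ^ j)" by (rule dens_summable(1)[OF c(1) cR]) (use K0 R in auto)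
    obtain w where w: "K-lipschitz_on UNIV w" "\<And>x. x \<in> frontier \<Omega> \<Longrightarrow> w x = g x"
      and EL: "stationary \<Omega> c w"
      by (rule dirichlet_solution_exists[OF \<Omega> c R(2) cR bsc]) (rule that)
    have u: "u \<in> S_class \<Omega> \<sigma> g" "\<not> energy \<Omega> a \<sigma> f w < energy \<Omega> a \<sigma> f u"
      using u_min S_class[OF w] by (auto simp: is_arg_min_def)
    have uC: "C01 (closure \<Omega>) u" "\<And>x. x \<in> frontier \<Omega> \<Longrightarrow> u x = w x"
      using u(1) w(2) by (auto simp: S_class_def)
    have "(\<integral>\<^sup>+x. G a \<sigma> (weak_gradient \<Omega> u x) \<partial>lebesgue_on \<Omega>) \<le> (\<integral>\<^sup>+x. G a \<sigma> (weak_gradient \<Omega> w x) \<partial>lebesgue_on \<Omega>)"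
      using u(2) energy_eq(1)[of \<Omega> f a \<sigma>] f_zero by (simp add: not_less less_eq_ennreal.rep_eq)
    then have eq: "AE x in lebesgue_on \<Omega>. weak_gradient \<Omega> u x = weak_gradient \<Omega> w x"
      using K_less
      by (intro energy_minimizer_gradient[OF \<Omega> a_nonneg a2 cK[unfolded c_def] _ w(1) EL[unfolded c_def] uC]) auto
    obtain Lu where um: "weak_gradient \<Omega> u \<in> borel_measurable (lebesgue_on \<Omega>)"
      by (rule C01_weak_gradient[OF \<Omega>(1) uC(1)]) (rule that)
    have "AE x in lebesgue_on \<Omega>. norm (weak_gradient \<Omega> u x) \<le> K"
      using eq weak_gradient_AE_grad(4)[OF \<Omega>(1) w(1)] by eventually_elim simp
    then show "Linf_norm \<Omega> (weak_gradient \<Omega> u) \<le> ereal K" by (rule Linf_norm_le[OF um])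
    have "(\<lambda>j. c j * p_form \<Omega> (j + 2) u \<psi>) sums 0" if "\<psi> \<in> W1inf_0 \<Omega>" for \<psi>
      by (rule p_form_sums_zero[OF \<Omega> c(1) cK w(1) EL um eq that])
    then show "weak_solution \<Omega> a \<sigma> f g u"
      using u(1) f0 by (auto simp: weak_solution_def c_def sums_iff)
  }
  fix n :: nat and un
  assume n: "2 \<le> n" and un: "is_arg_min (truncated_energy \<Omega> a n f) (\<lambda>v. v \<in> truncated_class \<Omega> n gbar) un"
  define c where "c = (\<lambda>j. if j + 2 \<le> n then a (j + 2) else 0)"
  have c: "0 \<le> c j" "0 < c 0" for j using a_nonneg[of "j + 2"] a2 n by (simp_all add: c_def numeral_2_eq_2)
  have cR: "summable (\<lambda>j. c j * t ^ j)" for t by (rule summable_finite[of "{..n}"]) (auto simp: c_def)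
  obtain w where w: "K-lipschitz_on UNIV w" "\<And>x. x \<in> frontier \<Omega> \<Longrightarrow> w x = g x"
    and EL: "stationary \<Omega> c w"
    by (rule dirichlet_solution_exists[OF \<Omega> c K_less cR bsc]) (rule that)
  have gb: "C01 (closure \<Omega>) gbar" "\<And>x. x \<in> frontier \<Omega> \<Longrightarrow> gbar x = w x"
    using gbar(1) w(2) by (auto simp: S_class_def)
  have wT: "w \<in> truncated_class \<Omega> n gbar"
    unfolding truncated_class_def
    using lipschitz_in_W1p[OF \<Omega> w(1)] C01_diff_in_W1p_0[OF \<Omega> lipschitz_C01[OF w(1)] gb(1)] gb(2) n by auto
  have unT: "un \<in> truncated_class \<Omega> n gbar" and unle: "\<not> truncated_energy \<Omega> a n f w < truncated_energy \<Omega> a n f un"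
    using un wT by (auto simp: is_arg_min_def)
  have le: "(\<Sum>p=2..n. a p / real p * (LINT x|lebesgue_on \<Omega>. norm (weak_gradient \<Omega> un x) ^ p))
      \<le> (\<Sum>p=2..n. a p / real p * (LINT x|lebesgue_on \<Omega>. norm (weak_gradient \<Omega> w x) ^ p))"
    using unle energy_eq(2)[of \<Omega> f a n] f_zero by simp
  have eq: "AE x in lebesgue_on \<Omega>. weak_gradient \<Omega> un x = weak_gradient \<Omega> w x" "AE x in lebesgue_on \<Omega>. w x = un x"
    by (rule truncated_minimizer_gradient[OF \<Omega> _ a2 n c_def w(1) EL gb(1) _ unT le];
        use a_nonneg gb(2) in simp)+
  have unm: "weak_gradient \<Omega> un \<in> borel_measurable (lebesgue_on \<Omega>)"
    using unT by (auto simp: truncated_class_def W1p_def Lp_space_def)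
  have "AE x in lebesgue_on \<Omega>. norm (weak_gradient \<Omega> un x) \<le> K"
    using eq(1) weak_gradient_AE_grad(4)[OF \<Omega>(1) w(1)] by eventually_elim simp
  then show "Linf_norm \<Omega> (weak_gradient \<Omega> un) \<le> ereal K" by (rule Linf_norm_le[OF unm])
  have "(\<Sum>p=2..n. a p * p_form \<Omega> p w \<psi>) = 0" if \<psi>: "\<psi> \<in> W1inf_0 \<Omega>" for \<psi>
  proof -
    have "(\<lambda>j. c j * p_form \<Omega> (j + 2) w \<psi>) sums 0"
      by (rule p_form_sums_zero[OF \<Omega> c(1) cR w(1) EL weak_gradient_AE_grad(3)[OF \<Omega>(1) w(1)] _ \<psi>]) auto
    moreover have "(\<lambda>j. c j * p_form \<Omega> (j + 2) w \<psi>) sums (\<Sum>p=2..n. a p * p_form \<Omega> p w \<psi>)"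
      unfolding c_def by (rule sums_truncated[OF n, of a "\<lambda>p. p_form \<Omega> p w \<psi>"])
    ultimately show ?thesis by (rule sums_unique2[symmetric])
  qed
  then have "truncated_weak_solution \<Omega> a \<sigma> n f g w"
    using S_class[OF w] f0 by (simp add: truncated_weak_solution_def)
  then show "\<exists>w. (AE x in lebesgue_on \<Omega>. w x = un x) \<and> truncated_weak_solution \<Omega> a \<sigma> n f g w"
    using eq(2) by blast
qed

end
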